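(* Let $F=K(x,y)/K(x)$ be the Kummer extension defined by $y^m=f(x)=\alpha\prod_{i=1}^r p_i(x)^{\lambda_i}$ described in the context. Suppose that $d_s=\gcd(m,\lambda_s)=1$ for some $0\leq s\leq r$. Then for every $\lambda\in\mathbb{Z}$ with $\gcd(m,\lambda)=1$, $$G(Q_s)=\left\{mj+i\lambda\lambda_s \;\Big|\; 1\leq i\leq m-1,\ \left\lceil\frac{-i\lambda\lambda_s}{m}\right\rceil\leq j\leq \sum_{k=0}^r\left\lceil\frac{i\lambda\lambda_k}{m}\right\rceil d_k-\left\lceil\frac{i\lambda\lambda_s}{m}\right\rceil-1\right\},$$ where $i,j$ range over integers. In particular, if $\lambda\in\mathbb{Z}$ is an inverse of $\lambda_s$ modulo $m$, then $$G(Q_s)=\left\{mj+i \;\Big|\; 1\leq i\leq m-1,\ 0\leq j\leq \sum_{k=0}^r\left\lceil\frac{i\lambda\lambda_k}{m}\right\rceil d_k-2\right\}.$$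
   Context: Setting. Let $q$ be a prime power, $K$ an algebraic extension of $\mathbb{F}_q$, $m\geq 2$ an integer with $\gcd(m,q)=1$, and $r\geq 2$. Let $F=K(x,y)$ with $y^m=f(x)=\alpha\prod_{i=1}^r p_i(x)^{\lambda_i}$, where $\alpha\in K\setminus\{0\}$, $\lambda_i\in\mathbb{Z}\setminus\{0\}$, the $p_i(x)\in K[x]$ are pairwise distinct monic irreducible polynomials, and for every $d\mid m$ with $d\geq 2$, $f(x)$ is not a $d$-th power of an element of $K(x)$. ($K$ is not required to contain a primitive $m$-th root of unity; $K$ is the full constant field of $F$.) Put $d_i=\deg p_i$ for $1\leq i\leq r$, $d_0=1$, and $\lambda_0=-\sum_{i=1}^r\lambda_i d_i$. Let $P_i$ ($1\leq i\leq r$) be the place of $K(x)$ that is the zero of $p_i(x)$, and $P_0$ the pole of $x$. If $\gcd(m,\lambda_i)=1$, then $P_i$ is totally ramified in $F$ and $Q_i$ denotes the unique place of $F$ over $P_i$; it has degree $d_i$. For a rational (degree one) place $P$ of $F$, $H(P)=\{n\in\mathbb{N}_0 : \exists z\in F,\ (z)_\infty=nP\}$, where $(z)_\infty$ is the pole divisor, and $G(P)=\mathbb{N}_0\setminus H(P)$ is the set of gaps at $P$. *)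

theory Defs
  imports
    Complex_Main
    "HOL-Computational_Algebra.Polynomial"
    "HOL-Number_Theory.Number_Theory"
    "Jordan_Normal_Form.Matrix"
begin

section \<open>Subfields and algebraic elements\<close>

definition is_subfield :: "'a::field set \<Rightarrow> bool" where
  "is_subfield L \<longleftrightarrow> 1 \<in> L \<and> (\<forall>a\<in>L. \<forall>b\<in>L. a - b \<in> L \<and> a * b \<in> L) \<and> (\<forall>a\<in>L. inverse a \<in> L)"

definition adjoin :: "'a::field set \<Rightarrow> 'a set \<Rightarrow> 'a set" where
  "adjoin K S = is_subfield hull (K \<union> S)"

definition algebraic_over :: "'a::field set \<Rightarrow> 'a \<Rightarrow> bool" where
  "algebraic_over L z \<longleftrightarrow> (\<exists>g. g \<noteq> 0 \<and> set (coeffs g) \<subseteq> L \<and> poly g z = 0)"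


section \<open>Places of a function field\<close>

text \<open>
  The ambient field type plays the role of a large field; \<open>K \<subseteq> L\<close> are subfields of it and we
  consider the valuation rings and places of the function field \<open>L/K\<close>. Taking \<open>L = UNIV\<close>
  gives the places of the whole field. A place is identified with the maximal ideal of its
  valuation ring.
\<close>

definition valuation_ring :: "'a::field set \<Rightarrow> 'a set \<Rightarrow> 'a set \<Rightarrow> bool" where
  "valuation_ring K L A \<longleftrightarrow>
     K \<subset> A \<and> A \<subset> L \<and> (\<forall>a\<in>A. \<forall>b\<in>A. a - b \<in> A \<and> a * b \<in> A) \<and>
     (\<forall>z\<in>L. z \<in> A \<or> inverse z \<in> A)"

text \<open>A valuation ring is local, so its maximal ideal is the set of its non-units.\<close>

definition is_place :: "'a::field set \<Rightarrow> 'a set \<Rightarrow> 'a set \<Rightarrow> bool" where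
  "is_place K L P \<longleftrightarrow> (\<exists>A. valuation_ring K L A \<and> P = {z \<in> A. \<not> (\<exists>w\<in>A. z * w = 1)})"

text \<open>The valuation ring is recovered from its maximal ideal \<open>P\<close> as the set of all \<open>z\<close> in \<open>L\<close>
  with \<open>1/z \<notin> P\<close>; the element \<open>0\<close> needs separate treatment as \<open>inverse 0 = 0\<close>.\<close>

definition place_ring :: "'a::field set \<Rightarrow> 'a set \<Rightarrow> 'a set" where
  "place_ring L P = {z \<in> L. z = 0 \<or> inverse z \<notin> P}"

definition prime_element_of :: "'a::field set \<Rightarrow> 'a set \<Rightarrow> 'a \<Rightarrow> bool" where
  "prime_element_of L P t \<longleftrightarrow> t \<in> P \<and> P = {t * u | u. u \<in> place_ring L P}"

text \<open>The discrete valuation at \<open>P\<close>: every nonzero \<open>z\<close> in \<open>L\<close> is uniquely \<open>t\<^sup>n u\<close> with \<open>t\<close> a prime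
  element and \<open>u\<close> a unit. The value at \<open>z = 0\<close> (infinity) is left unspecified and never used.\<close>

definition place_val :: "'a::field set \<Rightarrow> 'a set \<Rightarrow> 'a \<Rightarrow> int" where
  "place_val L P z =
     (THE n. \<exists>t u. prime_element_of L P t \<and> u \<noteq> 0 \<and> u \<in> place_ring L P \<and>
                   inverse u \<in> place_ring L P \<and> z = t powi n * u)"

text \<open>The following three are meant for elements and places for which the described place
  is unique.\<close>

definition the_zero :: "'a::field set \<Rightarrow> 'a set \<Rightarrow> 'a \<Rightarrow> 'a set" where
  "the_zero K L z = (THE P. is_place K L P \<and> place_val L P z > 0)"

definition the_pole :: "'a::field set \<Rightarrow> 'a set \<Rightarrow> 'a \<Rightarrow> 'a set" where
  "the_pole K L z = (THE P. is_place K L P \<and> place_val L P z < 0)"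

definition the_place_above :: "'a::field set \<Rightarrow> 'a set \<Rightarrow> 'a set \<Rightarrow> 'a set" where
  "the_place_above K L P = (THE Q. is_place K L Q \<and> P \<subseteq> Q)"


section \<open>Pole divisors, the Weierstrass semigroup and its gaps\<close>

text \<open>A divisor is represented by its coefficient function, which vanishes outside the places.\<close>

definition pole_divisor :: "'a::field set \<Rightarrow> 'a set \<Rightarrow> 'a \<Rightarrow> 'a set \<Rightarrow> int" where
  "pole_divisor K L z = (\<lambda>P. if is_place K L P then max 0 (- place_val L P z) else 0)"

definition point_divisor :: "nat \<Rightarrow> 'a set \<Rightarrow> 'a set \<Rightarrow> int" where
  "point_divisor n P = (\<lambda>Q. if Q = P then int n else 0)"

definition weierstrass_semigroup :: "'a::field set \<Rightarrow> 'a set \<Rightarrow> 'a set \<Rightarrow> nat set" where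
  "weierstrass_semigroup K L P =
     {n. \<exists>z\<in>L. z \<noteq> 0 \<and> pole_divisor K L z = point_divisor n P}"

definition gaps :: "'a::field set \<Rightarrow> 'a set \<Rightarrow> 'a set \<Rightarrow> nat set" where
  "gaps K L P = UNIV - weierstrass_semigroup K L P"

end

theory Submission
  imports
    "HOL-Algebra.Algebraic_Closure_Type"
    "Jordan_Normal_Form.Char_Poly"
    Defs
begin

text \<open>
  A Moebius transformation moves the rational place \<open>P\<^sub>s\<close> to the pole of a generator \<open>t\<close> of \<open>K(x)\<close>. There
  the valuation of \<open>f\<close> is prime to \<open>m\<close>, so the valuations of the terms of \<open>z = \<Sum>i<m. a\<^sub>i y\<^sup>i\<close> are
  pairwise distinct and the pole order of \<open>z\<close> at \<open>Q\<^sub>s\<close> is that of one of its terms. The function \<open>z\<close>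
  has no other poles iff no term \<open>a\<^sub>i y\<^sup>i\<close> has: in the algebraic closure of \<open>F\<close> the conjugates
  \<open>y \<mapsto> \<zeta> y\<close>, with \<open>\<zeta>\<^sup>m = 1\<close>, recover \<open>m a\<^sub>i y\<^sup>i\<close> from \<open>z\<close>, and an element of \<open>K(t)\<close> that lies in every valuation
  ring containing \<open>K[t]\<close> is a polynomial. Hence the pole numbers at \<open>Q\<^sub>s\<close> are the degrees of the polynomials of
  the form \<open>a\<^sup>m f\<^sup>i\<close> with \<open>a \<in> K(t)\<close>, which unique factorization determines.
\<close>

section \<open>Valuation rings\<close>

text \<open>The field \<open>K\<close> need not contain the m-th roots of unity, so conjugates of
  \<open>z\<close> leave \<open>F\<close>. The test for being a polynomial is therefore stated along
  an arbitrary embedding of \<open>F\<close> and used for the algebraic closure; the valuation rings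
  it needs come from Chevalley's theorem and need not be discrete. Discreteness matters for
  \<open>place_val\<close>, whose \<open>THE\<close> is meaningful only if nonzero elements are
  powers of a prime element times units; hence a uniformizer is produced at every place of
  \<open>K(t)\<close> and \<open>F\<close>. Normalise the valuation at the ramified place by v(1/t)
  = m. Then v(y) is the order l of f at the pole of t, and coprimality of l and m yields the
  independence of 1, y, ..., y^(m-1), the uniqueness of the place and, by Bezout, its uniformizer.
  Each residue class modulo m has a least pole number: in a^m f^i the m-th powers of the p_k are
  absorbed into a, and what remains has degree sum of d_k ((i lam_k) mod m). The gaps are the
  smaller natural numbers of the class, and m ceil(c/m) = c + (-c mod m) turns remainders into
  ceilings.\<close>

lemma is_subfieldD:
  assumes "is_subfield L"
  shows "1 \<in> L" "0 \<in> L"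
    "a \<in> L \<Longrightarrow> b \<in> L \<Longrightarrow> a - b \<in> L" "a \<in> L \<Longrightarrow> b \<in> L \<Longrightarrow> a * b \<in> L"
    "a \<in> L \<Longrightarrow> - a \<in> L" "a \<in> L \<Longrightarrow> b \<in> L \<Longrightarrow> a + b \<in> L"
    "a \<in> L \<Longrightarrow> inverse a \<in> L" "a \<in> L \<Longrightarrow> b \<in> L \<Longrightarrow> a / b \<in> L" "a \<in> L \<Longrightarrow> a ^ n \<in> L"
    "a \<in> L \<Longrightarrow> a powi k \<in> L"
proof -
  show one: "1 \<in> L" and diff: "\<And>a b. a \<in> L \<Longrightarrow> b \<in> L \<Longrightarrow> a - b \<in> L"
    and mult: "\<And>a b. a \<in> L \<Longrightarrow> b \<in> L \<Longrightarrow> a * b \<in> L"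
    and inv: "\<And>a. a \<in> L \<Longrightarrow> inverse a \<in> L"
    using assms by (auto simp: is_subfield_def)
  show zero: "0 \<in> L" using diff[OF one one] by simp
  show minus: "- a \<in> L" if "a \<in> L" for a using diff[OF zero that] by simp
  show "a + b \<in> L" if "a \<in> L" "b \<in> L" for a b using diff[OF that(1) minus[OF that(2)]] by simp
  show "a / b \<in> L" if "a \<in> L" "b \<in> L" for a b
    using mult[OF that(1) inv[OF that(2)]] by (simp add: divide_inverse)
  show pow: "a ^ n \<in> L" if "a \<in> L" for a n
    by (induction n) (use one mult that in auto)
  show "a powi k \<in> L" if "a \<in> L" for a k
    using pow[OF that] pow[OF inv[OF that]] by (auto simp: power_int_def)
qed

text \<open>Constants and properness are left out: \<open>A = L\<close> is allowed, so preimages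
  under embeddings and restrictions to subfields stay in the locale without a check that they are
  nontrivial.\<close>

locale vring =
  fixes L A :: "'a::field set"
  assumes subfield: "is_subfield L" and sub: "A \<subseteq> L"
    and diff: "\<And>a b. a \<in> A \<Longrightarrow> b \<in> A \<Longrightarrow> a - b \<in> A"
    and mult: "\<And>a b. a \<in> A \<Longrightarrow> b \<in> A \<Longrightarrow> a * b \<in> A"
    and total: "\<And>z. z \<in> L \<Longrightarrow> z \<in> A \<or> inverse z \<in> A"
begin

definition units :: "'a set" where
  "units = {z \<in> A. z \<noteq> 0 \<and> inverse z \<in> A}"

definition max_ideal :: "'a set" where
  "max_ideal = {z \<in> A. \<not> (\<exists>w\<in>A. z * w = 1)}"

lemmas L_rules = is_subfieldD[OF subfield]

lemma one: "1 \<in> A"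
  using total[of 1] L_rules(1) by auto

lemma zero: "0 \<in> A"
  using diff[OF one one] by simp

lemma minus: "a \<in> A \<Longrightarrow> - a \<in> A"
  using diff[OF zero, of a] by simp

lemma add: "a \<in> A \<Longrightarrow> b \<in> A \<Longrightarrow> a + b \<in> A"
  using diff[of a "- b"] minus[of b] by simp

lemma power: "a \<in> A \<Longrightarrow> a ^ n \<in> A"
  by (induction n) (auto intro: one mult)

lemma sum: "(\<And>i. i \<in> I \<Longrightarrow> g i \<in> A) \<Longrightarrow> sum g I \<in> A"
  by (induction I rule: infinite_finite_induct) (auto intro: zero add)

lemma max_ideal_iff: "z \<in> max_ideal \<longleftrightarrow> z \<in> L \<and> (z = 0 \<or> inverse z \<notin> A)"
proof (cases "z = 0")
  case True
  then show ?thesis using zero L_rules(2) by (auto simp: max_ideal_def)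
next
  case False
  have "(\<exists>w\<in>A. z * w = 1) \<longleftrightarrow> inverse z \<in> A"
    using False by (metis right_inverse inverse_unique)
  then show ?thesis using False total[of z] sub by (auto simp: max_ideal_def)
qed

lemma max_ideal_sub: "max_ideal \<subseteq> A"
  by (auto simp: max_ideal_def)

lemma place_ring_max_ideal: "place_ring L max_ideal = A"
  using sub L_rules(7) zero by (auto simp: place_ring_def max_ideal_iff)

lemma not_in_iff: "z \<in> L \<Longrightarrow> z \<notin> A \<longleftrightarrow> z \<noteq> 0 \<and> inverse z \<in> max_ideal"
  using L_rules(7) zero by (auto simp: max_ideal_iff)

lemma units_iff: "z \<in> units \<longleftrightarrow> z \<in> A \<and> z \<notin> max_ideal"
  using sub by (auto simp: max_ideal_iff units_def)

lemma max_ideal_mult: "a \<in> max_ideal \<Longrightarrow> b \<in> A \<Longrightarrow> a * b \<in> max_ideal"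
proof (cases "a * b = 0")
  case True
  then show ?thesis using L_rules(2) by (metis max_ideal_iff)
next
  case False
  assume a: "a \<in> max_ideal" and b: "b \<in> A"
  have "inverse (a * b) \<notin> A"
  proof
    assume "inverse (a * b) \<in> A"
    with b have "b * inverse (a * b) \<in> A" by (rule mult)
    then have "inverse a \<in> A" using False by (simp add: field_simps)
    with a False show False by (simp add: max_ideal_iff)
  qed
  then show ?thesis using a b sub L_rules(4)[of a b] by (auto simp: max_ideal_iff)
qed

text \<open>One of \<open>a / b\<close> and \<open>b / a\<close> lies in \<open>A\<close>, so the
  sum is a multiple of one summand.\<close>

lemma max_ideal_add:
  assumes "a \<in> max_ideal" "b \<in> max_ideal"
  shows "a + b \<in> max_ideal"
proof (cases "a = 0 \<or> b = 0")
  case True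
  then show ?thesis using assms by auto
next
  case False
  have *: "a + b \<in> max_ideal" if "a / b \<in> A" "b \<in> max_ideal" "b \<noteq> 0" for a b
  proof -
    have "a + b = b * (a / b + 1)" using that(3) by (simp add: field_simps)
    then show ?thesis using max_ideal_mult[OF that(2) add[OF that(1) one]] by simp
  qed
  have "a / b \<in> A \<or> b / a \<in> A"
    using total[of "a / b"] assms L_rules(8) max_ideal_iff by auto
  then show ?thesis
    using *[of a b] *[of b a] False assms by (auto simp: add.commute)
qed

lemma one_notin_max_ideal: "1 \<notin> max_ideal"
  using one by (auto simp: max_ideal_iff)

lemma zero_in_max_ideal: "0 \<in> max_ideal"
  using L_rules(2) by (auto simp: max_ideal_iff)

lemma max_ideal_sum: "(\<And>i. i \<in> I \<Longrightarrow> g i \<in> max_ideal) \<Longrightarrow> sum g I \<in> max_ideal"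
  by (induction I rule: infinite_finite_induct) (auto intro: max_ideal_add zero_in_max_ideal)

lemma unit_add_max_ideal:
  assumes "u \<in> units" "b \<in> max_ideal"
  shows "u + b \<in> units"
proof -
  have "u + b \<notin> max_ideal"
  proof
    assume "u + b \<in> max_ideal"
    moreover have "- b \<in> max_ideal" using max_ideal_mult[OF assms(2) minus[OF one]] by simp
    ultimately have "u \<in> max_ideal" using max_ideal_add[of "u + b" "- b"] by simp
    then show False using assms(1) by (simp add: units_iff)
  qed
  then show ?thesis
    using assms max_ideal_sub by (auto simp: units_iff intro: add)
qed

lemma units_one: "1 \<in> units"
  by (simp add: units_def one)

lemma units_mult: "a \<in> units \<Longrightarrow> b \<in> units \<Longrightarrow> a * b \<in> units"
  by (auto simp: units_def mult)

lemma units_inverse: "a \<in> units \<Longrightarrow> inverse a \<in> units"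
  by (auto simp: units_def)

lemma units_divide: "a \<in> units \<Longrightarrow> b \<in> units \<Longrightarrow> a / b \<in> units"
  by (simp add: divide_inverse units_mult units_inverse)

lemma units_power: "a \<in> units \<Longrightarrow> a ^ n \<in> units"
  by (induction n) (auto intro: units_one units_mult)

lemma units_powi: "a \<in> units \<Longrightarrow> a powi n \<in> units"
  by (auto simp: power_int_def intro: units_power units_inverse)

lemma units_L: "a \<in> units \<Longrightarrow> a \<in> L \<and> a \<noteq> 0 \<and> a \<in> A"
  using sub by (auto simp: units_def)

lemma max_ideal_power: "a \<in> max_ideal \<Longrightarrow> n > 0 \<Longrightarrow> a ^ n \<in> max_ideal"
  by (induction n) (use max_ideal_mult max_ideal_sub power in \<open>auto\<close>)

text \<open>The case X^n = c of integral closedness. It carries facts about m-th powers, which can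
  be computed in K(t), over to \<open>y\<close> and its multiples.\<close>

lemma root_closed:
  assumes "z \<in> L" "z ^ n \<in> A" "n > 0"
  shows "z \<in> A"
proof (rule ccontr)
  assume "z \<notin> A"
  then have z: "z \<noteq> 0" "inverse z \<in> max_ideal" using not_in_iff[OF assms(1)] by auto
  from max_ideal_power[OF z(2) assms(3)] have "inverse (z ^ n) \<in> max_ideal"
    by (simp add: power_inverse)
  with z(1) assms(2) show False using max_ideal_iff[of "inverse (z ^ n)"] by auto
qed

lemma root_units:
  assumes "z \<in> L" "z ^ n \<in> units" "n > 0"
  shows "z \<in> units"
proof -
  have "z \<in> A" "inverse z \<in> A"
    using root_closed[of z n] root_closed[of "inverse z" n] assms L_rules(7)
    by (auto simp: units_def power_inverse)
  then show ?thesis using assms by (auto simp: units_def power_0_left)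
qed

section \<open>Uniformizers and the discrete valuation\<close>

lemma powi_in_A_iff:
  assumes "t \<in> max_ideal" "t \<noteq> 0"
  shows "t powi n \<in> A \<longleftrightarrow> n \<ge> 0" "t powi n \<in> max_ideal \<longleftrightarrow> n > 0"
proof -
  have pos: "t powi k \<in> max_ideal" if "k > 0" for k
    using max_ideal_power[OF assms(1), of "nat k"] that by (simp add: power_int_def)
  have neg: "t powi k \<notin> A" if "k < 0" for k
    using pos[of "- k"] that assms(2) by (auto simp: max_ideal_iff power_int_minus)
  show "t powi n \<in> A \<longleftrightarrow> n \<ge> 0" "t powi n \<in> max_ideal \<longleftrightarrow> n > 0"
    using pos[of n] neg[of n] max_ideal_sub one one_notin_max_ideal
    by (cases "n = 0"; force)+
qed

lemma mult_unit_in_A_iff: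
  assumes "u \<in> units"
  shows "z * u \<in> A \<longleftrightarrow> z \<in> A" "z * u \<in> max_ideal \<longleftrightarrow> z \<in> max_ideal"
proof -
  have "z = z * u * inverse u" using assms by (auto simp: units_def)
  then show "z * u \<in> A \<longleftrightarrow> z \<in> A" "z * u \<in> max_ideal \<longleftrightarrow> z \<in> max_ideal"
    using mult max_ideal_mult assms by (metis units_L units_inverse)+
qed

lemma powi_unit_unique:
  assumes t: "t \<in> max_ideal" "t \<noteq> 0" and u: "u \<in> units" "w \<in> units"
    and eq: "t powi n * u = t powi k * w"
  shows "n = k"
proof -
  have "t powi (n - k) = w / u" "t powi (k - n) = u / w"
    using eq t(2) units_L[OF u(1)] units_L[OF u(2)] by (auto simp: power_int_diff field_simps)
  then have "t powi (n - k) \<in> A" "t powi (k - n) \<in> A"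
    using units_L[OF units_divide[OF u(2,1)]] units_L[OF units_divide[OF u]] by auto
  then show ?thesis using powi_in_A_iff[OF t] by auto
qed

text \<open>Stronger than \<open>prime_element_of\<close>: a valuation ring of higher rank can have
  a principal maximal ideal whose generator does not reach all elements as
  \<open>t powi n * u\<close>.\<close>

definition uniformizer :: "'a \<Rightarrow> bool" where
  "uniformizer t \<longleftrightarrow> t \<noteq> 0 \<and> t \<in> max_ideal \<and>
     (\<forall>z\<in>L. z \<noteq> 0 \<longrightarrow> (\<exists>n. \<exists>u\<in>units. z = t powi n * u))"

lemma uniformizer_prime_element:
  assumes "uniformizer t"
  shows "prime_element_of L max_ideal t"
proof -
  have t: "t \<noteq> 0" "t \<in> max_ideal" using assms by (auto simp: uniformizer_def)
  have "\<exists>u. z = t * u \<and> u \<in> A" if z: "z \<in> max_ideal" for z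
  proof (cases "z = 0")
    case True
    then show ?thesis using zero by auto
  next
    case False
    moreover have "z \<in> L" using z by (simp add: max_ideal_iff)
    ultimately obtain n u where u: "u \<in> units" "z = t powi n * u"
      using assms by (auto simp: uniformizer_def)
    have "n > 0"
      using z mult_unit_in_A_iff[OF u(1)] powi_in_A_iff[OF t(2,1)] u(2) by auto
    then have "t powi (n - 1) * u \<in> A"
      using powi_in_A_iff[OF t(2,1)] units_L[OF u(1)] by (auto intro!: mult)
    moreover have "z = t * (t powi (n - 1) * u)"
      using u(2) t(1) by (simp add: power_int_diff)
    ultimately show ?thesis by blast
  qed
  then show ?thesis
    using t max_ideal_mult by (auto simp: prime_element_of_def place_ring_max_ideal)
qed

lemma prime_element_dvd:
  assumes "prime_element_of L max_ideal t" "uniformizer t0"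
  shows "t \<noteq> 0" "t / t0 \<in> units"
proof -
  note t0 = uniformizer_prime_element[OF assms(2)]
  have t0': "t0 \<noteq> 0" "t0 \<in> max_ideal" using assms(2) by (auto simp: uniformizer_def)
  from t0' assms(1) obtain u where u: "t0 = t * u" "u \<in> A"
    by (auto simp: prime_element_of_def place_ring_max_ideal)
  have "t \<in> max_ideal" using assms(1) by (simp add: prime_element_of_def)
  with t0 obtain w where w: "t = t0 * w" "w \<in> A"
    by (auto simp: prime_element_of_def place_ring_max_ideal)
  show "t \<noteq> 0" using u t0' by auto
  have "t0 * (u * w) = t0 * 1" using u w by (simp add: mult_ac)
  then have "u * w = 1" using t0'(1) by (metis mult_left_cancel)
  then have "w \<noteq> 0" "inverse w = u" by (auto simp: inverse_unique mult.commute)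
  then show "t / t0 \<in> units" using u w t0' by (auto simp: units_def)
qed

text \<open>The \<open>THE\<close> in \<open>place_val\<close> ranges over all prime elements; two
  of them differ by a unit, which changes the unit part but not the exponent.\<close>

lemma place_val_eq:
  assumes t: "uniformizer t" and u: "u \<in> units"
  shows "place_val L max_ideal (t powi n * u) = n"
  unfolding place_val_def
proof (rule the_equality)
  show "\<exists>t' u'. prime_element_of L max_ideal t' \<and> u' \<noteq> 0 \<and> u' \<in> place_ring L max_ideal \<and>
      inverse u' \<in> place_ring L max_ideal \<and> t powi n * u = t' powi n * u'"
    using uniformizer_prime_element[OF t] u by (auto simp: place_ring_max_ideal units_def)
next
  fix k
  assume "\<exists>t' u'. prime_element_of L max_ideal t' \<and> u' \<noteq> 0 \<and> u' \<in> place_ring L max_ideal \<and>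
      inverse u' \<in> place_ring L max_ideal \<and> t powi n * u = t' powi k * u'"
  then obtain t' u' where t': "prime_element_of L max_ideal t'" and u': "u' \<in> units"
    and eq: "t powi n * u = t' powi k * u'"
    by (auto simp: place_ring_max_ideal units_def)
  define w where "w = t' / t"
  have t0: "t \<noteq> 0" "t \<in> max_ideal" using t by (auto simp: uniformizer_def)
  have w: "w \<in> units" "t' = t * w" using prime_element_dvd[OF t' t] t0 by (auto simp: w_def)
  have "t powi n * u = t powi k * (w powi k * u')"
    by (simp add: eq w(2) power_int_mult_distrib mult.assoc)
  from powi_unit_unique[OF t0(2,1) u units_mult[OF units_powi[OF w(1)] u'] this]
  show "k = n" by simp
qed

lemma place_val_sign:
  assumes "uniformizer t" "z \<in> L" "z \<noteq> 0"
  shows "place_val L max_ideal z \<ge> 0 \<longleftrightarrow> z \<in> A" "place_val L max_ideal z > 0 \<longleftrightarrow> z \<in> max_ideal"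
proof -
  obtain n u where u: "u \<in> units" "z = t powi n * u" using assms by (auto simp: uniformizer_def)
  have t: "t \<in> max_ideal" "t \<noteq> 0" using assms(1) by (auto simp: uniformizer_def)
  show "place_val L max_ideal z \<ge> 0 \<longleftrightarrow> z \<in> A" "place_val L max_ideal z > 0 \<longleftrightarrow> z \<in> max_ideal"
    using place_val_eq[OF assms(1) u(1), of n] u(2) mult_unit_in_A_iff[OF u(1)] powi_in_A_iff[OF t]
    by auto
qed

text \<open>The exponent of \<open>z ^ N\<close> is an integral valuation under which
  \<open>t\<close> has value N. Its value group is a nonzero subgroup of the integers, hence cyclic,
  and an element of least positive value is a uniformizer.\<close>

lemma uniformizer_of_root:
  assumes t: "t \<in> max_ideal" "t \<noteq> 0" and N: "N > 0"
    and pow: "\<And>z. z \<in> L \<Longrightarrow> z \<noteq> 0 \<Longrightarrow> \<exists>k. \<exists>u\<in>units. z ^ N = t powi k * u"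
  shows "\<exists>p. uniformizer p"
proof -
  define v where "v z = (SOME k. \<exists>u\<in>units. z ^ N = t powi k * u)" for z
  have v: "\<exists>u\<in>units. z ^ N = t powi (v z) * u" if "z \<in> L" "z \<noteq> 0" for z
    unfolding v_def by (rule someI_ex) (rule pow[OF that])
  have v_uniq: "v z = k" if z: "z \<in> L" "z \<noteq> 0" "u \<in> units" "z ^ N = t powi k * u" for z k u
  proof -
    obtain w where "w \<in> units" "z ^ N = t powi (v z) * w" using v[OF z(1,2)] by auto
    then show ?thesis using powi_unit_unique[OF t, of w u "v z" k] z(3,4) by simp
  qed
  have tL: "t \<in> L" using t(1) by (simp add: max_ideal_iff)
  have vt: "v t = int N"
    using v_uniq[of t 1 "int N"] tL t(2) units_one by simp
  have vpos: "v z > 0 \<longleftrightarrow> z \<in> max_ideal" if z: "z \<in> L" "z \<noteq> 0" for z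
  proof -
    obtain u where u: "u \<in> units" "z ^ N = t powi (v z) * u" using v[OF z] by auto
    have "z ^ N \<in> max_ideal \<longleftrightarrow> v z > 0"
      using u mult_unit_in_A_iff[OF u(1)] powi_in_A_iff[OF t] by simp
    moreover have "z ^ N \<in> max_ideal \<longleftrightarrow> z \<in> max_ideal"
    proof
      assume "z ^ N \<in> max_ideal"
      then have "inverse z ^ N \<notin> A" using z by (simp add: max_ideal_iff power_inverse)
      then show "z \<in> max_ideal"
        using power[of "inverse z" N] z by (auto simp: max_ideal_iff)
    qed (rule max_ideal_power[OF _ N])
    ultimately show ?thesis by simp
  qed
  define S where "S = {nat (v z) | z. z \<in> L \<and> z \<noteq> 0 \<and> v z > 0}"
  have "v t > 0" using vt N by simp
  then have "nat (v t) \<in> S" unfolding S_def using tL t(2) by blast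
  then obtain k0 where k0: "k0 \<in> S" "\<And>k. k \<in> S \<Longrightarrow> k0 \<le> k"
    using LeastI[of "\<lambda>k. k \<in> S"] Least_le[of "\<lambda>k. k \<in> S"] by blast
  obtain p where p: "p \<in> L" "p \<noteq> 0" "v p > 0" "nat (v p) = k0"
    using k0(1) unfolding S_def by auto
  have least: "v p \<le> v z" if "z \<in> L" "z \<noteq> 0" "v z > 0" for z
  proof -
    have "nat (v z) \<in> S" unfolding S_def using that by blast
    from k0(2)[OF this] p(3,4) show ?thesis by linarith
  qed
  obtain w where w: "w \<in> units" "p ^ N = t powi (v p) * w" using v[OF p(1,2)] by auto
  have "\<exists>n. \<exists>u\<in>units. z = p powi n * u" if z: "z \<in> L" "z \<noteq> 0" for z
  proof -
    \<comment> \<open>Division with remainder by the least value: \<open>z'\<close> has value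
      \<open>v z mod v p\<close>, which minimality forces to be 0, so \<open>z'\<close> is a
      unit.\<close>
    define n where "n = v z div v p"
    define z' where "z' = z / p powi n"
    have z': "z' \<in> L" "z' \<noteq> 0" using z p L_rules(8,10) by (auto simp: z'_def)
    obtain u where u: "u \<in> units" "z ^ N = t powi (v z) * u" using v[OF z] by auto
    have "(p powi n) ^ N = (p ^ N) powi n"
      by (metis power_int_mult power_int_of_nat mult.commute)
    then have "z' ^ N = z ^ N / (p ^ N) powi n"
      unfolding z'_def power_divide by (rule arg_cong)
    also have "\<dots> = t powi (v z) / t powi (v p * n) * (u / w powi n)"
      unfolding u(2) w(2) power_int_mult_distrib power_int_mult by (simp only: times_divide_times_eq)
    also have "t powi (v z) / t powi (v p * n) = t powi (v z mod v p)"
      using t(2) by (simp add: power_int_diff[symmetric] n_def minus_mult_div_eq_mod)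
    finally have eq: "z' ^ N = t powi (v z mod v p) * (u / w powi n)" .
    have uu: "u / w powi n \<in> units" by (intro units_divide units_powi u w)
    from v_uniq[OF z' uu eq] have "v z' = v z mod v p" .
    moreover have "v z mod v p < v p" "v z mod v p \<ge> 0" using p(3) by auto
    ultimately have "v z mod v p = 0" using least[OF z'] by linarith
    then have "z' ^ N \<in> units" using eq uu by (metis mult_1 power_int_0_right)
    then have "z' \<in> units" using root_units[OF z'(1)] N by blast
    moreover have "z = p powi n * z'" using p(2) by (simp add: z'_def)
    ultimately show ?thesis by blast
  qed
  moreover have "p \<in> max_ideal" using p(3) vpos[OF p(1,2)] by blast
  ultimately have "uniformizer p" using p(2) unfolding uniformizer_def by blast
  then show ?thesis by blast
qed

section \<open>Sums with a dominant term\<close>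

lemma dominant_sum:
  assumes "finite I" "i0 \<in> I" "g i0 \<noteq> 0" "\<And>i. i \<in> I - {i0} \<Longrightarrow> g i / g i0 \<in> max_ideal"
  shows "sum g I / g i0 \<in> units"
proof -
  have "sum g I / g i0 = 1 + (\<Sum>i\<in>I - {i0}. g i / g i0)"
    using assms(1-3) by (simp add: sum.remove add_divide_distrib sum_divide_distrib)
  also have "\<dots> \<in> units"
    by (intro unit_add_max_ideal units_one max_ideal_sum assms(4))
  finally show ?thesis .
qed

text \<open>Pairwise different values in a finite family have a unique minimum. Together with
  \<open>dominant_sum\<close> this forces two terms of a vanishing sum to have equal value.\<close>

lemma ex_dominant:
  assumes "finite I" "I \<noteq> {}" "\<And>i. i \<in> I \<Longrightarrow> g i \<noteq> 0 \<and> g i \<in> L"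
    "\<And>i j. i \<in> I \<Longrightarrow> j \<in> I \<Longrightarrow> i \<noteq> j \<Longrightarrow> g i / g j \<notin> units"
  shows "\<exists>i0\<in>I. \<forall>i\<in>I - {i0}. g i / g i0 \<in> max_ideal"
  using assms
proof (induction I rule: finite_ne_induct)
  case (singleton i)
  then show ?case by auto
next
  case (insert k I)
  then obtain i0 where i0: "i0 \<in> I" "\<And>i. i \<in> I - {i0} \<Longrightarrow> g i / g i0 \<in> max_ideal"
    by (metis insertCI)
  have nz: "g k \<noteq> 0" "g i0 \<noteq> 0" "g k / g i0 \<in> L" "k \<noteq> i0"
    using insert.prems(1)[of k] insert.prems(1)[of i0] i0(1) insert.hyps L_rules(8) by auto
  show ?case
  proof (cases "g k / g i0 \<in> A")
    case True
    then have "g k / g i0 \<in> max_ideal"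
      using insert.prems(2)[of k i0] i0(1) nz(4) by (auto simp: units_iff)
    then show ?thesis using i0 by (intro bexI[of _ i0]) auto
  next
    case False
    then have "g i0 / g k \<in> max_ideal" using not_in_iff[OF nz(3)] by simp
    moreover have "g i / g k \<in> max_ideal" if "i \<in> I - {i0}" for i
      using max_ideal_mult[OF i0(2)[OF that]] max_ideal_sub \<open>g i0 / g k \<in> max_ideal\<close> nz
      by (force simp: field_simps)
    ultimately show ?thesis by (intro bexI[of _ k]) auto
  qed
qed

end

lemma valuation_ring_vring:
  "is_subfield L \<Longrightarrow> valuation_ring K L A \<Longrightarrow> vring L A"
  by unfold_locales (auto simp: valuation_ring_def)

lemma is_subfield_UNIV: "is_subfield UNIV"
  by (simp add: is_subfield_def)

lemma is_place_iff:
  assumes "is_subfield L"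
  shows "is_place K L P \<longleftrightarrow> (\<exists>A. valuation_ring K L A \<and> P = vring.max_ideal A)"
proof -
  have "vring.max_ideal A = {z \<in> A. \<not> (\<exists>w\<in>A. z * w = 1)}" if "valuation_ring K L A" for A
    using vring.max_ideal_def[OF valuation_ring_vring[OF assms that]] .
  then show ?thesis unfolding is_place_def by (intro ex_cong1 conj_cong) simp_all
qed

lemma max_ideal_inj:
  assumes "vring L A" "vring L B" "vring.max_ideal A = vring.max_ideal B"
  shows "A = B"
  by (rule trans[OF sym trans])
    (fact vring.place_ring_max_ideal[OF assms(1)] arg_cong[OF assms(3)]
      vring.place_ring_max_ideal[OF assms(2)])+

section \<open>Existence of valuation rings\<close>

definition is_subring :: "'a::comm_ring_1 set \<Rightarrow> bool" where
  "is_subring R \<longleftrightarrow> 1 \<in> R \<and> (\<forall>a\<in>R. \<forall>b\<in>R. a - b \<in> R \<and> a * b \<in> R)"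

lemma is_subringD:
  assumes "is_subring R"
  shows "1 \<in> R" "0 \<in> R" "a \<in> R \<Longrightarrow> b \<in> R \<Longrightarrow> a - b \<in> R" "a \<in> R \<Longrightarrow> b \<in> R \<Longrightarrow> a * b \<in> R"
    "a \<in> R \<Longrightarrow> - a \<in> R" "a \<in> R \<Longrightarrow> b \<in> R \<Longrightarrow> a + b \<in> R" "a \<in> R \<Longrightarrow> a ^ n \<in> R"
    "(\<And>i. i \<in> I \<Longrightarrow> g i \<in> R) \<Longrightarrow> sum g I \<in> R"
proof -
  show one: "1 \<in> R" and diff: "\<And>a b. a \<in> R \<Longrightarrow> b \<in> R \<Longrightarrow> a - b \<in> R"
    and mult: "\<And>a b. a \<in> R \<Longrightarrow> b \<in> R \<Longrightarrow> a * b \<in> R"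
    using assms by (auto simp: is_subring_def)
  show zero: "0 \<in> R" using diff[OF one one] by simp
  show minus: "- a \<in> R" if "a \<in> R" for a using diff[OF zero that] by simp
  show add: "a + b \<in> R" if "a \<in> R" "b \<in> R" for a b using diff[OF that(1) minus[OF that(2)]] by simp
  show "a ^ n \<in> R" if "a \<in> R" for a n
    by (induction n) (use one mult that in auto)
  show "sum g I \<in> R" if "\<And>i. i \<in> I \<Longrightarrow> g i \<in> R" for g and I :: "'z set"
    using that by (induction I rule: infinite_finite_induct) (auto intro: zero add)
qed

lemma is_subring_adjoin:
  assumes "is_subring R"
  shows "is_subring {poly g z | g. \<forall>i. coeff g i \<in> R}" (is "is_subring ?S")
proof -
  note R = is_subringD[OF assms]
  have "1 \<in> ?S" using R(1,2) by (auto intro!: exI[of _ 1] simp: coeff_1)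
  moreover have "poly g z - poly h z \<in> ?S"
    if "\<forall>i. coeff g i \<in> R" "\<forall>i. coeff h i \<in> R" for g h
    using that R(3) by (auto intro!: exI[of _ "g - h"])
  moreover have "poly g z * poly h z \<in> ?S"
    if "\<forall>i. coeff g i \<in> R" "\<forall>i. coeff h i \<in> R" for g h
    using that R(4) by (auto intro!: exI[of _ "g * h"] R(8) simp: coeff_mult)
  ultimately show ?thesis by (auto simp: is_subring_def)
qed

text \<open>The descent step of Chevalley's extension theorem: of the two relations
  \<open>poly G z = 1\<close> and \<open>poly H (1 / z) = 1\<close> with coefficients in the ideal generated by \<open>u\<close>,
  the one of larger degree can be shortened.\<close>

lemma shorten_relation:
  fixes z u :: "'a::field"
  assumes B: "is_subring B" and u: "u \<in> B" "inverse u \<notin> B"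
    and local: "\<And>b. b \<in> B \<Longrightarrow> inverse (1 - u * b) \<in> B" and z: "z \<noteq> 0"
    and G: "\<forall>i. \<exists>b\<in>B. coeff G i = u * b" "poly G z = 1"
    and H: "\<forall>i. \<exists>b\<in>B. coeff H i = u * b" "poly H (inverse z) = 1"
    and deg: "degree H \<le> degree G"
  shows "\<exists>G'. (\<forall>i. \<exists>b\<in>B. coeff G' i = u * b) \<and> poly G' z = 1 \<and> degree G' < degree G"
proof -
  note R = is_subringD[OF B]
  define I where "I = {u * b | b. b \<in> B}"
  have I: "(\<exists>b\<in>B. c = u * b) \<longleftrightarrow> c \<in> I" for c by (auto simp: I_def)
  have I_add: "c + c' \<in> I" if "c \<in> I" "c' \<in> I" for c c'
    using that R(6) by (auto simp: I_def distrib_left[symmetric])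
  have I_diff: "c - c' \<in> I" if "c \<in> I" "c' \<in> I" for c c'
    using that R(3) by (auto simp: I_def right_diff_distrib[symmetric])
  have I_mult: "b * c \<in> I" if "c \<in> I" "b \<in> B" for c b
    using that R(4) by (force simp: I_def)
  have I_zero: "0 \<in> I" using R(2) by (auto simp: I_def)
  have I_B: "I \<subseteq> B" using u R(4) by (auto simp: I_def)
  have I_sum: "sum g J \<in> I" if "\<And>j. j \<in> J \<Longrightarrow> g j \<in> I" for g and J :: "nat set"
    using that by (induction J rule: infinite_finite_induct) (auto intro: I_zero I_add)
  have one_notin: "1 \<notin> I"
  proof
    assume "1 \<in> I"
    then obtain b where "b \<in> B" "u * b = 1" by (auto simp: I_def)
    then show False using u(2) inverse_unique[of u b] by simp
  qed
  have Hc: "coeff H i \<in> I" and Gc: "coeff G i \<in> I" for i using G H by (auto simp: I)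
  define l n h0 where "l = degree H" and "n = degree G" and "h0 = coeff H 0"
  have "l > 0"
  proof (rule ccontr)
    assume "\<not> l > 0"
    then have "degree H = 0" by (simp add: l_def)
    then obtain c where "H = [:c:]" by (rule degree_eq_zeroE)
    then have "poly H (inverse z) = h0" by (simp add: h0_def)
    then show False using H(2) Hc[of 0] one_notin by (simp add: h0_def)
  qed
  define w where "w = inverse (1 - h0)"
  obtain b0 where "b0 \<in> B" "h0 = u * b0" using H(1) by (auto simp: h0_def)
  then have w: "w \<in> B" using local by (simp add: w_def)
  have "1 - h0 \<noteq> 0" using Hc[of 0] one_notin by (auto simp: h0_def)
  \<comment> \<open>H(1/z) = 1 multiplied by z^l and divided by the unit \<open>1 - h0\<close>
    expresses z^l through lower powers of z, again with coefficients in the ideal.\<close>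
  define H' where "H' = (\<Sum>j=1..l. monom (w * coeff H j) (l - j))"
  have H'c: "coeff H' i \<in> I" for i
    unfolding H'_def coeff_sum by (rule I_sum) (auto intro: I_mult I_zero w Hc)
  have H'deg: "degree H' < l"
  proof -
    have "degree H' \<le> l - 1" unfolding H'_def
      by (intro degree_sum_le) (auto intro: order_trans[OF degree_monom_le])
    then show ?thesis using \<open>l > 0\<close> by simp
  qed
  have "1 = (\<Sum>j\<le>l. coeff H j * inverse z ^ j)"
    using H(2) by (simp add: poly_altdef l_def)
  also have "\<dots> = h0 + (\<Sum>j=1..l. coeff H j * inverse z ^ j)"
    by (simp add: h0_def atMost_atLeast0 sum.atLeast_Suc_atMost)
  finally have sum_eq: "(\<Sum>j=1..l. coeff H j * inverse z ^ j) = 1 - h0"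
    by (simp add: algebra_simps)
  have "poly H' z = (\<Sum>j=1..l. w * coeff H j * z ^ (l - j))"
    by (simp add: H'_def poly_sum poly_monom)
  also have "\<dots> = (\<Sum>j=1..l. w * z ^ l * (coeff H j * inverse z ^ j))"
    using z by (intro sum.cong) (auto simp: power_diff field_simps)
  also have "\<dots> = w * z ^ l * (1 - h0)"
    by (simp only: sum_distrib_left[symmetric] sum_eq)
  also have "\<dots> = z ^ l" using \<open>1 - h0 \<noteq> 0\<close> by (simp add: w_def)
  finally have H'z: "poly H' z = z ^ l" .
  \<comment> \<open>The leading term c z^n of G is replaced by c z^(n-l) H'(z), which has the same
    value at z and smaller degree.\<close>
  define G' where "G' = G - monom (coeff G n) n + monom (coeff G n) (n - l) * H'"
  have "poly G' z = 1"
    using G(2) deg by (simp add: G'_def H'z poly_monom mult.assoc power_add[symmetric] l_def n_def)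
  moreover have "coeff G' i \<in> I" for i
    unfolding G'_def coeff_add coeff_diff
    by (intro I_add I_diff Gc)
      (auto simp: coeff_monom_mult I_zero Gc H'c I_B[THEN subsetD] I_mult)
  moreover have "degree G' < n"
  proof -
    have n: "n > 0" using \<open>l > 0\<close> deg by (simp add: l_def n_def)
    have "degree (G - monom (coeff G n) n) < n"
      using n by (intro degree_lessI) (auto simp: coeff_eq_0 n_def le_less)
    moreover have "degree (monom (coeff G n) (n - l) * H') < n"
    proof -
      have "degree (monom (coeff G n) (n - l) * H') \<le> degree (monom (coeff G n) (n - l)) + degree H'"
        by (rule degree_mult_le)
      also have "\<dots> \<le> (n - l) + degree H'" by (simp add: degree_monom_le)
      also have "\<dots> < n" using H'deg deg by (simp add: l_def n_def)
      finally show ?thesis .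
    qed
    ultimately show ?thesis unfolding G'_def by (rule degree_add_less)
  qed
  ultimately show ?thesis by (auto simp: I n_def)
qed

text \<open>A subring B maximal among those that contain R but not 1/u is a valuation ring: if z and
  1/z were both missing, maximality would put 1/u into B[z] and B[1/z], and multiplication by u
  gives the two relations on which \<open>shorten_relation\<close> descends.\<close>

theorem ex_valuation_subring:
  fixes R :: "'a::field set"
  assumes R: "is_subring R" and u: "u \<in> R" "inverse u \<notin> R"
  shows "\<exists>A. R \<subseteq> A \<and> vring UNIV A \<and> inverse u \<notin> A"
proof -
  define S where "S = {B. is_subring B \<and> R \<subseteq> B \<and> inverse u \<notin> B}"
  have "\<exists>M\<in>S. \<forall>Y\<in>S. M \<subseteq> Y \<longrightarrow> Y = M"
  proof (rule subset_Zorn_nonempty)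
    show "S \<noteq> {}" using assms by (auto simp: S_def)
    fix C assume C: "C \<noteq> {}" "subset.chain S C"
    have sub: "C \<subseteq> S" using C(2) by (simp add: subset.chain_def)
    have "is_subring (\<Union>C)"
    proof -
      have "\<exists>Y\<in>C. a \<in> Y \<and> b \<in> Y" if ab: "a \<in> \<Union>C" "b \<in> \<Union>C" for a b
      proof -
        obtain Y Z where YZ: "Y \<in> C" "a \<in> Y" "Z \<in> C" "b \<in> Z" using ab by blast
        then have "Y \<subseteq> Z \<or> Z \<subseteq> Y" using C(2) by (auto simp: subset_chain_def)
        then show ?thesis using YZ by blast
      qed
      moreover have "is_subring Y" if "Y \<in> C" for Y using that sub by (auto simp: S_def)
      ultimately show ?thesis
        using C(1) unfolding is_subring_def by (intro conjI ballI) (blast+)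
    qed
    then show "\<Union>C \<in> S" using sub C(1) by (auto simp: S_def)
  qed
  then obtain B where B: "B \<in> S" "\<And>Y. Y \<in> S \<Longrightarrow> B \<subseteq> Y \<Longrightarrow> Y = B" by blast
  have BR: "is_subring B" "R \<subseteq> B" "inverse u \<notin> B" using B(1) by (auto simp: S_def)
  note BD = is_subringD[OF BR(1)]
  have uB: "u \<in> B" using u BR by auto
  then have u0: "u \<noteq> 0" using BR(3) BD(2) by auto
  have ext: "\<exists>g. (\<forall>i. coeff g i \<in> B) \<and> inverse u = poly g z" if z: "z \<notin> B" for z
  proof (rule ccontr)
    assume *: "\<not> ?thesis"
    let ?E = "{poly g z | g. \<forall>i. coeff g i \<in> B}"
    have sub: "B \<subseteq> ?E"
    proof
      fix b assume "b \<in> B"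
      then show "b \<in> ?E" using BD(2) by (auto intro!: exI[of _ "[:b:]"] simp: coeff_pCons split: nat.split)
    qed
    have "z \<in> ?E"
      using BD(1,2) by (auto intro!: exI[of _ "[:0, 1:]"] simp: coeff_pCons split: nat.split)
    moreover have "?E \<in> S" using is_subring_adjoin[OF BR(1)] sub BR(2) * by (auto simp: S_def)
    ultimately show False using B(2)[OF _ sub] z by auto
  qed
  \<comment> \<open>If 1/c were missing for c = 1 - u b, then 1/u would be a polynomial in 1/c and
    c^n / u would lie in B for some n. Since c^n is 1 modulo u, so would 1/u.\<close>
  have local: "inverse (1 - u * b) \<in> B" if b: "b \<in> B" for b
  proof (rule ccontr)
    assume "inverse (1 - u * b) \<notin> B"
    from ext[OF this] obtain g where g: "\<And>i. coeff g i \<in> B" "inverse u = poly g (inverse (1 - u * b))"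
      by blast
    define c where "c = 1 - u * b"
    have c: "c \<in> B" using b uB BD by (simp add: c_def)
    have c0: "c \<noteq> 0"
    proof
      assume "c = 0"
      then have "u * b = 1" by (simp add: c_def)
      then show False using BR(3) b inverse_unique[of u b] by simp
    qed
    have "c ^ degree g * inverse u = (\<Sum>i\<le>degree g. coeff g i * c ^ (degree g - i))"
      using c0 unfolding g(2) c_def[symmetric] poly_altdef sum_distrib_left
      by (intro sum.cong) (auto simp: power_diff field_simps)
    also have "\<dots> \<in> B" using g(1) c BD by (intro BD(8)) auto
    finally have 1: "c ^ degree g * inverse u \<in> B" .
    have "\<exists>e\<in>B. c ^ k = 1 - u * e" for k
    proof (induction k)
      case 0
      show ?case using BD(2) by (intro bexI[of _ 0]) auto
    next
      case (Suc k)
      then obtain e where "e \<in> B" "c ^ k = 1 - u * e" by auto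
      have "c ^ Suc k = 1 - u * (b + e - u * b * e)"
        unfolding power_Suc \<open>c ^ k = 1 - u * e\<close> by (simp add: c_def algebra_simps)
      moreover have "b + e - u * b * e \<in> B" using b uB \<open>e \<in> B\<close> by (simp add: BD)
      ultimately show ?case by blast
    qed
    then obtain e where e: "e \<in> B" "c ^ degree g = 1 - u * e" by blast
    have "inverse u = c ^ degree g * inverse u + e"
      unfolding e(2) using u0 by (simp add: left_diff_distrib)
    then show False using BD(6)[OF 1 e(1)] BR(3) by simp
  qed
  \<comment> \<open>Induction on the sum of the degrees; exchanging z and 1/z lets either relation
    be the longer one.\<close>
  have no_rel: False
    if "degree G + degree H = N" "z \<noteq> 0"
      "\<forall>i. \<exists>b\<in>B. coeff G i = u * b" "poly G z = 1"
      "\<forall>i. \<exists>b\<in>B. coeff H i = u * b" "poly H (inverse z) = 1" for G H N z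
    using that
  proof (induction N arbitrary: G H z rule: less_induct)
    case (less N)
    show False
    proof (cases "degree H \<le> degree G")
      case True
      from shorten_relation[OF BR(1) uB BR(3) local less.prems(2-6) this]
      obtain G' where G': "\<forall>i. \<exists>b\<in>B. coeff G' i = u * b" "poly G' z = 1" "degree G' < degree G"
        by blast
      show False
        by (rule less.IH[OF _ refl less.prems(2) G'(1,2) less.prems(5,6)]) (use G'(3) less.prems(1) in simp)
    next
      case False
      then have "degree G \<le> degree H" by simp
      from shorten_relation[OF BR(1) uB BR(3) local _ less.prems(5,6,3) _ this] less.prems(2,4)
      obtain H' where H': "\<forall>i. \<exists>b\<in>B. coeff H' i = u * b" "poly H' (inverse z) = 1" "degree H' < degree H"
        by auto
      show False
        by (rule less.IH[OF _ refl less.prems(2-4) H'(1,2)]) (use H'(3) less.prems(1) in simp)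
    qed
  qed
  have "z \<in> B \<or> inverse z \<in> B" for z
  proof (rule ccontr)
    assume "\<not> ?thesis"
    then have z: "z \<notin> B" "inverse z \<notin> B" by auto
    obtain G where G: "\<forall>i. coeff G i \<in> B" "inverse u = poly G z" using ext[OF z(1)] by blast
    obtain H where H: "\<forall>i. coeff H i \<in> B" "inverse u = poly H (inverse z)" using ext[OF z(2)] by blast
    show False
    proof (rule no_rel[OF refl])
      show "z \<noteq> 0" using z(1) BD(2) by auto
      show "\<forall>i. \<exists>b\<in>B. coeff (smult u G) i = u * b" "\<forall>i. \<exists>b\<in>B. coeff (smult u H) i = u * b"
        using G(1) H(1) by auto
      show "poly (smult u G) z = 1" "poly (smult u H) (inverse z) = 1"
        using u0 by (simp_all add: G(2)[symmetric] H(2)[symmetric])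
    qed
  qed
  then have "vring UNIV B"
    by unfold_locales (simp_all add: is_subfield_UNIV BD(3,4))
  then show ?thesis using BR by blast
qed

section \<open>Rational function fields and their places\<close>

text \<open>The generator \<open>t\<close> varies: the locale is used for \<open>x\<close>, for
  \<open>x - \<iota> a\<close> and for the inverse of the latter.\<close>

locale ratfun =
  fixes \<iota> :: "'k::field \<Rightarrow> 'f::field" and t :: 'f
  assumes hom: "field_hom \<iota>"
    and transcendental: "\<And>h. poly (map_poly \<iota> h) t = 0 \<Longrightarrow> h = 0"
begin

sublocale iota: field_hom \<iota> by (rule hom)
sublocale iota_poly: map_poly_inj_idom_hom \<iota> ..

definition ev :: "'k poly \<Rightarrow> 'f" where
  "ev h = poly (map_poly \<iota> h) t"

lemma ev_simps [simp]:
  "ev 0 = 0" "ev 1 = 1" "ev (g + h) = ev g + ev h" "ev (g - h) = ev g - ev h" "ev (- g) = - ev g"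
  "ev (g * h) = ev g * ev h" "ev (g ^ n) = ev g ^ n" "ev [:c:] = \<iota> c" "ev [:0, 1:] = t"
  "ev (smult c g) = \<iota> c * ev g"
  by (simp_all add: ev_def hom_distribs)

lemma ev_eq_0_iff [simp]: "ev h = 0 \<longleftrightarrow> h = 0"
  using transcendental by (auto simp: ev_def)

lemma ev_eq_iff [simp]: "ev g = ev h \<longleftrightarrow> g = h"
  using ev_eq_0_iff[of "g - h"] by (simp del: ev_eq_0_iff)

lemma t_nonzero: "t \<noteq> 0"
  using ev_eq_0_iff[of "[:0, 1:]"] by (simp del: ev_eq_0_iff)

lemma ev_altdef: "ev h = (\<Sum>i\<le>degree h. \<iota> (coeff h i) * t ^ i)"
  by (simp add: ev_def poly_altdef)

text \<open>The embedding of the abstract rational function field, with range K(t). Denominators and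
  prime factors are handled in \<open>'k poly fract\<close>, valuations in the range.\<close>

definition phi :: "'k poly fract \<Rightarrow> 'f" where
  "phi a = (THE c. \<forall>g h. h \<noteq> 0 \<longrightarrow> a = Fract g h \<longrightarrow> c = ev g / ev h)"

lemma phi_Fract: "h \<noteq> 0 \<Longrightarrow> phi (Fract g h) = ev g / ev h"
  unfolding phi_def
proof (rule the_equality, intro allI impI)
  fix g' h' assume *: "h \<noteq> 0" "h' \<noteq> 0" "Fract g h = Fract g' h'"
  then have "g * h' = g' * h" by (simp add: eq_fract)
  then have "ev (g * h') = ev (g' * h)" by simp
  then show "ev g / ev h = ev g' / ev h'" using * by (simp add: field_simps)
qed auto

lemma phi_to_fract [simp]: "phi (to_fract h) = ev h"
  by (simp add: to_fract_def phi_Fract)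

sublocale phi: field_hom phi
proof
  show "phi 0 = 0" using phi_to_fract[of 0] by simp
  show "phi 1 = 1" using phi_to_fract[of 1] by simp
  fix a b :: "'k poly fract"
  obtain g h where a: "a = Fract g h" "h \<noteq> 0" by (cases a) auto
  obtain g' h' where b: "b = Fract g' h'" "h' \<noteq> 0" by (cases b) auto
  show "phi (a + b) = phi a + phi b"
    using a b by (simp add: phi_Fract add_frac_eq)
  show "phi (a * b) = phi a * phi b"
    using a b by (simp add: phi_Fract)
qed

sublocale phi_poly: map_poly_inj_idom_hom phi ..

lemma phi_cases:
  obtains g h where "a = Fract g h" "h \<noteq> 0" "phi a = ev g / ev h"
  using phi_Fract by (cases a) metis

lemma is_subfield_phi: "is_subfield (range phi)"
  unfolding is_subfield_def
  by (auto simp flip: phi.hom_one phi.hom_minus phi.hom_mult phi.hom_inverse)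

lemma range_iota_sub_phi: "range \<iota> \<subseteq> range phi"
  by (metis ev_simps(8) phi_to_fract image_subset_iff rangeI)

lemma t_in_phi: "t \<in> range phi"
  by (metis ev_simps(9) phi_to_fract rangeI)

lemma ev_in_subring:
  assumes "is_subring R" "range \<iota> \<subseteq> R" "t \<in> R"
  shows "ev h \<in> R"
  unfolding ev_altdef using assms(2,3)
  by (intro is_subringD(8)[OF assms(1)] is_subringD(4)[OF assms(1)] is_subringD(7)[OF assms(1)]) auto

lemma phi_in_subfield:
  assumes "is_subfield L" "range \<iota> \<subseteq> L" "t \<in> L"
  shows "phi a \<in> L"
proof -
  have "is_subring L" using assms(1) by (auto simp: is_subfield_def is_subring_def)
  from ev_in_subring[OF this assms(2,3)] show ?thesis
    by (cases a rule: phi_cases) (simp add: is_subfieldD(8)[OF assms(1)])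
qed

lemma is_subring_ev: "is_subring (range ev)"
  unfolding is_subring_def by (auto simp flip: ev_simps(2,4,6))

lemma vring_is_subring: "vring L A \<Longrightarrow> is_subring A"
  by (simp add: is_subring_def vring.one vring.diff vring.mult)

text \<open>The polynomials with value in the maximal ideal form an ideal of K[X]; by division with
  remainder a nonzero one of least degree generates it.\<close>

lemma finite_place_dvd:
  assumes A: "vring L A" and K: "range \<iota> \<subseteq> A" and t: "t \<in> A"
    and g: "ev g \<in> vring.max_ideal A" "g \<noteq> 0"
  obtains p where "p \<noteq> 0" "ev p \<in> vring.max_ideal A" "\<And>h. ev h \<in> vring.max_ideal A \<Longrightarrow> p dvd h"
proof -
  interpret vring L A by (rule A)
  have evA: "ev h \<in> A" for h by (rule ev_in_subring[OF vring_is_subring[OF A] K t])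
  obtain p where p: "p \<noteq> 0 \<and> ev p \<in> max_ideal"
    and least: "\<And>h. h \<noteq> 0 \<and> ev h \<in> max_ideal \<Longrightarrow> degree p \<le> degree h"
    using ex_has_least_nat[of "\<lambda>h. h \<noteq> 0 \<and> ev h \<in> max_ideal" g degree] g by blast
  have "p dvd h" if h: "ev h \<in> max_ideal" for h
  proof (rule ccontr)
    assume "\<not> p dvd h"
    then have nz: "h mod p \<noteq> 0" by (simp add: dvd_eq_mod_eq_0)
    have "h mod p = h + p * (- (h div p))" by (simp add: minus_mult_div_eq_mod)
    then have "ev (h mod p) = ev h + ev p * ev (- (h div p))"
      by (metis ev_simps(3,6))
    also have "\<dots> \<in> max_ideal" by (intro max_ideal_add max_ideal_mult h evA conjunct2[OF p])
    finally show False
      using least[of "h mod p"] nz degree_mod_less[of p h] p by auto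
  qed
  with p that show ?thesis by blast
qed

lemma ex_polynomial_in_max_ideal:
  assumes A: "vring L A" and K: "range \<iota> \<subseteq> A" and t: "t \<in> A" and phi: "\<not> range phi \<subseteq> A"
  shows "\<exists>h. h \<noteq> 0 \<and> ev h \<in> vring.max_ideal A"
proof (rule ccontr)
  interpret vring L A by (rule A)
  have evA: "ev h \<in> A" for h by (rule ev_in_subring[OF vring_is_subring[OF A] K t])
  assume *: "\<not> ?thesis"
  have "phi a \<in> A" for a
  proof (cases a rule: phi_cases)
    case (1 g h)
    then have "ev h \<in> units" using * evA by (auto simp: units_iff)
    then have "ev g * inverse (ev h) \<in> A" using evA by (intro mult) (auto simp: units_def)
    then show ?thesis using 1 by (simp add: divide_inverse)
  qed
  then show False using phi by blast
qed

lemma inverse_t_not_constant: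
  assumes "range \<iota> \<subseteq> A" "t \<notin> A"
  shows "inverse t \<notin> range \<iota>"
proof
  assume "inverse t \<in> range \<iota>"
  then obtain c where "\<iota> c = inverse t" by auto
  then have "\<iota> (inverse c) = t" by (simp add: iota.hom_inverse)
  then show False using assms by auto
qed

text \<open>A polynomial not divisible by \<open>p\<close> becomes a unit, so splitting off factors
  \<open>p\<close> ends by degree; \<open>p\<close> is not constant since otherwise 1 would lie in
  the maximal ideal.\<close>

lemma finite_place_val:
  assumes A: "vring L A" and K: "range \<iota> \<subseteq> A" and t: "t \<in> A"
    and p: "p \<noteq> 0" "ev p \<in> vring.max_ideal A" "\<And>h. ev h \<in> vring.max_ideal A \<Longrightarrow> p dvd h"
    and a: "a \<noteq> 0"
  shows "\<exists>n. \<exists>u\<in>vring.units A. phi a = ev p powi n * u"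
proof -
  interpret vring L A by (rule A)
  have evA: "ev h \<in> A" for h by (rule ev_in_subring[OF vring_is_subring[OF A] K t])
  have deg: "degree p > 0"
  proof (rule ccontr)
    assume "\<not> degree p > 0"
    then have "p dvd 1" using p(1) by (simp add: is_unit_iff_degree)
    then obtain q where "1 = p * q" by (rule dvdE)
    then have "1 = ev p * ev q" by (metis ev_simps(2,6))
    then show False using max_ideal_mult[OF p(2) evA] one_notin_max_ideal by metis
  qed
  have *: "\<exists>n. \<exists>u\<in>units. ev h = ev p ^ n * u" if "h \<noteq> 0" for h
    using that
  proof (induction "degree h" arbitrary: h rule: less_induct)
    case less
    show ?case
    proof (cases "p dvd h")
      case True
      then obtain q where q: "h = p * q" by (rule dvdE)
      with less.prems have "q \<noteq> 0" by auto
      then have "degree q < degree h" using q deg p(1) by (simp add: degree_mult_eq)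
      from less.hyps[OF this \<open>q \<noteq> 0\<close>] obtain n u where "u \<in> units" "ev q = ev p ^ n * u" by blast
      then show ?thesis by (intro exI[of _ "Suc n"] bexI[of _ u]) (auto simp: q)
    next
      case False
      then have "ev h \<in> units" using p(3) evA by (auto simp: units_iff)
      then show ?thesis by (intro exI[of _ 0] bexI[of _ "ev h"]) auto
    qed
  qed
  obtain g h where gh: "a = Fract g h" "h \<noteq> 0" "phi a = ev g / ev h" by (rule phi_cases)
  then have "g \<noteq> 0" using a by auto
  from *[OF this] obtain n u where n: "u \<in> units" "ev g = ev p ^ n * u" by blast
  from *[OF gh(2)] obtain k w where k: "w \<in> units" "ev h = ev p ^ k * w" by blast
  have "phi a = ev p powi (int n - int k) * (u / w)"
    using p(1) by (simp add: gh(3) n(2) k(2) power_int_diff)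
  then show ?thesis using units_divide[OF n(1) k(1)] by blast
qed

text \<open>After division by the top power of t there remain the leading coefficient, a unit, and
  multiples of positive powers of 1/t.\<close>

lemma infinite_place_unit:
  assumes A: "vring L A" and K: "range \<iota> \<subseteq> A" and t: "t \<in> L" "t \<notin> A" and h: "h \<noteq> 0"
  shows "ev h / t ^ degree h \<in> vring.units A"
proof -
  interpret vring L A by (rule A)
  have t0: "t \<noteq> 0" and ti: "inverse t \<in> max_ideal" using not_in_iff[OF t(1)] t(2) by auto
  have KA: "\<iota> c \<in> A" for c using K by auto
  have Ku: "\<iota> c \<in> units" if "c \<noteq> 0" for c
    using that KA[of c] KA[of "inverse c"] by (simp add: units_def iota.hom_inverse)
  have "ev h / t ^ degree h = (\<Sum>i\<le>degree h. \<iota> (coeff h i) * inverse t ^ (degree h - i))"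
    unfolding ev_altdef sum_divide_distrib using t0
    by (intro sum.cong) (auto simp: power_diff field_simps)
  also have "\<dots> = \<iota> (lead_coeff h) + (\<Sum>i<degree h. \<iota> (coeff h i) * inverse t ^ (degree h - i))"
    by (subst lessThan_Suc_atMost[symmetric], subst sum.lessThan_Suc) simp
  also have "\<dots> \<in> units"
  proof (intro unit_add_max_ideal max_ideal_sum)
    show "\<iota> (lead_coeff h) \<in> units" using h by (intro Ku) simp
    fix i assume "i \<in> {..<degree h}"
    then have "inverse t ^ (degree h - i) \<in> max_ideal" by (intro max_ideal_power ti) simp
    from max_ideal_mult[OF this KA] show "\<iota> (coeff h i) * inverse t ^ (degree h - i) \<in> max_ideal"
      by (simp add: mult.commute)
  qed
  finally show ?thesis .
qed

text \<open>The exponent is chosen before \<open>L\<close> and \<open>A\<close>: all valuation rings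
  without t agree on the value of \<open>phi a\<close>. This order of quantifiers yields the
  uniqueness of the place at infinity, in K(t) as well as in F.\<close>

lemma infinite_place_val:
  assumes "a \<noteq> 0"
  shows "\<exists>n. \<forall>L A. vring L A \<longrightarrow> range \<iota> \<subseteq> A \<longrightarrow> t \<in> L \<longrightarrow> t \<notin> A \<longrightarrow>
    phi a / inverse t powi n \<in> vring.units A"
proof -
  obtain g h where gh: "a = Fract g h" "h \<noteq> 0" "phi a = ev g / ev h" by (rule phi_cases)
  then have g: "g \<noteq> 0" using assms by auto
  show ?thesis
  proof (intro exI[of _ "int (degree h) - int (degree g)"] allI impI)
    fix L A assume A: "vring L A" "range \<iota> \<subseteq> A" "t \<in> L" "t \<notin> A"
    interpret vring L A by (rule A(1))
    have "t \<noteq> 0" using A zero by auto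
    then have "phi a / inverse t powi (int (degree h) - int (degree g)) =
        (ev g / t ^ degree g) / (ev h / t ^ degree h)"
      using gh by (simp add: power_int_diff field_simps)
    then show "phi a / inverse t powi (int (degree h) - int (degree g)) \<in> units"
      using units_divide[OF infinite_place_unit[OF A g] infinite_place_unit[OF A gh(2)]]
      by (simp only:)
  qed
qed

text \<open>The numerator of a rational function lies in every maximal ideal containing a denominator
  of minimal degree, provided the function is integral there; dividing both by the generator of
  that prime ideal contradicts minimality.\<close>

lemma polynomial_if_integral:
  fixes e :: "'f \<Rightarrow> 'w::field"
  assumes e: "field_hom e"
    and int: "\<And>B. vring UNIV B \<Longrightarrow> e ` range \<iota> \<subseteq> B \<Longrightarrow> e t \<in> B \<Longrightarrow> e (phi a) \<in> B"
  shows "\<exists>h. a = to_fract h"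
proof -
  interpret e: field_hom e by (rule e)
  obtain g0 h0 where gh0: "a = Fract g0 h0" "h0 \<noteq> 0" by (cases a)
  obtain h where h: "h \<noteq> 0 \<and> (\<exists>g. a = Fract g h)"
    and least: "\<And>h'. h' \<noteq> 0 \<and> (\<exists>g. a = Fract g h') \<Longrightarrow> degree h \<le> degree h'"
    using ex_has_least_nat[of "\<lambda>h. h \<noteq> 0 \<and> (\<exists>g. a = Fract g h)" h0 degree] gh0 by blast
  from h obtain g where g: "a = Fract g h" by blast
  have "degree h = 0"
  proof (rule ccontr)
    assume deg: "degree h \<noteq> 0"
    have sub: "is_subring (e ` range ev)"
      using is_subring_ev unfolding is_subring_def
      by (auto simp flip: e.hom_minus e.hom_mult e.hom_one ev_simps(2))
    have "inverse (e (ev h)) \<notin> e ` range ev"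
    proof
      assume "inverse (e (ev h)) \<in> e ` range ev"
      then obtain q where "inverse (e (ev h)) = e (ev q)" by blast
      moreover have "e (ev h) \<noteq> 0" using h by simp
      ultimately have "e (ev h) * e (ev q) = 1" by (metis right_inverse)
      then have "e (ev (h * q)) = e (ev 1)" by (simp add: e.hom_mult)
      then have "h * q = 1" by (simp only: e.eq_iff ev_eq_iff)
      then show False using deg is_unit_iff_degree[of h] h by (metis dvdI)
    qed
    then obtain B where B: "e ` range ev \<subseteq> B" "vring UNIV B" "inverse (e (ev h)) \<notin> B"
      using ex_valuation_subring[OF sub] by blast
    interpret B: vring UNIV B by (rule B(2))
    have evB: "e (ev p) \<in> B" for p using B(1) by auto
    \<comment> \<open>\<open>B\<close> lives in the target of \<open>e\<close>; its preimage is a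
      valuation ring of F, to which \<open>finite_place_dvd\<close> applies.\<close>
    define A where "A = e -` B"
    have A: "vring UNIV A"
      using B.total by unfold_locales
        (auto simp: A_def is_subfield_UNIV e.hom_minus e.hom_mult e.hom_inverse B.diff B.mult)
    interpret A: vring UNIV A by (rule A)
    have KA: "range \<iota> \<subseteq> A" "t \<in> A"
      using evB ev_simps(8,9) unfolding A_def by (metis image_subset_iff vimageI, metis vimageI)
    have "e ` range \<iota> \<subseteq> B" "e t \<in> B" using KA by (auto simp: A_def)
    from int[OF B(2) this] have aA: "phi a \<in> A" by (simp add: A_def)
    have hA: "ev h \<in> A.max_ideal"
      using B(3) unfolding A.max_ideal_iff by (simp add: A_def e.hom_inverse)
    obtain p where p: "p \<noteq> 0" "ev p \<in> A.max_ideal" "\<And>h. ev h \<in> A.max_ideal \<Longrightarrow> p dvd h"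
      using finite_place_dvd[OF A KA hA] h by blast
    have "ev g = ev h * phi a" using g h by (simp add: phi_Fract)
    then have "ev g \<in> A.max_ideal" using A.max_ideal_mult[OF hA aA] by simp
    with p hA obtain g' h' where gh': "g = p * g'" "h = p * h'" by (metis dvdE)
    have h'0: "h' \<noteq> 0" using h gh' by auto
    have "a = Fract g' h'" using g h gh' h'0 p(1) by (simp add: eq_fract)
    with least[of h'] h'0 have "degree h \<le> degree h'" by blast
    moreover have "degree h = degree p + degree h'"
      using gh' p(1) h'0 by (simp add: degree_mult_eq)
    ultimately have "degree p = 0" by simp
    then have "p dvd 1" using p(1) by (simp add: is_unit_iff_degree)
    then obtain q where "1 = p * q" by (rule dvdE)
    then have "1 = ev p * ev q" by (metis ev_simps(2,6))
    moreover have "ev q \<in> A" using evB by (simp add: A_def)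
    ultimately show False using A.max_ideal_mult[OF p(2)] A.one_notin_max_ideal by metis
  qed
  then obtain c where c: "h = [:c:]" by (rule degree_eq_zeroE)
  then have "c \<noteq> 0" using h by auto
  then have "a = to_fract (smult (inverse c) g)"
    using g c by (simp add: to_fract_def eq_fract)
  then show ?thesis by blast
qed

end

section \<open>Existence of a place above the pole of t\<close>

context ratfun
begin

lemma ratfun_inverse: "ratfun \<iota> (inverse t)"
proof (unfold_locales)
  fix h assume *: "poly (map_poly \<iota> h) (inverse t) = 0"
  have "ev (reflect_poly h) = poly (reflect_poly (map_poly \<iota> h)) t"
  proof -
    have "map_poly \<iota> (reflect_poly h) = reflect_poly (map_poly \<iota> h)"
      by (intro poly_eqI) (simp add: coeff_reflect_poly)
    then show ?thesis by (simp add: ev_def)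
  qed
  also have "\<dots> = 0" using t_nonzero * by (simp add: poly_reflect_poly_nz)
  finally show "h = 0" by simp
qed

text \<open>In K[1/t] the element 1/t is not invertible, so Chevalley's theorem gives a valuation
  ring containing 1/t but not t.\<close>

lemma ex_infinite_place: "\<exists>A. vring UNIV A \<and> range \<iota> \<subseteq> A \<and> t \<notin> A"
proof -
  interpret inv: ratfun \<iota> "inverse t" by (rule ratfun_inverse)
  have 1: "inverse t \<in> range inv.ev" using inv.ev_simps(9) by (metis rangeI)
  have "inverse (inverse t) \<notin> range inv.ev"
  proof
    assume "inverse (inverse t) \<in> range inv.ev"
    then obtain h where "t = inv.ev h" by auto
    then have "inv.ev (h * [:0, 1:]) = inv.ev 1" using t_nonzero unfolding inv.ev_simps by simp
    then have "h * [:0, 1:] = 1" by (simp only: inv.ev_eq_iff)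
    then have "[:0, 1 :: 'k:] dvd 1" by (metis dvd_triv_right)
    then show False by (simp add: is_unit_iff_degree)
  qed
  from ex_valuation_subring[OF inv.is_subring_ev 1 this]
  obtain A where A: "range inv.ev \<subseteq> A" "vring UNIV A" "t \<notin> A" by auto
  have "\<iota> c \<in> A" for c using subsetD[OF A(1) rangeI, of "[:c:]"] by simp
  then have "range \<iota> \<subseteq> A" by blast
  then show ?thesis using A by blast
qed

end

section \<open>Totally ramified Kummer extensions\<close>

text \<open>The extension \<open>F = K(t)(y)\<close> with \<open>y ^ m = f0\<close>, where the valuation \<open>l\<close> of \<open>f0\<close> at the pole
  of \<open>t\<close> is prime to \<open>m\<close>.\<close>

locale kummer = ratfun \<iota> t for \<iota> :: "'k::field \<Rightarrow> 'f::field" and t :: 'f +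
  fixes y :: 'f and m :: nat and fn fd :: "'k poly" and f0 :: "'k poly fract" and l :: int
  assumes m: "m > 0" and m_unit: "(of_nat m :: 'k) \<noteq> 0"
    and fn: "fn \<noteq> 0" and fd: "fd \<noteq> 0" and f0: "f0 = Fract fn fd"
    and l: "l = int (degree fd) - int (degree fn)" and coprime: "coprime l (int m)"
    and y: "y ^ m = phi f0"
    and gen: "\<And>L. is_subfield L \<Longrightarrow> range phi \<subseteq> L \<Longrightarrow> y \<in> L \<Longrightarrow> L = UNIV"
begin

lemma f0_nz: "f0 \<noteq> 0"
  using fn fd by (simp add: f0 Zero_fract_def eq_fract)

lemma y_nz: "y \<noteq> 0"
proof
  assume "y = 0"
  then have "phi f0 = 0" using y m by (simp add: power_0_left)
  then show False using f0_nz by simp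
qed

section \<open>Values at the places above the pole of t\<close>

definition inf_ring :: "'f set \<Rightarrow> bool" where
  "inf_ring A \<longleftrightarrow> vring UNIV A \<and> range \<iota> \<subseteq> A \<and> t \<notin> A"

lemma inf_ring_valuation_ring:
  assumes A: "inf_ring A"
  shows "valuation_ring (range \<iota>) UNIV A"
proof -
  interpret vring UNIV A using A by (simp add: inf_ring_def)
  have A': "range \<iota> \<subseteq> A" "t \<notin> A" using A by (auto simp: inf_ring_def)
  then have "inverse t \<in> A" "inverse t \<notin> range \<iota>"
    using total[of t] inverse_t_not_constant by auto
  then show ?thesis using A' diff mult total by (auto simp: valuation_ring_def)
qed

text \<open>Equality of values at all valuation rings above the pole of t at once. No place has to
  be chosen before uniqueness is known, and uniqueness is read off from this relation.\<close>

definition eqv :: "'f \<Rightarrow> 'f \<Rightarrow> bool" (infix "\<approx>" 50) where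
  "z \<approx> w \<longleftrightarrow> z \<noteq> 0 \<and> w \<noteq> 0 \<and> (\<forall>A. inf_ring A \<longrightarrow> z / w \<in> vring.units A)"

lemma eqv_trans:
  assumes "a \<approx> b" "b \<approx> c"
  shows "a \<approx> c"
  unfolding eqv_def
proof (intro conjI allI impI)
  show "a \<noteq> 0" "c \<noteq> 0" using assms by (auto simp: eqv_def)
  fix A assume A: "inf_ring A"
  then interpret vring UNIV A by (simp add: inf_ring_def)
  have "a / b * (b / c) \<in> units" using assms A unfolding eqv_def by (intro units_mult) blast+
  moreover have "a / b * (b / c) = a / c" using assms by (simp add: eqv_def)
  ultimately show "a / c \<in> units" by (simp only:)
qed

lemma eqv_sym:
  assumes "a \<approx> b"
  shows "b \<approx> a"
  unfolding eqv_def
proof (intro conjI allI impI)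
  show "b \<noteq> 0" "a \<noteq> 0" using assms by (auto simp: eqv_def)
  fix A assume A: "inf_ring A"
  then interpret vring UNIV A by (simp add: inf_ring_def)
  have "inverse (a / b) \<in> units" using assms A unfolding eqv_def by (intro units_inverse) blast
  then show "b / a \<in> units" by simp
qed

lemma eqv_mult:
  assumes "a \<approx> b" "c \<approx> d"
  shows "a * c \<approx> b * d"
  unfolding eqv_def
proof (intro conjI allI impI)
  show "a * c \<noteq> 0" "b * d \<noteq> 0" using assms by (auto simp: eqv_def)
  fix A assume A: "inf_ring A"
  then interpret vring UNIV A by (simp add: inf_ring_def)
  have "(a / b) * (c / d) \<in> units" using assms A unfolding eqv_def by (intro units_mult) blast+
  then show "(a * c) / (b * d) \<in> units" by simp
qed

lemma eqv_powi:
  assumes "a \<approx> b"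
  shows "a powi n \<approx> b powi n"
  unfolding eqv_def
proof (intro conjI allI impI)
  show "a powi n \<noteq> 0" "b powi n \<noteq> 0" using assms by (auto simp: eqv_def)
  fix A assume A: "inf_ring A"
  then interpret vring UNIV A by (simp add: inf_ring_def)
  have "(a / b) powi n \<in> units" using assms A unfolding eqv_def by (intro units_powi) blast
  then show "a powi n / b powi n \<in> units" by (simp add: power_int_divide_distrib)
qed

lemma eqv_root:
  assumes "a ^ m \<approx> b ^ m"
  shows "a \<approx> b"
  unfolding eqv_def
proof (intro conjI allI impI)
  show "a \<noteq> 0" "b \<noteq> 0" using assms m by (auto simp: eqv_def)
  fix A assume A: "inf_ring A"
  then interpret vring UNIV A by (simp add: inf_ring_def)
  have "(a / b) ^ m \<in> units" using assms A by (simp add: eqv_def power_divide)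
  then show "a / b \<in> units" using root_units m by blast
qed

lemma phi_eqv:
  assumes "a \<noteq> 0"
  shows "\<exists>n. phi a \<approx> inverse t powi n"
  using infinite_place_val[OF assms] assms t_nonzero unfolding eqv_def inf_ring_def
  by (metis UNIV_I phi.hom_0_iff power_int_eq_0_iff inverse_zero_imp_zero)

lemma ev_eqv: "h \<noteq> 0 \<Longrightarrow> ev h \<approx> t ^ degree h"
  using infinite_place_unit[of UNIV _ h] t_nonzero by (auto simp: eqv_def inf_ring_def)

text \<open>With v(1/t) = m and v(y) = l, Bezout coefficients satisfying u l + w m = 1 make this
  product an element of value 1.\<close>

definition unif :: 'f where
  "unif = (let (u, w) = bezout_coefficients l (int m) in y powi u * inverse t powi w)"

lemma y_power_eqv: "y ^ m \<approx> inverse t powi l"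
proof -
  have "ev fn * ev fd powi (-1) \<approx> t ^ degree fn * (t ^ degree fd) powi (-1)"
    by (intro eqv_mult eqv_powi ev_eqv fn fd)
  moreover have "t ^ degree fn * (t ^ degree fd) powi (-1) = inverse t powi l"
    using t_nonzero by (simp add: l power_int_diff field_simps power_int_minus)
  ultimately show ?thesis
    using fd by (simp add: y f0 phi_Fract power_int_minus divide_inverse)
qed

lemma unif_power_eqv: "unif ^ m \<approx> inverse t"
proof -
  obtain u w where uw: "bezout_coefficients l (int m) = (u, w)" by fastforce
  then have *: "u * l + w * int m = 1"
    using bezout_coefficients_fst_snd[of l "int m"] coprime by simp
  have unif: "unif = y powi u * inverse t powi w" by (simp add: unif_def uw)
  have "inverse t \<approx> inverse t"
    using t_nonzero by (auto simp: eqv_def inf_ring_def vring.units_one)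
  then have "(y ^ m) powi u * inverse t powi (w * int m)
      \<approx> (inverse t powi l) powi u * inverse t powi (w * int m)"
    by (intro eqv_mult eqv_powi y_power_eqv)
  also have "(y ^ m) powi u * inverse t powi (w * int m) = unif ^ m"
    by (simp add: unif power_mult_distrib power_int_mult)
      (metis mult.commute power_int_mult power_int_of_nat)
  also have "(inverse t powi l) powi u * inverse t powi (w * int m) = inverse t powi (u * l + w * int m)"
    using t_nonzero by (simp add: power_int_add power_int_mult mult.commute[of u])
  finally show ?thesis by (simp add: *)
qed

lemma unif_nz: "unif \<noteq> 0"
  using unif_power_eqv m by (auto simp: eqv_def)

lemma y_eqv: "y \<approx> unif powi l"
proof (rule eqv_root)
  have "(unif ^ m) powi l \<approx> inverse t powi l" by (rule eqv_powi[OF unif_power_eqv])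
  also have "(unif ^ m) powi l = (unif powi l) ^ m"
    by (metis mult.commute power_int_mult power_int_of_nat)
  finally show "y ^ m \<approx> (unif powi l) ^ m" using eqv_trans[OF y_power_eqv] eqv_sym by blast
qed

lemma unif_max_ideal:
  assumes "inf_ring A"
  shows "unif \<in> vring.max_ideal A"
proof -
  interpret vring UNIV A using assms by (simp add: inf_ring_def)
  have "inverse unif \<notin> A"
  proof
    assume "inverse unif \<in> A"
    then have "inverse unif ^ m * (unif ^ m / inverse t) \<in> A"
      using unif_power_eqv assms by (intro mult power) (auto simp: eqv_def units_def)
    then have "t \<in> A" using unif_nz by (simp add: field_simps)
    then show False using assms by (simp add: inf_ring_def)
  qed
  then show ?thesis by (simp add: max_ideal_iff)
qed

text \<open>The form of the exponent matters: a factor from K(t) contributes a multiple of m, so the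
  value modulo m is that of \<open>l * int i\<close> and identifies the term.\<close>

lemma term_eqv:
  assumes "a \<noteq> 0"
  shows "\<exists>n. phi a * y ^ i \<approx> unif powi (int m * n + l * int i)"
proof -
  obtain n where n: "phi a \<approx> inverse t powi n" using phi_eqv[OF assms] by blast
  have "inverse t powi n \<approx> (unif ^ m) powi n" 
    by (rule eqv_powi[OF eqv_sym[OF unif_power_eqv]])
  then have "phi a \<approx> (unif ^ m) powi n" using eqv_trans[OF n] by blast
  moreover have "y ^ i \<approx> (unif powi l) ^ i" using eqv_powi[OF y_eqv, of "int i"] by simp
  ultimately have "phi a * y ^ i \<approx> (unif ^ m) powi n * (unif powi l) ^ i" by (rule eqv_mult)
  also have "(unif ^ m) powi n * (unif powi l) ^ i = unif powi (int m * n + l * int i)"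
    using unif_nz by (simp add: power_int_add power_int_mult)
  finally show ?thesis by blast
qed

definition elt :: "'k poly fract poly \<Rightarrow> 'f" where
  "elt G = poly (map_poly phi G) y"

lemma elt_simps [simp]:
  "elt 0 = 0" "elt 1 = 1" "elt (G + H) = elt G + elt H" "elt (G - H) = elt G - elt H"
  "elt (G * H) = elt G * elt H" "elt [:c:] = phi c" "elt [:0, 1:] = y" "elt (- G) = - elt G"
  by (simp_all add: elt_def hom_distribs)

lemma elt_altdef: "elt G = (\<Sum>i\<le>degree G. phi (coeff G i) * y ^ i)"
  by (simp add: elt_def poly_altdef)

text \<open>Terms with values distinct modulo m cannot cancel, so the value of the sum is the least
  value of a term. The last clause names a term attaining it, which reduces pole orders of functions
  to pole orders of single terms.\<close>

lemma elt_eqv: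
  assumes G: "G \<noteq> 0" "degree G < m"
  shows "\<exists>N. elt G \<approx> unif powi N \<and>
    (\<forall>i. coeff G i \<noteq> 0 \<longrightarrow> (\<exists>n\<ge>N. phi (coeff G i) * y ^ i \<approx> unif powi n)) \<and>
    (\<exists>i. coeff G i \<noteq> 0 \<and> phi (coeff G i) * y ^ i \<approx> unif powi N)"
proof -
  define I where "I = {i. coeff G i \<noteq> 0}"
  have I: "i \<le> degree G" if "i \<in> I" for i using that by (auto simp: I_def le_degree)
  then have fin: "finite I" by (meson finite_atMost finite_subset subsetI atMost_iff)
  have ne: "I \<noteq> {}" using G by (auto simp: I_def poly_eq_iff)
  define g where "g i = phi (coeff G i) * y ^ i" for i
  have "\<forall>i\<in>I. \<exists>n. g i \<approx> unif powi (int m * n + l * int i)"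
    unfolding g_def using term_eqv by (auto simp: I_def)
  then obtain n0 where n0: "\<And>i. i \<in> I \<Longrightarrow> g i \<approx> unif powi (int m * n0 i + l * int i)" by metis
  define n where "n i = int m * n0 i + l * int i" for i
  have n: "g i \<approx> unif powi n i" if "i \<in> I" for i using n0[OF that] by (simp add: n_def)
  \<comment> \<open>Equal exponents give m | l (i - j), hence m | i - j by coprimality, while |i -
    j| < m.\<close>
  have inj: "i = j" if ij: "i \<in> I" "j \<in> I" "n i = n j" for i j
  proof -
    have "l * (int i - int j) = int m * (n0 j - n0 i)" using ij(3) by (simp add: n_def algebra_simps)
    then have "int m dvd l * (int i - int j)" by (metis dvd_triv_left)
    then have "int m dvd int i - int j"
      using coprime by (simp add: coprime_commute coprime_dvd_mult_right_iff)
    moreover have "\<bar>int i - int j\<bar> < int m" using I[OF ij(1)] I[OF ij(2)] G(2) by linarith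
    ultimately show ?thesis using dvd_imp_le_int[of "int i - int j" "int m"] by auto
  qed
  have "Min (n ` I) \<in> n ` I" using fin ne by simp
  then obtain i0 where i0: "i0 \<in> I" "n i0 = Min (n ` I)" by auto
  then have min: "n i0 \<le> n i" if "i \<in> I" for i using that fin by simp
  have elt: "elt G = sum g I"
    unfolding elt_altdef g_def using I by (intro sum.mono_neutral_right) (auto simp: I_def)
  have unit: "sum g I / g i0 \<in> vring.units A" if A: "inf_ring A" for A
  proof -
    interpret vring UNIV A using A by (simp add: inf_ring_def)
    show ?thesis
    proof (rule dominant_sum[OF fin i0(1)])
      show "g i0 \<noteq> 0" using n[OF i0(1)] by (simp add: eqv_def)
      fix i assume i: "i \<in> I - {i0}"
      then have pos: "n i - n i0 > 0" using min[of i] inj[of i i0] i0(1) by force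
      have "g i * g i0 powi (-1) \<approx> unif powi n i * (unif powi n i0) powi (-1)"
        using i i0(1) by (intro eqv_mult eqv_powi n) auto
      also have "unif powi n i * (unif powi n i0) powi (-1) = unif powi (n i - n i0)"
        using unif_nz by (simp add: power_int_diff power_int_minus divide_inverse)
      finally have "g i / g i0 \<approx> unif powi (n i - n i0)"
        by (simp add: power_int_minus divide_inverse)
      then have "(g i / g i0) / unif powi (n i - n i0) \<in> units" using A by (simp add: eqv_def)
      from mult_unit_in_A_iff(2)[OF this, of "unif powi (n i - n i0)"]
      show "g i / g i0 \<in> max_ideal"
        using powi_in_A_iff(2)[OF unif_max_ideal[OF A] unif_nz] pos unif_nz by simp
    qed
  qed
  obtain A where A: "inf_ring A" using ex_infinite_place by (auto simp: inf_ring_def)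
  have "sum g I \<noteq> 0"
    using vring.units_L[OF _ unit[OF A]] A by (auto simp: inf_ring_def)
  then have "elt G \<approx> g i0"
    using n[OF i0(1)] unit by (simp add: eqv_def elt)
  then have "elt G \<approx> unif powi n i0" using n[OF i0(1)] by (rule eqv_trans)
  moreover have "\<exists>k\<ge>n i0. phi (coeff G i) * y ^ i \<approx> unif powi k" if "coeff G i \<noteq> 0" for i
    using that n[of i] min[of i] by (auto simp: I_def g_def)
  ultimately show ?thesis
    using n[OF i0(1)] i0(1) by (intro exI[of _ "n i0"]) (auto simp: g_def I_def)
qed

lemma elt_eq_0D: "elt G = 0 \<Longrightarrow> degree G < m \<Longrightarrow> G = 0"
  using elt_eqv[of G] by (auto simp: eqv_def)

section \<open>Coordinates with respect to the powers of y\<close>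

definition modul :: "'k poly fract poly" where
  "modul = monom 1 m - [:f0:]"

lemma degree_modul: "degree modul = m"
proof -
  have "degree (monom (1 :: 'k poly fract) m) = m" by (simp add: degree_monom_eq)
  moreover have "degree [:f0:] < m" using m by simp
  ultimately show ?thesis unfolding modul_def
    by (metis degree_add_eq_left degree_minus diff_conv_add_uminus)
qed

lemma elt_modul: "elt modul = 0"
proof -
  have "elt (monom 1 m) = y ^ m" by (simp add: elt_def hom_distribs poly_monom)
  then show ?thesis by (simp add: modul_def y)
qed

lemma elt_mod: "elt (G mod modul) = elt G" "degree (G mod modul) < m"
proof -
  have "elt G = elt (modul * (G div modul) + G mod modul)" by simp
  also have "\<dots> = elt (G mod modul)" unfolding elt_simps elt_modul by simp
  finally show "elt (G mod modul) = elt G" ..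
  show "degree (G mod modul) < m"
    using degree_mod_less'[of modul G] degree_modul m
    by (cases "G mod modul = 0"; cases "modul = 0") auto
qed

text \<open>The remainder modulo X^m - f0 has degree below m and vanishes by
  \<open>elt_eq_0D\<close>; total ramification takes the place of an irreducibility
  argument.\<close>

lemma elt_eq_0_dvd: "elt G = 0 \<Longrightarrow> modul dvd G"
  using elt_eq_0D[of "G mod modul"] elt_mod[of G] by (simp add: dvd_eq_mod_eq_0)

text \<open>\<open>range elt\<close> is spanned over K(t) by m powers of y, so m + 1 powers of z are
  dependent.\<close>

lemma power_relation:
  assumes z: "z \<in> range elt"
  shows "\<exists>H. H \<noteq> 0 \<and> degree H \<le> m \<and> poly (map_poly phi H) z = 0"
proof (cases "inj_on (\<lambda>j. z ^ j) {..m}")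
  \<comment> \<open>Dependence is a notion for sets, in which repeated powers of z coincide; two
    equal powers give a relation directly.\<close>
  case False
  then obtain i j where ij: "i < j" "j \<le> m" "z ^ i = z ^ j"
    by (auto simp: inj_on_def) (metis linorder_neqE_nat)
  have "monom 1 j - monom 1 i \<noteq> (0 :: 'k poly fract poly)" using ij by (auto simp: monom_eq_iff')
  moreover have "degree (monom 1 j - monom 1 i :: 'k poly fract poly) \<le> m"
    using ij by (intro degree_diff_le) (auto simp: degree_monom_eq)
  moreover have "poly (map_poly phi (monom 1 j - monom 1 i)) z = 0"
    using ij by (simp add: hom_distribs poly_monom)
  ultimately show ?thesis by blast
next
  case True
  interpret vs: vector_space "\<lambda>a z. phi a * z"
    by unfold_locales (auto simp: phi.hom_add phi.hom_mult algebra_simps)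
  have span: "elt G \<in> vs.span ((\<lambda>i. y ^ i) ` {..<m})" for G
  proof -
    have "elt (G mod modul) \<in> vs.span ((\<lambda>i. y ^ i) ` {..<m})"
      unfolding elt_altdef using elt_mod(2)[of G]
      by (intro vs.span_sum vs.span_scale vs.span_base) auto
    then show ?thesis by (simp add: elt_mod)
  qed
  have subring: "is_subring (range elt)"
    unfolding is_subring_def by (auto simp flip: elt_simps(2,4,5))
  let ?T = "(\<lambda>j. z ^ j) ` {..m}"
  have "?T \<subseteq> vs.span ((\<lambda>i. y ^ i) ` {..<m})"
  proof (rule image_subsetI)
    fix j
    obtain G where "z ^ j = elt G" using is_subringD(7)[OF subring z, of j] by blast
    then show "z ^ j \<in> vs.span ((\<lambda>i. y ^ i) ` {..<m})" using span[of G] by simp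
  qed
  moreover have "card ?T = Suc m" using card_image[OF True] by simp
  moreover have "card ((\<lambda>i. y ^ i) ` {..<m}) \<le> m" using card_image_le[of "{..<m}"] by simp
  ultimately have "vs.dependent ?T"
    using vs.independent_span_bound[of "(\<lambda>i. y ^ i) ` {..<m}" ?T] by force
  then obtain u where u: "\<exists>v\<in>?T. u v \<noteq> 0" "(\<Sum>v\<in>?T. phi (u v) * v) = 0"
    by (auto simp: vs.dependent_finite)
  define H where "H = (\<Sum>j\<le>m. monom (u (z ^ j)) j)"
  have coeff: "coeff H j = (if j \<le> m then u (z ^ j) else 0)" for j
    by (simp add: H_def coeff_sum coeff_monom)
  have "H \<noteq> 0" using u(1) coeff by (auto simp: poly_eq_iff)
  moreover have deg: "degree H \<le> m" by (rule degree_le) (simp add: coeff)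
  moreover have "poly (map_poly phi H) z = (\<Sum>v\<in>?T. phi (u v) * v)"
    by (simp add: H_def hom_distribs poly_sum poly_monom sum.reindex[OF True])
  ultimately show ?thesis using u(2) by auto
qed

text \<open>K(t)[y] is a field: a relation of least degree for z has nonzero constant term, and
  solving for that term exhibits 1/z as a polynomial in z. By \<open>gen\<close> this field is all
  of F.\<close>

lemma elt_surj: "range elt = UNIV"
proof (rule gen)
  have inv: "inverse z \<in> range elt" if z: "z \<in> range elt" for z
  proof (cases "z = 0")
    case True
    then show ?thesis using z by simp
  next
    case False
    obtain H where H: "H \<noteq> 0 \<and> poly (map_poly phi H) z = 0"
      and least: "\<And>H'. H' \<noteq> 0 \<and> poly (map_poly phi H') z = 0 \<Longrightarrow> degree H \<le> degree H'"
      using ex_has_least_nat[of "\<lambda>H. H \<noteq> 0 \<and> poly (map_poly phi H) z = 0" _ degree]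
        power_relation[OF z] by blast
    obtain c H1 where H1: "H = pCons c H1" by (cases H) auto
    have "c \<noteq> 0"
    proof
      assume "c = 0"
      then have *: "H1 \<noteq> 0 \<and> poly (map_poly phi H1) z = 0"
        using H H1 False by (auto simp: hom_distribs)
      then show False using least[OF *] H1 by simp
    qed
    have "phi c + z * poly (map_poly phi H1) z = 0" using H H1 by (simp add: hom_distribs)
    then have "z * poly (map_poly phi H1) z = phi (- c)"
      by (simp add: phi.hom_uminus eq_neg_iff_add_eq_0 add.commute)
    then have "z * (phi (inverse (- c)) * poly (map_poly phi H1) z) = phi (inverse (- c)) * phi (- c)"
      by (simp add: mult_ac)
    also have "\<dots> = 1" using \<open>c \<noteq> 0\<close> by (simp flip: phi.hom_mult)
    finally have "inverse z = phi (inverse (- c)) * poly (map_poly phi H1) z"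
      by (rule inverse_unique)
    also have "poly (map_poly phi H1) z \<in> range elt"
    proof -
      obtain G where "z = elt G" using z by auto
      then have "poly (map_poly phi H1) z = elt (pcompose H1 G)"
        by (simp add: elt_def hom_distribs poly_pcompose)
      then show ?thesis by simp
    qed
    then obtain G where "poly (map_poly phi H1) z = elt G" by auto
    then have "phi (inverse (- c)) * poly (map_poly phi H1) z = elt ([:inverse (- c):] * G)"
      by (simp only: elt_simps)
    finally show ?thesis by (metis rangeI)
  qed
  show "is_subfield (range elt)"
    unfolding is_subfield_def using inv by (auto simp flip: elt_simps(2,4,5))
  show "range phi \<subseteq> range elt" using elt_simps(6) by (metis image_subset_iff rangeI)
  show "y \<in> range elt" using elt_simps(7) by (metis rangeI)
qed

lemma coordinates:
  obtains G where "z = elt G" "degree G < m"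
  using elt_surj elt_mod by (metis rangeE UNIV_I)

section \<open>The places of F and their uniformizers\<close>

lemma infinite_place_uniformizer:
  assumes A: "inf_ring A"
  shows "vring.uniformizer UNIV A unif"
proof -
  interpret vring UNIV A using A by (simp add: inf_ring_def)
  have "\<exists>n. \<exists>u\<in>units. z = unif powi n * u" if z: "z \<noteq> 0" for z
  proof -
    obtain G where G: "z = elt G" "degree G < m" by (rule coordinates)
    then obtain N where "z \<approx> unif powi N" using elt_eqv[of G] z by (metis elt_simps(1))
    then have "z / unif powi N \<in> units" using A by (simp add: eqv_def)
    then show ?thesis using unif_nz by (intro exI[of _ N] bexI[of _ "z / unif powi N"]) auto
  qed
  then show ?thesis using unif_nz unif_max_ideal[OF A] by (auto simp: uniformizer_def)
qed

lemma inf_ring_mem_iff: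
  assumes A: "inf_ring A" and z: "z \<approx> unif powi N"
  shows "z \<in> A \<longleftrightarrow> N \<ge> 0"
proof -
  interpret vring UNIV A using A by (simp add: inf_ring_def)
  have "z / unif powi N \<in> units" using A z by (simp add: eqv_def)
  from mult_unit_in_A_iff(1)[OF this, of "unif powi N"] show ?thesis
    using powi_in_A_iff(1)[OF unif_max_ideal[OF A] unif_nz] unif_nz by simp
qed

text \<open>This is total ramification: the exponent of \<open>unif\<close> attached to an element
  does not depend on the ring, and its sign decides membership.\<close>

lemma inf_ring_unique:
  assumes "inf_ring A" "inf_ring B"
  shows "A = B"
proof -
  have "z \<in> A \<longleftrightarrow> z \<in> B" for z
  proof (cases "z = 0")
    case True
    then show ?thesis using assms vring.zero by (auto simp: inf_ring_def)
  next
    case False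
    obtain G where G: "z = elt G" "degree G < m" by (rule coordinates)
    then obtain N where "z \<approx> unif powi N" using elt_eqv[of G] False by (metis elt_simps(1))
    then show ?thesis using inf_ring_mem_iff assms by blast
  qed
  then show ?thesis by blast
qed

text \<open>The value group of a place of \<open>F\<close> is contained in \<open>1/m!\<close> times the value group of the place
  of \<open>K(t)\<close> below, because two terms of a relation among \<open>1, z, \<dots>, z ^ m\<close> have equal value.\<close>

lemma finite_place_uniformizer:
  assumes A: "vring UNIV A" "range \<iota> \<subseteq> A" "t \<in> A" "A \<noteq> UNIV"
  shows "\<exists>p. vring.uniformizer UNIV A p"
proof -
  interpret vring UNIV A by (rule A(1))
  \<comment> \<open>Otherwise y, whose m-th power would lie in A, would lie in A, and with it all of
    F.\<close>
  have "\<not> range phi \<subseteq> A"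
  proof
    assume phi: "range phi \<subseteq> A"
    then have "y ^ m \<in> A" by (auto simp: y)
    then have "y \<in> A" using root_closed m by blast
    then have "elt G \<in> A" for G unfolding elt_altdef using phi by (intro sum mult power) auto
    then have "range elt \<subseteq> A" by blast
    then show False using elt_surj A(4) by (metis top.extremum_uniqueI)
  qed
  from ex_polynomial_in_max_ideal[OF A(1-3) this]
  obtain p where p: "p \<noteq> 0" "ev p \<in> max_ideal" "\<And>h. ev h \<in> max_ideal \<Longrightarrow> p dvd h"
    using finite_place_dvd[OF A(1-3)] by metis
  have "\<exists>k. \<exists>u\<in>units. z ^ fact m = ev p powi k * u" if z: "z \<noteq> 0" for z
  proof -
    obtain H where H: "H \<noteq> 0" "degree H \<le> m" "poly (map_poly phi H) z = 0"
      using power_relation[of z] elt_surj by auto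
    define I where "I = {i. coeff H i \<noteq> 0}"
    have I: "i \<le> m" if "i \<in> I" for i
      using that H(2) by (metis (mono_tags) I_def le_degree le_trans mem_Collect_eq)
    then have fin: "finite I" by (meson finite_atMost finite_subset subsetI atMost_iff)
    have ne: "I \<noteq> {}" using H by (auto simp: I_def poly_eq_iff)
    define g where "g i = phi (coeff H i) * z ^ i" for i
    have sum: "sum g I = 0"
    proof -
      have "poly (map_poly phi H) z = (\<Sum>i\<le>degree H. g i)" by (simp add: poly_altdef g_def)
      also have "\<dots> = sum g I"
        by (intro sum.mono_neutral_right) (auto simp: I_def g_def le_degree)
      finally show ?thesis using H(3) by simp
    qed
    have gnz: "g i \<noteq> 0" if "i \<in> I" for i using that z by (auto simp: g_def I_def)
    have "\<exists>i\<in>I. \<exists>j\<in>I. i \<noteq> j \<and> g i / g j \<in> units"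
    proof (rule ccontr)
      assume "\<not> ?thesis"
      then obtain i0 where "i0 \<in> I" "\<And>i. i \<in> I - {i0} \<Longrightarrow> g i / g i0 \<in> max_ideal"
        using ex_dominant[OF fin ne, of g] gnz by (metis UNIV_I)
      then have "sum g I / g i0 \<in> units" using fin gnz by (intro dominant_sum) auto
      then show False using sum by (simp add: units_def)
    qed
    then obtain i j where ij: "i \<in> I" "j \<in> I" "i < j" "g i / g j \<in> units"
    proof -
      assume *: "\<And>i j. i \<in> I \<Longrightarrow> j \<in> I \<Longrightarrow> i < j \<Longrightarrow> g i / g j \<in> units \<Longrightarrow> thesis"
      assume "\<exists>i\<in>I. \<exists>j\<in>I. i \<noteq> j \<and> g i / g j \<in> units"
      then obtain i j where ij: "i \<in> I" "j \<in> I" "i \<noteq> j" "g i / g j \<in> units" by blast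
      have "g j / g i \<in> units" using units_inverse[OF ij(4)] by simp
      then show thesis using *[of i j] *[of j i] ij by (cases "i < j") auto
    qed
    define a where "a = coeff H i / coeff H j"
    have "a \<noteq> 0" using ij by (simp add: a_def I_def)
    from finite_place_val[OF A(1-3) p this] obtain n u
      where u: "u \<in> units" "phi a = ev p powi n * u" by blast
    \<comment> \<open>Two terms of equal value, solved for z: a power of z with exponent at most m
      is an element of K(t) up to a unit.\<close>
    have zji: "z ^ (j - i) = ev p powi n * (u / (g i / g j))"
      using z ij gnz[OF ij(1)] gnz[OF ij(2)] u(2)[symmetric] unfolding g_def a_def
      by (simp add: power_diff phi.hom_div field_simps)
    have "j - i dvd fact m" using ij I[OF ij(2)] by (intro dvd_fact) auto
    then obtain q where q: "fact m = (j - i) * q" by (rule dvdE)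
    have "z ^ fact m = (ev p powi n * (u / (g i / g j))) ^ q" by (simp only: q power_mult zji)
    also have "\<dots> = ev p powi (n * int q) * (u / (g i / g j)) ^ q"
      by (simp only: power_mult_distrib power_int_mult power_int_of_nat)
    finally show ?thesis using units_power[OF units_divide[OF u(1) ij(4)]] by blast
  qed
  then show ?thesis
    using uniformizer_of_root[of "ev p" "fact m"] p by simp
qed

end

section \<open>Functions with poles only above the pole of \<open>t\<close>\<close>

text \<open>X^m - 1 splits, and a double root would be a root of the derivative m X^(m-1), hence 0,
  which is no root of X^m - 1.\<close>

lemma card_roots_of_unity:
  assumes m: "m > 0" "(of_nat m :: 'w::alg_closed_field) \<noteq> 0"
  shows "finite {z :: 'w. z ^ m = 1}" "card {z :: 'w. z ^ m = 1} = m"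
proof -
  define q :: "'w poly" where "q = monom 1 m - 1"
  have deg: "degree q = m"
  proof -
    have "degree (- 1 :: 'w poly) < degree (monom 1 m :: 'w poly)" using m by (simp add: degree_monom_eq)
    from degree_add_eq_left[OF this] show ?thesis by (simp add: q_def degree_monom_eq)
  qed
  then have "q \<noteq> 0" using m by auto
  have poly_q: "poly q z = z ^ m - 1" for z by (simp add: q_def poly_monom)
  have lc: "lead_coeff q = 1" unfolding deg using m by (simp add: q_def coeff_1)
  from alg_closed_imp_factorization[OF \<open>q \<noteq> 0\<close>]
  obtain A where A: "size A = m" "q = (\<Prod>x\<in>#A. [:- x, 1:])" unfolding lc by (auto simp: deg)
  have roots: "poly q z = 0 \<longleftrightarrow> z \<in># A" for z
    unfolding A(2) poly_prod_mset by (simp add: prod_mset_zero_iff image_iff)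
  have simple: "count A x \<le> 1" for x
  proof (rule ccontr)
    assume "\<not> count A x \<le> 1"
    then have "{#x, x#} \<subseteq># A" by (auto simp: subseteq_mset_def)
    then obtain B where "A = {#x, x#} + B" by (auto simp: subset_mset.le_iff_add)
    then have *: "q = [:- x, 1:] * ([:- x, 1:] * (\<Prod>x\<in>#B. [:- x, 1:]))" by (simp add: A(2))
    have "poly q x = 0" "poly (pderiv q) x = 0"
      unfolding * pderiv_mult poly_mult poly_add by simp_all
    moreover have "poly (pderiv q) x = of_nat m * x ^ (m - 1)"
      by (simp add: q_def pderiv_diff pderiv_monom poly_monom)
    ultimately show False using m by (auto simp: poly_q power_0_left)
  qed
  have "{z. z ^ m = 1} = set_mset A" using roots by (auto simp: poly_q)
  moreover have "A = mset_set (set_mset A)"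
  proof (rule multiset_eqI)
    fix x
    show "count A x = count (mset_set (set_mset A)) x"
      using simple[of x] by (cases "x \<in># A") (auto simp: not_in_iff Suc_le_eq intro: le_antisym)
  qed
  ultimately show "finite {z :: 'w. z ^ m = 1}" "card {z :: 'w. z ^ m = 1} = m"
    using A(1) by (simp, metis size_mset_set)
qed

text \<open>Multiplication by a root of unity w permutes the roots and multiplies the sum by w^i, so
  the sum vanishes as soon as some w^i differs from 1.\<close>

lemma sum_roots_of_unity:
  assumes m: "m > 0" "(of_nat m :: 'w::alg_closed_field) \<noteq> 0"
  shows "(\<Sum>z | z ^ m = 1. z ^ i) = (if m dvd i then of_nat m else (0 :: 'w))"
proof (cases "m dvd i")
  case True
  then have "z ^ i = 1" if "z ^ m = 1" for z :: 'w
    using that by (auto simp: power_mult)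
  then show ?thesis using True card_roots_of_unity[OF m] by simp
next
  case False
  define r where "r = i mod m"
  have r: "0 < r" "r < m" using False m by (auto simp: r_def mod_greater_zero_iff_not_dvd)
  have pow: "z ^ i = z ^ r" if "z ^ m = 1" for z :: 'w
  proof -
    have "z ^ i = z ^ (m * (i div m) + r)" by (simp add: r_def)
    also have "\<dots> = z ^ r" using that by (simp only: power_add power_mult) simp
    finally show ?thesis .
  qed
  \<comment> \<open>X^r - 1 has at most r < m roots, too few to include all m-th roots of
    unity.\<close>
  have "\<exists>w :: 'w. w ^ m = 1 \<and> w ^ r \<noteq> 1"
  proof (rule ccontr)
    assume *: "\<not> ?thesis"
    have nz: "monom 1 r - 1 \<noteq> (0 :: 'w poly)"
      using r by (auto simp: monom_eq_1_iff)
    have "{z :: 'w. z ^ m = 1} \<subseteq> {z. poly (monom 1 r - 1) z = 0}"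
      using * by (auto simp: poly_monom)
    then have "m \<le> card {z :: 'w. poly (monom 1 r - 1) z = 0}"
      using card_mono[OF poly_roots_finite[OF nz]] card_roots_of_unity(2)[OF m] by metis
    also have "\<dots> \<le> degree (monom 1 r - 1 :: 'w poly)" by (rule card_poly_roots_bound[OF nz])
    also have "\<dots> \<le> r" by (intro degree_diff_le) (auto simp: degree_monom_eq)
    finally show False using r by simp
  qed
  then obtain w :: 'w where w: "w ^ m = 1" "w ^ r \<noteq> 1" by blast
  have "w \<noteq> 0" using w m by (auto simp: power_0_left)
  have "(\<Sum>z | z ^ m = 1. z ^ i) = (\<Sum>z | z ^ m = 1. (w * z) ^ i)"
    using w \<open>w \<noteq> 0\<close>
    by (intro sum.reindex_bij_witness[of _ "\<lambda>z. w * z" "\<lambda>z. z / w"])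
      (auto simp: power_divide power_mult_distrib)
  also have "\<dots> = w ^ r * (\<Sum>z | z ^ m = 1. z ^ i)"
    using pow[OF w(1)] by (simp add: power_mult_distrib sum_distrib_left)
  finally have "(1 - w ^ r) * (\<Sum>z | z ^ m = 1. z ^ i) = 0" by (simp add: algebra_simps)
  then show ?thesis using w False by simp
qed

section \<open>Conjugation over K(t) into the algebraic closure\<close>

context kummer
begin

interpretation ac: field_hom to_ac
  by unfold_locales auto

interpretation psi: field_hom "to_ac \<circ> phi"
  by unfold_locales (auto simp: hom_distribs)

interpretation psi_poly: map_poly_inj_idom_hom "to_ac \<circ> phi" ..

definition conj_elt :: "'f alg_closure \<Rightarrow> 'k poly fract poly \<Rightarrow> 'f alg_closure" where
  "conj_elt \<zeta> G = poly (map_poly (to_ac \<circ> phi) G) (\<zeta> * to_ac y)"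

lemma conj_elt_simps [simp]:
  "conj_elt \<zeta> 0 = 0" "conj_elt \<zeta> 1 = 1" "conj_elt \<zeta> (G + H) = conj_elt \<zeta> G + conj_elt \<zeta> H"
  "conj_elt \<zeta> (G - H) = conj_elt \<zeta> G - conj_elt \<zeta> H"
  "conj_elt \<zeta> (G * H) = conj_elt \<zeta> G * conj_elt \<zeta> H" "conj_elt \<zeta> [:c:] = to_ac (phi c)"
  by (simp_all add: conj_elt_def psi_poly.hom_add psi_poly.hom_minus psi_poly.hom_mult
      psi_poly.hom_one psi_poly.hom_zero hom_distribs)

text \<open>\<open>\<zeta> * to_ac y\<close> is again a root of \<open>modul\<close>, so the value
  does not depend on the polynomial representing an element of F. This justifies the choice made in
  \<open>conjugate\<close>.\<close>

lemma conj_elt_cong: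
  assumes "\<zeta> ^ m = 1" "elt G = elt H"
  shows "conj_elt \<zeta> G = conj_elt \<zeta> H"
proof -
  have "modul dvd G - H" using assms(2) by (intro elt_eq_0_dvd) simp
  then obtain Q where Q: "G - H = modul * Q" by (rule dvdE)
  have "conj_elt \<zeta> modul = (\<zeta> * to_ac y) ^ m - to_ac (phi f0)"
    by (simp add: modul_def) (simp add: conj_elt_def psi.map_poly_hom_monom poly_monom)
  also have "\<dots> = 0" using assms(1) by (simp add: power_mult_distrib y flip: to_ac_power)
  finally have "conj_elt \<zeta> (G - H) = 0" unfolding Q by simp
  then show ?thesis by simp
qed

definition conjugate :: "'f alg_closure \<Rightarrow> 'f \<Rightarrow> 'f alg_closure" where
  "conjugate \<zeta> z = conj_elt \<zeta> (SOME G. z = elt G)"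

lemma conj_elt:
  assumes "\<zeta> ^ m = 1"
  shows "conjugate \<zeta> (elt G) = conj_elt \<zeta> G"
  unfolding conjugate_def
  by (rule conj_elt_cong[OF assms]) (metis (mono_tags) someI)

lemma conjugate_hom:
  assumes "\<zeta> ^ m = 1"
  shows "field_hom (conjugate \<zeta>)"
proof
  note c = conj_elt[OF assms]
  show "conjugate \<zeta> 0 = 0" "conjugate \<zeta> 1 = 1" using c[of 0] c[of 1] by simp_all
  fix z w
  obtain G where G: "z = elt G" by (rule coordinates)
  obtain H where H: "w = elt H" by (rule coordinates)
  show "conjugate \<zeta> (z + w) = conjugate \<zeta> z + conjugate \<zeta> w" "conjugate \<zeta> (z * w) = conjugate \<zeta> z * conjugate \<zeta> w"
    using c[of "G + H"] c[of "G * H"] by (simp_all add: G H c)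
qed

lemma conjugate_phi: "\<zeta> ^ m = 1 \<Longrightarrow> conjugate \<zeta> (phi a) = to_ac (phi a)"
  using conj_elt[of \<zeta> "[:a:]"] by simp

text \<open>The discrete Fourier transform over the \<open>m\<close>-th roots of unity isolates one coordinate.\<close>

lemma sum_conjugate:
  assumes G: "degree G < m" and i: "i < m"
  shows "(\<Sum>\<zeta> | \<zeta> ^ m = 1. \<zeta> ^ (m - i) * conjugate \<zeta> (elt G)) = of_nat m * to_ac (phi (coeff G i) * y ^ i)"
proof -
  have unit: "(of_nat m :: 'f alg_closure) \<noteq> 0"
  proof -
    have "to_ac (\<iota> (of_nat m)) \<noteq> 0" using m_unit by simp
    then show ?thesis by (simp add: iota.hom_of_nat)
  qed
  have "(\<Sum>\<zeta> | \<zeta> ^ m = 1. \<zeta> ^ (m - i) * conjugate \<zeta> (elt G)) =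
      (\<Sum>\<zeta> | \<zeta> ^ m = 1. \<Sum>j\<le>degree G. to_ac (phi (coeff G j) * y ^ j) * \<zeta> ^ (m - i + j))"
    by (intro sum.cong refl)
      (simp add: conj_elt conj_elt_def poly_altdef sum_distrib_left power_add power_mult_distrib mult_ac)
  also have "\<dots> = (\<Sum>j\<le>degree G. to_ac (phi (coeff G j) * y ^ j) * (\<Sum>\<zeta> | \<zeta> ^ m = 1. \<zeta> ^ (m - i + j)))"
    by (subst sum.swap) (simp add: sum_distrib_left)
  also have "\<dots> = (\<Sum>j\<le>degree G. if j = i then to_ac (phi (coeff G j) * y ^ j) * of_nat m else 0)"
  proof (intro sum.cong refl)
    fix j assume j: "j \<in> {..degree G}"
    \<comment> \<open>The exponent m - i stands for -i within the natural numbers; since 0 < m - i +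
      j < 2 m, the only possible multiple of m is m itself.\<close>
    have "m dvd m - i + j \<longleftrightarrow> j = i"
    proof
      assume "m dvd m - i + j"
      then obtain q where q: "m - i + j = m * q" by (rule dvdE)
      have "0 < m - i + j" "m - i + j < m * 2" using i j G by auto
      then have "q = 1" using q by (cases q) (auto simp: less_Suc_eq_le)
      then show "j = i" using q i by simp
    qed (use i in auto)
    then show "to_ac (phi (coeff G j) * y ^ j) * (\<Sum>\<zeta> | \<zeta> ^ m = 1. \<zeta> ^ (m - i + j)) =
        (if j = i then to_ac (phi (coeff G j) * y ^ j) * of_nat m else 0)"
      using sum_roots_of_unity[OF m unit] by simp
  qed
  also have "\<dots> = of_nat m * to_ac (phi (coeff G i) * y ^ i)"
    using le_degree[of G i] by (cases "i \<le> degree G") (auto simp: coeff_eq_0)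
  finally show ?thesis .
qed

text \<open>The integral closure of K[t] in F, given by valuation rings so that membership can be
  tested on preimages under conjugations. The trivial ring \<open>A = UNIV\<close> imposes no
  condition.\<close>

definition regular :: "'f set" where
  "regular = {z. \<forall>A. vring UNIV A \<longrightarrow> range \<iota> \<subseteq> A \<longrightarrow> t \<in> A \<longrightarrow> z \<in> A}"

text \<open>Conjugates of a regular function lie in every valuation ring B above K[t], because the
  preimage of B is a valuation ring of F above K[t]. The Fourier sum puts a_i y^i into B; its m-th
  power lies in K(t), where integrality means being a polynomial.\<close>

lemma regular_coordinate:
  assumes G: "degree G < m" and reg: "elt G \<in> regular"
  shows "\<exists>h. coeff G i ^ m * f0 ^ i = to_fract h"
proof (cases "i < m")
  case False
  then have "coeff G i = 0" using G by (intro coeff_eq_0) simp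
  then show ?thesis using m by (intro exI[of _ 0]) (simp add: power_0_left)
next
  case i: True
  show ?thesis
  proof (rule polynomial_if_integral[of to_ac])
    show "field_hom to_ac" by (rule ac.field_hom_axioms)
    fix B :: "'f alg_closure set"
    assume B: "vring UNIV B" "to_ac ` range \<iota> \<subseteq> B" "to_ac t \<in> B"
    interpret B: vring UNIV B by (rule B(1))
    have root: "\<zeta> \<in> B" if "\<zeta> ^ m = 1" for \<zeta>
      using that B.root_closed[of \<zeta> m] B.one m by simp
    have conj: "conjugate \<zeta> (elt G) \<in> B" if z: "\<zeta> ^ m = 1" for \<zeta>
    proof -
      interpret c: field_hom "conjugate \<zeta>" by (rule conjugate_hom[OF z])
      define A where "A = conjugate \<zeta> -` B"
      have A: "vring UNIV A"
      proof
        fix z :: 'f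
        show "z \<in> A \<or> inverse z \<in> A" using B.total[of "conjugate \<zeta> z"] by (simp add: A_def c.hom_inverse)
      qed (auto simp: A_def is_subfield_UNIV c.hom_minus c.hom_mult B.diff B.mult)
      have "conjugate \<zeta> (\<iota> c) = to_ac (\<iota> c)" for c
        using conjugate_phi[OF z, of "to_fract [:c:]"] by simp
      then have "range \<iota> \<subseteq> A" using B(2) by (auto simp: A_def image_subset_iff)
      moreover have "t \<in> A"
        using conjugate_phi[OF z, of "to_fract [:0, 1:]"] B(3) by (simp add: A_def)
      ultimately show ?thesis using reg A by (auto simp: regular_def A_def)
    qed
    have "of_nat m * to_ac (phi (coeff G i) * y ^ i) \<in> B"
      unfolding sum_conjugate[OF G i, symmetric] using root conj by (intro B.sum B.mult B.power) auto
    moreover have "to_ac (\<iota> (inverse (of_nat m))) \<in> B" using B(2) by blast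
    ultimately have "to_ac (\<iota> (inverse (of_nat m))) * (of_nat m * to_ac (phi (coeff G i) * y ^ i)) \<in> B"
      by (rule B.mult[rotated])
    moreover have "to_ac (\<iota> (inverse (of_nat m))) * of_nat m = 1"
    proof -
      have "to_ac (\<iota> (inverse (of_nat m) * of_nat m)) = 1" using m_unit by simp
      then show ?thesis by (simp only: iota.hom_mult to_ac_mult iota.hom_of_nat to_ac_of_nat)
    qed
    ultimately have "to_ac (phi (coeff G i) * y ^ i) \<in> B" by (simp only: mult.assoc[symmetric] mult_1)
    then have "to_ac (phi (coeff G i) * y ^ i) ^ m \<in> B" by (rule B.power)
    moreover have "(phi (coeff G i) * y ^ i) ^ m = phi (coeff G i ^ m * f0 ^ i)"
      by (simp add: power_mult_distrib hom_distribs flip: y) (simp add: mult.commute flip: power_mult)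
    ultimately show "to_ac (phi (coeff G i ^ m * f0 ^ i)) \<in> B" by (simp only: to_ac_power[symmetric])
  qed
qed

lemma regular_term:
  assumes "a ^ m * f0 ^ i = to_fract h"
  shows "phi a * y ^ i \<in> regular" "(phi a * y ^ i) ^ m = ev h"
proof -
  have "(phi a * y ^ i) ^ m = phi (a ^ m * f0 ^ i)"
    by (simp add: power_mult_distrib hom_distribs flip: y) (simp add: mult.commute flip: power_mult)
  then show pow: "(phi a * y ^ i) ^ m = ev h" by (simp add: assms)
  show "phi a * y ^ i \<in> regular"
    unfolding regular_def
  proof (intro CollectI allI impI)
    fix A assume A: "vring UNIV A" "range \<iota> \<subseteq> A" "t \<in> A"
    interpret vring UNIV A by (rule A(1))
    have "ev h \<in> A" by (rule ev_in_subring[OF vring_is_subring[OF A(1)] A(2,3)])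
    then show "phi a * y ^ i \<in> A" using root_closed[of "phi a * y ^ i" m] pow m by simp
  qed
qed

lemma term_degree:
  assumes "a ^ m * f0 ^ i = to_fract h" "a \<noteq> 0"
  shows "h \<noteq> 0" "phi a * y ^ i \<approx> unif powi (- int (degree h))"
proof -
  note pow = regular_term(2)[OF assms(1)]
  have "phi a * y ^ i \<noteq> 0" using assms(2) y_nz by simp
  then show h: "h \<noteq> 0" using pow by auto
  show "phi a * y ^ i \<approx> unif powi (- int (degree h))"
  proof (rule eqv_root)
    have "(inverse t) powi (- int (degree h)) \<approx> (unif ^ m) powi (- int (degree h))"
      by (rule eqv_powi[OF eqv_sym[OF unif_power_eqv]])
    also have "(unif ^ m) powi (- int (degree h)) = (unif powi (- int (degree h))) ^ m"
      by (metis mult.commute power_int_mult power_int_of_nat)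
    also have "inverse t powi (- int (degree h)) = t ^ degree h"
      by (simp add: power_int_minus power_inverse)
    finally show "(phi a * y ^ i) ^ m \<approx> (unif powi (- int (degree h))) ^ m"
      using eqv_trans[OF ev_eqv[OF h]] by (simp only: pow)
  qed
qed

section \<open>The Weierstrass semigroup at the ramified place\<close>

lemma eqv_unique:
  assumes "z \<approx> unif powi N" "z \<approx> unif powi k"
  shows "N = k"
proof -
  obtain A where A: "inf_ring A" using ex_infinite_place by (auto simp: inf_ring_def)
  then interpret vring UNIV A by (simp add: inf_ring_def)
  have "unif powi N \<approx> unif powi k" using eqv_trans[OF eqv_sym] assms by blast
  then have "unif powi N / unif powi k \<in> units" using A by (simp add: eqv_def)
  then show ?thesis
    using powi_unit_unique[OF unif_max_ideal[OF A] unif_nz units_one, of "unif powi N / unif powi k" N k]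
      unif_nz by simp
qed

text \<open>\<open>degree h\<close> is the pole order of the term \<open>phi a * y ^ i\<close>
  itself: the m-th power of the term is \<open>ev h\<close>, and t has a pole of order m.\<close>

definition pole_orders :: "nat set" where
  "pole_orders = {degree h | h a i. a \<noteq> 0 \<and> i < m \<and> a ^ m * f0 ^ i = to_fract h}"

lemma regular_pole_orders:
  "{N. \<exists>z\<in>regular. z \<approx> unif powi (- N)} = int ` pole_orders"
proof safe
  fix N z assume z: "z \<in> regular" "z \<approx> unif powi (- N)"
  obtain G where G: "z = elt G" "degree G < m" by (rule coordinates)
  have "G \<noteq> 0" using z G by (auto simp: eqv_def)
  from elt_eqv[OF this G(2)] obtain k i where k: "elt G \<approx> unif powi k" "coeff G i \<noteq> 0"
    "phi (coeff G i) * y ^ i \<approx> unif powi k" by blast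
  have Nk: "k = - N" using eqv_unique[OF k(1)] z(2) G(1) by simp
  obtain h where h: "coeff G i ^ m * f0 ^ i = to_fract h"
    using regular_coordinate[OF G(2)] z(1) G(1) by auto
  have "k = - int (degree h)" by (rule eqv_unique[OF k(3) term_degree(2)[OF h k(2)]])
  then have "N = int (degree h)" using Nk by simp
  moreover have "i < m" using k(2) G(2) le_degree le_less_trans by blast
  ultimately show "N \<in> int ` pole_orders" using h k(2) by (auto simp: pole_orders_def)
next
  fix n assume "n \<in> pole_orders"
  then obtain h a i where h: "n = degree h" "a \<noteq> 0" "a ^ m * f0 ^ i = to_fract h"
    by (auto simp: pole_orders_def)
  then show "\<exists>z\<in>regular. z \<approx> unif powi (- int n)"
    using regular_term(1)[OF h(3)] term_degree(2)[OF h(3,2)] by auto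
qed

theorem infinite_place_semigroup:
  assumes A: "inf_ring A"
  shows "weierstrass_semigroup (range \<iota>) UNIV (vring.max_ideal A) = pole_orders"
proof -
  interpret vring UNIV A using A by (simp add: inf_ring_def)
  have unif: "uniformizer unif" by (rule infinite_place_uniformizer[OF A])
  have t_notin: "t \<notin> range \<iota>"
  proof
    assume "t \<in> range \<iota>"
    then show False using A by (auto simp: inf_ring_def)
  qed
  note valA = inf_ring_valuation_ring[OF A]
  \<comment> \<open>The sign of \<open>place_val\<close> says whether z is integral only where a
    uniformizer exists, which \<open>finite_place_uniformizer\<close> ensures at all these
    places.\<close>
  have other: "z \<in> regular \<longleftrightarrow>
      (\<forall>P. is_place (range \<iota>) UNIV P \<longrightarrow> P \<noteq> max_ideal \<longrightarrow> place_val UNIV P z \<ge> 0)" (is "_ \<longleftrightarrow> ?R")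
    if z: "z \<noteq> 0" for z
  proof
    assume reg: "z \<in> regular"
    show ?R
    proof (intro allI impI)
      fix P assume P: "is_place (range \<iota>) UNIV P" "P \<noteq> max_ideal"
      then obtain B where B: "valuation_ring (range \<iota>) UNIV B" "P = vring.max_ideal B"
        using is_place_iff[OF is_subfield_UNIV] by metis
      interpret B: vring UNIV B by (rule valuation_ring_vring[OF is_subfield_UNIV B(1)])
      have "t \<in> B"
      proof (rule ccontr)
        assume "t \<notin> B"
        then have "inf_ring B" using B by (auto simp: inf_ring_def B.vring_axioms valuation_ring_def)
        then show False using P(2) B(2) inf_ring_unique[OF A] by simp
      qed
      moreover have "range \<iota> \<subseteq> B" "B \<noteq> UNIV" using B(1) by (auto simp: valuation_ring_def)
      ultimately obtain p where p: "B.uniformizer p"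
        using finite_place_uniformizer[OF B.vring_axioms] by blast
      have "z \<in> B" using reg \<open>t \<in> B\<close> \<open>range \<iota> \<subseteq> B\<close> B.vring_axioms by (simp add: regular_def)
      then show "place_val UNIV P z \<ge> 0" using B.place_val_sign(1)[OF p _ z] B(2) by simp
    qed
  next
    assume R: ?R
    show "z \<in> regular"
      unfolding regular_def
    proof (intro CollectI allI impI)
      fix B assume B: "vring UNIV B" "range \<iota> \<subseteq> B" "t \<in> B"
      interpret B: vring UNIV B by (rule B(1))
      show "z \<in> B"
      proof (cases "B = UNIV")
        case False
        have "valuation_ring (range \<iota>) UNIV B"
          using B t_notin False B.diff B.mult B.total by (auto simp: valuation_ring_def)
        then have "is_place (range \<iota>) UNIV B.max_ideal"
          using is_place_iff[OF is_subfield_UNIV] by blast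
        moreover have "B.max_ideal \<noteq> max_ideal"
          using max_ideal_inj[OF B(1) vring_axioms] B(3) A by (auto simp: inf_ring_def)
        ultimately have "place_val UNIV B.max_ideal z \<ge> 0" using R by blast
        then show ?thesis
          using finite_place_uniformizer[OF B False] B.place_val_sign(1)[OF _ _ z] by auto
      qed simp
    qed
  qed
  have place: "is_place (range \<iota>) UNIV max_ideal"
    using valA is_place_iff[OF is_subfield_UNIV] by blast
  have pole: "pole_divisor (range \<iota>) UNIV z = point_divisor n max_ideal \<longleftrightarrow>
      z \<in> regular \<and> max 0 (- place_val UNIV max_ideal z) = int n" (is "?D = ?E \<longleftrightarrow> _") if z: "z \<noteq> 0" for z n
  proof -
    have "?D = ?E \<longleftrightarrow> (\<forall>P. ?D P = ?E P)" by (simp add: fun_eq_iff)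
    also have "\<dots> \<longleftrightarrow> (\<forall>P. P \<noteq> max_ideal \<longrightarrow> ?D P = ?E P) \<and> ?D max_ideal = ?E max_ideal" by metis
    also have "(\<forall>P. P \<noteq> max_ideal \<longrightarrow> ?D P = ?E P) \<longleftrightarrow> z \<in> regular"
      unfolding other[OF z] by (simp add: pole_divisor_def point_divisor_def max_def) force
    also have "?D max_ideal = ?E max_ideal \<longleftrightarrow> max 0 (- place_val UNIV max_ideal z) = int n"
      using place by (simp add: pole_divisor_def point_divisor_def)
    finally show ?thesis .
  qed
  have val: "z \<approx> unif powi place_val UNIV max_ideal z" if z: "z \<noteq> 0" for z
  proof -
    obtain G where G: "z = elt G" "degree G < m" by (rule coordinates)
    then obtain N where N: "z \<approx> unif powi N" using elt_eqv[of G] z by (metis elt_simps(1))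
    then have "z / unif powi N \<in> units" using A by (simp add: eqv_def)
    from place_val_eq[OF unif this, of N] have "place_val UNIV max_ideal z = N" using unif_nz by simp
    then show ?thesis using N by simp
  qed
  \<comment> \<open>\<open>pole_divisor\<close> truncates at 0, so for n = 0 it does not tell a unit
    from a function with a zero. A nonzero regular function has no zero here, as its pole order is a
    natural number.\<close>
  have nonpos: "place_val UNIV max_ideal z \<le> 0" if "z \<noteq> 0" "z \<in> regular" for z
  proof -
    have "- place_val UNIV max_ideal z \<in> int ` pole_orders"
      using val[OF that(1)] that(2) by (subst regular_pole_orders[symmetric]) auto
    then show ?thesis by auto
  qed
  have "n \<in> weierstrass_semigroup (range \<iota>) UNIV max_ideal \<longleftrightarrow>
      (\<exists>z\<in>regular. z \<approx> unif powi (- int n))" for n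
  proof
    assume "n \<in> weierstrass_semigroup (range \<iota>) UNIV max_ideal"
    then obtain z where z: "z \<noteq> 0" "z \<in> regular" "max 0 (- place_val UNIV max_ideal z) = int n"
      using pole by (auto simp: weierstrass_semigroup_def)
    then have "place_val UNIV max_ideal z = - int n" using nonpos by force
    then show "\<exists>z\<in>regular. z \<approx> unif powi (- int n)" using val[OF z(1)] z(2) by auto
  next
    assume "\<exists>z\<in>regular. z \<approx> unif powi (- int n)"
    then obtain z where z: "z \<in> regular" "z \<approx> unif powi (- int n)" by blast
    then have z0: "z \<noteq> 0" by (simp add: eqv_def)
    have "place_val UNIV max_ideal z = - int n" using eqv_unique[OF val[OF z0] z(2)] .
    then show "n \<in> weierstrass_semigroup (range \<iota>) UNIV max_ideal"
      using z0 z(1) pole[OF z0, of n] by (auto simp: weierstrass_semigroup_def)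
  qed
  moreover have "(\<exists>z\<in>regular. z \<approx> unif powi (- int n)) \<longleftrightarrow> n \<in> pole_orders" for n
    using regular_pole_orders by (auto simp: set_eq_iff)
  ultimately show ?thesis by blast
qed

end

section \<open>Pole orders in terms of the irreducible factors\<close>

lemma to_fract_power: "to_fract (g ^ n) = to_fract g ^ n"
  by (induction n) auto

lemma ex_prime_divisor:
  fixes w :: "'k::field poly"
  assumes "degree w \<noteq> 0"
  shows "\<exists>q. q dvd w \<and> prime_elem q"
proof -
  obtain q where q: "q dvd w \<and> degree q \<noteq> 0"
    and least: "\<And>q'. q' dvd w \<and> degree q' \<noteq> 0 \<Longrightarrow> degree q \<le> degree q'"
    using ex_has_least_nat[of "\<lambda>q. q dvd w \<and> degree q \<noteq> 0" w degree] assms dvd_refl[of w] by metis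
  have "irreducible q"
  proof (rule irreducibleI)
    show "q \<noteq> 0" "\<not> is_unit q" using q by (auto simp: is_unit_iff_degree)
    fix a b assume ab: "q = a * b"
    then have nz: "a \<noteq> 0" "b \<noteq> 0" using \<open>q \<noteq> 0\<close> by auto
    have "a dvd w" using ab q by (auto dest: dvd_mult_left)
    have "degree q = degree a + degree b" using nz by (simp add: ab degree_mult_eq)
    then have "degree a = 0 \<or> degree b = 0"
      using least[of a] \<open>a dvd w\<close> by linarith
    then show "is_unit a \<or> is_unit b" using nz by (simp add: is_unit_iff_degree)
  qed
  then show ?thesis using q field_poly_irreducible_imp_prime by blast
qed

lemma prime_elem_dvd_prod:
  assumes "finite I" "prime_elem q" "q dvd (\<Prod>k\<in>I. g k)"
  shows "\<exists>k\<in>I. q dvd g k"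
  using assms(1,3)
proof (induction I rule: finite_induct)
  case empty
  then show ?case using assms(2) by (simp add: prime_elem_def)
next
  case (insert k I)
  then show ?case using prime_elem_dvd_multD[OF assms(2)] by auto
qed

text \<open>Write b with a denominator of least degree. A prime factor q of it does not divide the
  numerator, so q^m divides the product of the \<open>p k ^ c k\<close>; but q is associated to a
  single \<open>p k\<close>, whose exponent is below m.\<close>

lemma polynomial_if_power_polynomial:
  fixes p :: "'i \<Rightarrow> 'k::field poly" and b :: "'k poly fract"
  assumes I: "finite I" and irred: "\<And>k. k \<in> I \<Longrightarrow> irreducible (p k)"
    and ndvd: "\<And>k j. k \<in> I \<Longrightarrow> j \<in> I \<Longrightarrow> k \<noteq> j \<Longrightarrow> \<not> p k dvd p j"
    and c: "\<And>k. k \<in> I \<Longrightarrow> c k < m" and m: "m > 0"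
    and eq: "b ^ m * to_fract (\<Prod>k\<in>I. p k ^ c k) = to_fract h"
  shows "\<exists>b'. b = to_fract b'"
proof -
  obtain u0 w0 where uw0: "b = Fract u0 w0" "w0 \<noteq> 0" by (cases b)
  obtain w where w: "w \<noteq> 0 \<and> (\<exists>u. b = Fract u w)"
    and least: "\<And>w'. w' \<noteq> 0 \<and> (\<exists>u. b = Fract u w') \<Longrightarrow> degree w \<le> degree w'"
    using ex_has_least_nat[of "\<lambda>w. w \<noteq> 0 \<and> (\<exists>u. b = Fract u w)" w0 degree] uw0 by blast
  from w obtain u where u: "b = Fract u w" by blast
  define R where "R = (\<Prod>k\<in>I. p k ^ c k)"
  have main: "u ^ m * R = h * w ^ m"
  proof -
    have b: "b = to_fract u / to_fract w" using u by (simp add: Fract_conv_to_fract)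
    have "to_fract w \<noteq> 0" using w by simp
    then have "to_fract u ^ m * to_fract R = to_fract h * to_fract w ^ m"
      using eq unfolding b power_divide R_def by (simp add: field_simps)
    then have "to_fract (u ^ m * R) = to_fract (h * w ^ m)"
      by (simp only: to_fract_mult to_fract_power)
    then show ?thesis by (simp only: to_fract_eq_iff)
  qed
  have "degree w = 0"
  proof (rule ccontr)
    assume "degree w \<noteq> 0"
    then have "\<not> is_unit w" using w by (auto simp: is_unit_iff_degree)
    obtain q where q: "q dvd w" "prime_elem q"
      using ex_prime_divisor \<open>degree w \<noteq> 0\<close> by blast
    have q0: "q \<noteq> 0" "degree q > 0"
      using q(2) by (auto simp: prime_elem_def is_unit_iff_degree)
    have qu: "\<not> q dvd u"
    proof
      assume "q dvd u"
      then obtain u' where u': "u = q * u'" by (rule dvdE)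
      from q(1) obtain w' where w': "w = q * w'" by (rule dvdE)
      have w'0: "w' \<noteq> 0" using w w' by auto
      have "b = Fract u' w'" using u w u' w' w'0 by (simp add: eq_fract)
      with least[of w'] w'0 have "degree w \<le> degree w'" by blast
      then show False using w' w'0 q0 by (simp add: degree_mult_eq)
    qed
    have *: "q ^ m dvd b" if "q ^ m dvd a * b" "\<not> q dvd a" for a b
      using prime_power_dvd_multD[OF q(2) that(1) m that(2)] .
    have "q ^ m dvd h * w ^ m" using q(1) by (simp add: dvd_power_same dvd_mult)
    then have qR: "q ^ m dvd R"
      using *[of "u ^ m" R] qu prime_elem_dvd_power[OF q(2)] main by auto
    have "q dvd R" using qR m by (meson dvd_power dvd_trans)
    from prime_elem_dvd_prod[OF I q(2) this[unfolded R_def]]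
    obtain k where k: "k \<in> I" "q dvd p k ^ c k" by blast
    then have qpk: "q dvd p k" using prime_elem_dvd_power[OF q(2)] by blast
    then obtain v where v: "p k = q * v" by (rule dvdE)
    have "is_unit v"
      using irreducibleD[OF irred[OF k(1)] v] prime_elem_not_unit[OF q(2)] by blast
    then have pq: "p k dvd q" unfolding v by (simp add: mult_unit_dvd_iff)
    have "\<not> q dvd (\<Prod>j\<in>I - {k}. p j ^ c j)"
    proof
      assume "q dvd (\<Prod>j\<in>I - {k}. p j ^ c j)"
      from prime_elem_dvd_prod[OF finite_Diff[OF I] q(2) this]
      obtain j where j: "j \<in> I - {k}" "q dvd p j ^ c j" by blast
      then have "q dvd p j" using prime_elem_dvd_power[OF q(2)] by blast
      then show False using ndvd[of k j] j k(1) pq by (auto dest: dvd_trans)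
    qed
    moreover have "R = (\<Prod>j\<in>I - {k}. p j ^ c j) * p k ^ c k"
      unfolding R_def using prod.remove[OF I k(1), of "\<lambda>j. p j ^ c j"] by (simp add: mult.commute)
    ultimately have "q ^ m dvd p k ^ c k" using * qR by (simp only:)
    then have "q ^ m dvd q ^ c k" using pq by (meson dvd_power_same dvd_trans)
    then have "m * degree q \<le> c k * degree q"
      using dvd_imp_degree_le[of "q ^ m" "q ^ c k"] q0 by (simp add: degree_power_eq)
    then show False using c[OF k(1)] q0 by simp
  qed
  then obtain e where e: "w = [:e:]" by (rule degree_eq_zeroE)
  then have "e \<noteq> 0" using w by auto
  then have "b = to_fract (smult (inverse e) u)"
    using u e by (simp add: to_fract_def eq_fract)
  then show ?thesis by blast
qed

definition factored :: "'k::field \<Rightarrow> 'i set \<Rightarrow> ('i \<Rightarrow> 'k poly) \<Rightarrow> ('i \<Rightarrow> int) \<Rightarrow> 'k poly fract" where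
  "factored \<alpha> I p lam = to_fract [:\<alpha>:] * (\<Prod>k\<in>I. to_fract (p k) powi lam k)"

lemma to_fract_prod: "to_fract (prod g I) = (\<Prod>i\<in>I. to_fract (g i))"
  by (induction I rule: infinite_finite_induct) auto

text \<open>Each exponent \<open>int i * lam k\<close> is split into a multiple of m and a remainder
  \<open>c i k\<close>. The multiples form the m-th power of \<open>g i\<close>, absorbed into a;
  for the rest, \<open>polynomial_if_power_polynomial\<close> makes the new base a polynomial b, and
  the degree is m deg b plus that of \<open>R i\<close>.\<close>

lemma (in kummer) pole_orders_factored:
  assumes I: "finite I" and irred: "\<And>k. k \<in> I \<Longrightarrow> irreducible (p k)"
    and ndvd: "\<And>k j. k \<in> I \<Longrightarrow> j \<in> I \<Longrightarrow> k \<noteq> j \<Longrightarrow> \<not> p k dvd p j"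
    and \<alpha>: "\<alpha> \<noteq> 0" and f0_eq: "f0 = factored \<alpha> I p lam"
  shows "pole_orders = {m * e + (\<Sum>k\<in>I. degree (p k) * nat ((int i * lam k) mod int m)) | e i. i < m}"
proof -
  have p0: "p k \<noteq> 0" if "k \<in> I" for k using irred[OF that] by (auto simp: irreducible_def)
  define c where "c i k = nat ((int i * lam k) mod int m)" for i k
  define g where "g i = (\<Prod>k\<in>I. to_fract (p k) powi ((int i * lam k) div int m))" for i
  define R where "R i = smult (\<alpha> ^ i) (\<Prod>k\<in>I. p k ^ c i k)" for i
  have g0: "g i \<noteq> 0" for i using p0 I by (simp add: g_def)
  have c_less: "c i k < m" for i k using m by (simp add: c_def nat_less_iff)
  have R0: "R i \<noteq> 0" for i using \<alpha> p0 I by (simp add: R_def)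
  have f0_power: "f0 ^ i = to_fract (R i) * g i ^ m" for i
  proof -
    have "f0 ^ i = to_fract [:\<alpha>:] ^ i * (\<Prod>k\<in>I. to_fract (p k) powi (int i * lam k))"
      unfolding f0_eq factored_def power_mult_distrib
      by (simp add: prod_power_distrib[symmetric] power_int_mult mult.commute[of "int i"])
    also have "(\<Prod>k\<in>I. to_fract (p k) powi (int i * lam k)) =
        (\<Prod>k\<in>I. to_fract (p k) ^ c i k * (to_fract (p k) powi ((int i * lam k) div int m)) ^ m)"
    proof (intro prod.cong refl)
      fix k assume k: "k \<in> I"
      have e: "int i * lam k = int (c i k) + (int i * lam k) div int m * int m"
        using m by (simp add: c_def)
      have "to_fract (p k) powi (int i * lam k) =
          to_fract (p k) powi (int (c i k) + (int i * lam k) div int m * int m)"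
        using e by simp
      also have "\<dots> = to_fract (p k) ^ c i k * (to_fract (p k) powi ((int i * lam k) div int m)) ^ m"
        using p0[OF k] by (simp add: power_int_add power_int_mult)
      finally show "to_fract (p k) powi (int i * lam k) =
          to_fract (p k) ^ c i k * (to_fract (p k) powi ((int i * lam k) div int m)) ^ m" .
    qed
    also have "\<dots> = to_fract (\<Prod>k\<in>I. p k ^ c i k) * g i ^ m"
      by (simp add: prod.distrib to_fract_prod to_fract_power g_def prod_power_distrib)
    also have "to_fract [:\<alpha>:] ^ i * (to_fract (\<Prod>k\<in>I. p k ^ c i k) * g i ^ m) = to_fract (R i) * g i ^ m"
    proof -
      have "R i = [:\<alpha>:] ^ i * (\<Prod>k\<in>I. p k ^ c i k)"
        by (simp add: R_def poly_const_pow)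
      then show ?thesis by (simp only: to_fract_mult to_fract_power mult.assoc)
    qed
    finally show ?thesis .
  qed
  have deg_R: "degree (R i) = (\<Sum>k\<in>I. degree (p k) * c i k)" for i
    using \<alpha> p0 by (simp add: R_def degree_prod_eq_sum_degree degree_power_eq mult.commute)
  show ?thesis
  proof (intro equalityI subsetI)
    fix n assume "n \<in> pole_orders"
    then obtain h a i where h: "n = degree h" "a \<noteq> 0" "i < m" "a ^ m * f0 ^ i = to_fract h"
      by (auto simp: pole_orders_def)
    have eq: "(a * g i) ^ m * to_fract (R i) = to_fract h"
      using h(4) by (simp add: f0_power power_mult_distrib mult_ac)
    have R_split: "R i = [:\<alpha> ^ i:] * (\<Prod>k\<in>I. p k ^ c i k)" by (simp add: R_def)
    have "(a * g i) ^ m * to_fract (\<Prod>k\<in>I. p k ^ c i k) = to_fract (smult (inverse (\<alpha> ^ i)) h)"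
    proof -
      have "(\<Prod>k\<in>I. p k ^ c i k) = [:inverse (\<alpha> ^ i):] * R i" using \<alpha> by (simp add: R_def)
      then have "(a * g i) ^ m * to_fract (\<Prod>k\<in>I. p k ^ c i k) =
          to_fract [:inverse (\<alpha> ^ i):] * ((a * g i) ^ m * to_fract (R i))"
        by (simp only: to_fract_mult mult_ac)
      also have "\<dots> = to_fract ([:inverse (\<alpha> ^ i):] * h)" by (simp only: eq to_fract_mult)
      finally show ?thesis by simp
    qed
    from polynomial_if_power_polynomial[OF I irred ndvd c_less m this]
    obtain b where b: "a * g i = to_fract b" by blast
    then have b0: "b \<noteq> 0" using h(2) g0[of i] by auto
    have "to_fract (b ^ m * R i) = to_fract h" using eq by (simp add: b to_fract_power)
    then have "h = b ^ m * R i" by (simp only: to_fract_eq_iff)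
    then have "n = m * degree b + degree (R i)"
      using h(1) b0 R0 by (simp add: degree_mult_eq degree_power_eq)
    then show "n \<in> {m * e + (\<Sum>k\<in>I. degree (p k) * nat ((int i * lam k) mod int m)) | e i. i < m}"
      using h(3) unfolding deg_R c_def by blast
  next
    fix n assume "n \<in> {m * e + (\<Sum>k\<in>I. degree (p k) * nat ((int i * lam k) mod int m)) | e i. i < m}"
    then obtain e i where n: "n = m * e + degree (R i)" "i < m" unfolding deg_R c_def by blast
    \<comment> \<open>A monomial realises each degree e; dividing it by \<open>g i\<close> undoes
      the absorption.\<close>
    define b where "b = (monom 1 e :: 'k poly)"
    have b0: "b \<noteq> 0" "degree b = e" by (simp_all add: b_def degree_monom_eq monom_eq_0_iff)
    have "(to_fract b / g i) ^ m * f0 ^ i = to_fract (b ^ m * R i)"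
      using g0[of i] by (simp add: f0_power power_divide to_fract_power)
    moreover have "to_fract b / g i \<noteq> 0" using b0 g0 by simp
    moreover have "degree (b ^ m * R i) = n"
      using n b0 R0 by (simp add: degree_mult_eq degree_power_eq)
    ultimately show "n \<in> pole_orders" using n(2) unfolding pole_orders_def by blast
  qed
qed

section \<open>The arithmetic of the gap set\<close>

lemma ceiling_div: "\<lceil>real_of_int a / real m\<rceil> = - ((- a) div int m)"
  using ceiling_divide_eq_div[of a "int m"] by simp

lemma ceiling_div_le_iff:
  assumes "m > 0"
  shows "\<lceil>real_of_int a / real m\<rceil> \<le> j \<longleftrightarrow> a \<le> int m * j"
proof -
  have "\<lceil>real_of_int a / real m\<rceil> \<le> j \<longleftrightarrow> real_of_int a \<le> real_of_int (int m * j)"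
    using assms by (simp add: ceiling_le_iff divide_le_eq mult.commute)
  then show ?thesis by (simp only: of_int_le_iff)
qed

text \<open>The gap set for a semigroup that contains, in the residue class of \<open>- i \<lambda>\<^sub>s\<close> modulo \<open>m\<close>,
  exactly the numbers from \<open>\<Sum>k\<noteq>s. d\<^sub>k ((i \<lambda>\<^sub>k) mod m)\<close> on.\<close>

lemma gap_set_eq:
  fixes lam :: "nat \<Rightarrow> int" and d :: "nat \<Rightarrow> nat" and m r s :: nat and mu :: int
  assumes m: "m \<ge> 2" and s: "s \<le> r" "d s = 1" and cop: "coprime (int m) (lam s)" "coprime (int m) mu"
    and sum0: "(\<Sum>k=0..r. lam k * int (d k)) = 0"
    and S: "S = {m * e + (\<Sum>k\<in>{0..r} - {s}. d k * nat ((int i * lam k) mod int m)) | e i. i < m}"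
  shows "int ` (UNIV - S) = {int m * j + i * mu * lam s | i j.
             1 \<le> i \<and> i \<le> int m - 1 \<and>
             \<lceil>real_of_int (- (i * mu * lam s)) / real m\<rceil> \<le> j \<and>
             j \<le> (\<Sum>k=0..r. \<lceil>real_of_int (i * mu * lam k) / real m\<rceil> * int (d k))
                    - \<lceil>real_of_int (i * mu * lam s) / real m\<rceil> - 1}"
    (is "_ = ?G")
proof -
  \<comment> \<open>\<open>T i\<close> is the least element of S in the class of -i lam_s; i may be
    any integer, since only its class modulo m matters.\<close>
  define T where "T i = (\<Sum>k\<in>{0..r} - {s}. int (d k) * ((i * lam k) mod int m))" for i :: int
  have m0: "int m > 0" using m by simp
  have sum_s: "(\<Sum>k\<in>{0..r} - {s}. lam k * int (d k)) = - lam s"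
    using sum0 s by (simp add: sum.remove[of "{0..r}" s])
  have T_nat: "int (\<Sum>k\<in>{0..r} - {s}. d k * nat ((int i * lam k) mod int m)) = T (int i)" for i
    using m0 by (simp add: T_def)
  have T_cong: "T i = T i'" if "[i = i'] (mod int m)" for i i'
    unfolding T_def using that by (intro sum.cong refl arg_cong2[of _ _ _ _ "(*)"])
      (auto simp: cong_def intro: mod_mult_cong)
  \<comment> \<open>The lam_k d_k sum to 0, so leaving out the index s gives -lam_s.\<close>
  have T_mod: "[T i = - (i * lam s)] (mod int m)" for i
  proof -
    have "[T i = (\<Sum>k\<in>{0..r} - {s}. int (d k) * (i * lam k))] (mod int m)"
      unfolding T_def by (intro cong_sum cong_mult cong_refl) (simp add: cong_def)
    also have "(\<Sum>k\<in>{0..r} - {s}. int (d k) * (i * lam k)) =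
        i * (\<Sum>k\<in>{0..r} - {s}. lam k * int (d k))"
      by (simp add: sum_distrib_left mult_ac)
    also have "\<dots> = - (i * lam s)" by (simp add: sum_s)
    finally show ?thesis .
  qed
  \<comment> \<open>The bound i < m is dropped so that \<open>- i * mu\<close> can be inserted for
    i.\<close>
  have S_iff: "n \<in> S \<longleftrightarrow> (\<exists>i. T i \<le> int n \<and> [int n = - (i * lam s)] (mod int m))" for n
  proof
    assume "n \<in> S"
    then obtain e i where n: "n = m * e + (\<Sum>k\<in>{0..r} - {s}. d k * nat ((int i * lam k) mod int m))"
      by (auto simp: S)
    have "int n = int m * int e + T (int i)" unfolding n T_nat[symmetric] by simp
    moreover have "[int m * int e + T (int i) = - (int i * lam s)] (mod int m)"
      using T_mod[of "int i"] by (simp add: cong_def)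
    ultimately show "\<exists>i. T i \<le> int n \<and> [int n = - (i * lam s)] (mod int m)"
      by (intro exI[of _ "int i"]) auto
  next
    assume "\<exists>i. T i \<le> int n \<and> [int n = - (i * lam s)] (mod int m)"
    then obtain i where i: "T i \<le> int n" "[int n = - (i * lam s)] (mod int m)" by blast
    define i' where "i' = nat (i mod int m)"
    have i': "int i' = i mod int m" "i' < m" using m0 by (auto simp: i'_def nat_less_iff)
    have T_i': "T (int i') = T i" by (rule T_cong) (simp add: i' cong_def)
    have "[int n = T i] (mod int m)" using i(2) T_mod[of i] by (metis cong_sym cong_trans)
    then obtain e where e: "int n = T i + int m * e" by (metis cong_iff_lin cong_sym mult.commute)
    have "e \<ge> 0" using e i(1) m0 by (simp add: zero_le_mult_iff)
    then have "int n = int (m * nat e + (\<Sum>k\<in>{0..r} - {s}. d k * nat ((int i' * lam k) mod int m)))"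
      unfolding of_nat_add T_nat T_i' using e by simp
    then have "n = m * nat e + (\<Sum>k\<in>{0..r} - {s}. d k * nat ((int i' * lam k) mod int m))"
      by (simp only: of_nat_eq_iff)
    then show "n \<in> S" using i'(2) unfolding S by blast
  qed
  define C where "C i k = \<lceil>real_of_int (i * mu * lam k) / real m\<rceil>" for i :: int and k
  \<comment> \<open>The identity m ceil(c/m) = c + (-c mod m); its minus sign is why
    \<open>T_C\<close> evaluates T at \<open>- i * mu\<close>.\<close>
  have C: "int m * C i k = i * mu * lam k + (- i * mu * lam k) mod int m" for i k
    unfolding C_def ceiling_div by (simp add: minus_mult_div_eq_mod[symmetric])
  have T_C: "T (- i * mu) = int m * ((\<Sum>k=0..r. C i k * int (d k)) - C i s) + i * mu * lam s" for i
  proof -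
    have "(\<Sum>k=0..r. C i k * int (d k)) - C i s = (\<Sum>k\<in>{0..r} - {s}. C i k * int (d k))"
      using s by (simp add: sum.remove[of "{0..r}" s])
    also have "int m * \<dots> = (\<Sum>k\<in>{0..r} - {s}. int (d k) * (int m * C i k))"
      by (simp add: sum_distrib_left mult_ac)
    also have "\<dots> = i * mu * (\<Sum>k\<in>{0..r} - {s}. lam k * int (d k)) + T (- i * mu)"
      unfolding C T_def by (simp add: algebra_simps sum.distrib sum_distrib_left)
    finally show ?thesis by (simp add: sum_s)
  qed
  have cop': "coprime (mu * lam s) (int m)" using cop by (simp add: coprime_commute)
  show ?thesis
  proof (intro equalityI subsetI)
    fix N assume "N \<in> int ` (UNIV - S)"
    then obtain n where n: "N = int n" "n \<notin> S" by blast
    obtain i0 where "[(mu * lam s) * i0 = int n] (mod int m)"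
      using cong_solve_coprime_int[OF cop'] by (metis cong_scalar_right mult.assoc mult_1)
    then have "[(mu * lam s) * (i0 mod int m) = int n] (mod int m)"
      by (simp add: cong_def mod_mult_right_eq)
    then obtain i where i: "0 \<le> i" "i < int m" "[i * mu * lam s = int n] (mod int m)"
      using m0 by (metis mult.assoc mult.commute pos_mod_bound pos_mod_sign)
    then have "[int n = - ((- i * mu) * lam s)] (mod int m)" by (simp add: cong_sym)
    then have less: "int n < T (- i * mu)" using n(2) S_iff[of n] by (metis not_le)
    \<comment> \<open>T 0 = 0, so no multiple of m is a gap, and the index i starts at 1.\<close>
    have "i \<noteq> 0"
    proof
      assume "i = 0"
      then show False using less by (simp add: T_def)
    qed
    from i(3) obtain j where "int n = i * mu * lam s + int m * j"
      by (metis cong_iff_lin mult.commute)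
    then have j: "N = int m * j + i * mu * lam s" by (simp add: n)
    \<comment> \<open>The lower bound on j expresses N \<ge> 0, the upper one N < T(-i mu).\<close>
    have "\<lceil>real_of_int (- (i * mu * lam s)) / real m\<rceil> \<le> j"
      using ceiling_div_le_iff[of m "- (i * mu * lam s)" j] m j n(1) by linarith
    moreover have "j \<le> (\<Sum>k=0..r. C i k * int (d k)) - C i s - 1"
    proof -
      have "int m * j < int m * ((\<Sum>k=0..r. C i k * int (d k)) - C i s)"
        using less j n(1) unfolding T_C by simp
      then show ?thesis using m0 by simp
    qed
    moreover have "1 \<le> i" "i \<le> int m - 1" using i \<open>i \<noteq> 0\<close> by auto
    ultimately show "N \<in> ?G" using j unfolding C_def by blast
  next
    fix N assume "N \<in> ?G"
    then obtain i j where N: "N = int m * j + i * mu * lam s" "1 \<le> i" "i \<le> int m - 1"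
      and lower: "\<lceil>real_of_int (- (i * mu * lam s)) / real m\<rceil> \<le> j"
      and upper: "j \<le> (\<Sum>k=0..r. C i k * int (d k)) - C i s - 1"
      unfolding C_def by blast
    have "N \<ge> 0"
      using ceiling_div_le_iff[of m "- (i * mu * lam s)" j] m lower N(1) by linarith
    then obtain n where n: "N = int n" by (metis nonneg_int_cases)
    have less: "int n < T (- i * mu)"
    proof -
      have "int m * j < int m * ((\<Sum>k=0..r. C i k * int (d k)) - C i s)"
        using upper m0 by (intro mult_strict_left_mono) auto
      then show ?thesis unfolding T_C n[symmetric] N(1) by simp
    qed
    \<comment> \<open>Since lam_s cancels modulo m, membership could only come from an index
      congruent to -i mu, where T has the same value.\<close>
    have "n \<notin> S"
    proof
      assume "n \<in> S"
      then obtain i' where i': "T i' \<le> int n" "[int n = - (i' * lam s)] (mod int m)"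
        using S_iff by blast
      have "[int n = i * mu * lam s] (mod int m)"
        unfolding n[symmetric] N(1) by (simp add: cong_def)
      then have "[- (i' * lam s) = i * mu * lam s] (mod int m)"
        using i'(2) by (metis cong_sym cong_trans)
      then have "[i' * lam s = (- i * mu) * lam s] (mod int m)"
        using cong_minus_minus_iff[of "- (i' * lam s)"] by simp
      then have "[i' = - i * mu] (mod int m)"
        using cop(1) cong_mult_rcancel by (metis coprime_commute)
      then have "T i' = T (- i * mu)" by (rule T_cong)
      then show False using i'(1) less by simp
    qed
    then show "N \<in> int ` (UNIV - S)" using n by blast
  qed
qed

text \<open>With w = 1 + m c, replacing j by j + i c turns i w into i. The two ceilings are -i c and
  i c + 1; this last 1 and the -1 of the general formula make up the -2.\<close>

lemma gap_set_inverse: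
  fixes m :: nat and B :: "int \<Rightarrow> int" and w :: int
  assumes m: "m \<ge> 2" and w: "[w = 1] (mod int m)"
  shows "{int m * j + i * w | i j. 1 \<le> i \<and> i \<le> int m - 1 \<and>
             \<lceil>real_of_int (- (i * w)) / real m\<rceil> \<le> j \<and> j \<le> B i - \<lceil>real_of_int (i * w) / real m\<rceil> - 1} =
         {int m * j + i | i j. 1 \<le> i \<and> i \<le> int m - 1 \<and> 0 \<le> j \<and> j \<le> B i - 2}" (is "?L = ?R")
proof -
  from w obtain c where c: "w = 1 + int m * c" by (metis cong_iff_lin cong_sym mult.commute)
  have ceil: "\<lceil>real_of_int (- (i * w)) / real m\<rceil> = - (i * c)"
    "\<lceil>real_of_int (i * w) / real m\<rceil> = i * c + 1" if i: "1 \<le> i" "i \<le> int m - 1" for i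
  proof -
    have "(i * w) div int m = i * c"
    proof -
      have "i * w = i + int m * (i * c)" by (simp add: c algebra_simps)
      then show ?thesis using i m by simp
    qed
    moreover have "(- (i * w)) div int m = - (i * c) - 1"
    proof -
      have "- (i * w) = (int m - i) + int m * (- (i * c) - 1)" by (simp add: c algebra_simps)
      moreover have "((int m - i) + int m * (- (i * c) - 1)) div int m = - (i * c) - 1"
        using i by (subst div_mult_self2) auto
      ultimately show ?thesis by simp
    qed
    ultimately show "\<lceil>real_of_int (- (i * w)) / real m\<rceil> = - (i * c)"
      "\<lceil>real_of_int (i * w) / real m\<rceil> = i * c + 1"
      unfolding ceiling_div by simp_all
  qed
  show ?thesis
  proof (intro equalityI subsetI)
    fix N assume "N \<in> ?L"
    then obtain i j where *: "N = int m * j + i * w" "1 \<le> i" "i \<le> int m - 1"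
      "\<lceil>real_of_int (- (i * w)) / real m\<rceil> \<le> j" "j \<le> B i - \<lceil>real_of_int (i * w) / real m\<rceil> - 1"
      by blast
    have "N = int m * (j + i * c) + i" using *(1) by (simp add: c algebra_simps)
    then have "N = int m * (j + i * c) + i \<and> 1 \<le> i \<and> i \<le> int m - 1 \<and> 0 \<le> j + i * c \<and> j + i * c \<le> B i - 2"
      using *(2-5) unfolding ceil[OF *(2,3)] by simp
    then show "N \<in> ?R" by blast
  next
    fix N assume "N \<in> ?R"
    then obtain i j where *: "N = int m * j + i" "1 \<le> i" "i \<le> int m - 1" "0 \<le> j" "j \<le> B i - 2" by blast
    have "N = int m * (j - i * c) + i * w" using *(1) by (simp add: c algebra_simps)
    then have "N = int m * (j - i * c) + i * w \<and> 1 \<le> i \<and> i \<le> int m - 1 \<and>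
        \<lceil>real_of_int (- (i * w)) / real m\<rceil> \<le> j - i * c \<and> j - i * c \<le> B i - \<lceil>real_of_int (i * w) / real m\<rceil> - 1"
      using *(2-5) unfolding ceil[OF *(2,3)] by simp
    then show "N \<in> ?L" by blast
  qed
qed

section \<open>Places of the rational function field\<close>

context ratfun
begin

lemma phi_powi: "phi (a powi n) = phi a powi n"
  by (simp add: power_int_def phi.hom_power phi.hom_inverse)

text \<open>Places of K(t) enter through \<open>the_pole\<close> and \<open>the_zero\<close>, whose
  \<open>place_val\<close> is meaningful only at discrete places.\<close>

lemma rational_place_uniformizer:
  assumes B: "valuation_ring (range \<iota>) (range phi) B"
  shows "\<exists>p. vring.uniformizer (range phi) B p"
proof -
  interpret vring "range phi" B by (rule valuation_ring_vring[OF is_subfield_phi B])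
  have KB: "range \<iota> \<subseteq> B" using B by (auto simp: valuation_ring_def)
  show ?thesis
  proof (cases "t \<in> B")
    case True
    have "\<not> range phi \<subseteq> B" using B by (auto simp: valuation_ring_def)
    from ex_polynomial_in_max_ideal[OF vring_axioms KB True this]
    obtain p where p: "p \<noteq> 0" "ev p \<in> max_ideal" "\<And>h. ev h \<in> max_ideal \<Longrightarrow> p dvd h"
      using finite_place_dvd[OF vring_axioms KB True] by metis
    have "uniformizer (ev p)"
      unfolding uniformizer_def using p finite_place_val[OF vring_axioms KB True p] by auto
    then show ?thesis by blast
  next
    case False
    have "inverse t \<in> max_ideal" using not_in_iff[OF t_in_phi] False by auto
    moreover have "\<exists>n. \<exists>u\<in>units. z = inverse t powi n * u" if z: "z \<in> range phi" "z \<noteq> 0" for z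
    proof -
      obtain a where a: "z = phi a" using z by auto
      then have "a \<noteq> 0" using z(2) by auto
      from infinite_place_val[OF this] obtain n where "phi a / inverse t powi n \<in> units"
        using vring_axioms KB t_in_phi False by blast
      then show ?thesis
        using a t_nonzero by (intro exI[of _ n] bexI[of _ "phi a / inverse t powi n"]) auto
    qed
    ultimately have "uniformizer (inverse t)" using t_nonzero by (simp add: uniformizer_def)
    then show ?thesis by blast
  qed
qed

lemma vring_restrict:
  assumes "vring UNIV A"
  shows "vring (range phi) (A \<inter> range phi)"
proof -
  interpret vring UNIV A by (rule assms)
  show ?thesis
    using is_subfieldD[OF is_subfield_phi] diff mult total by unfold_locales (auto simp: is_subfield_phi)
qed

text \<open>A valuation ring of K(t) without t is determined by the exponents of
  \<open>infinite_place_val\<close>. Two descriptions are recorded: P_0 is given as the pole of x,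
  and P_s for s > 0 as the zero of p_s(x), which will be 1/t.\<close>

lemma rational_infinite_place:
  assumes A: "vring UNIV A" "range \<iota> \<subseteq> A" "t \<notin> A"
  shows "is_place (range \<iota>) (range phi) P \<and> place_val (range phi) P t < 0 \<longleftrightarrow>
           P = vring.max_ideal (A \<inter> range phi)" (is ?th1)
    and "is_place (range \<iota>) (range phi) P \<and> place_val (range phi) P (inverse t) > 0 \<longleftrightarrow>
           P = vring.max_ideal (A \<inter> range phi)" (is ?th2)
proof -
  let ?A = "A \<inter> range phi"
  interpret A: vring "range phi" ?A by (rule vring_restrict[OF A(1)])
  have KA: "range \<iota> \<subseteq> ?A" using A(2) range_iota_sub_phi by auto
  have tA: "t \<notin> ?A" using A(3) by auto
  have valA: "valuation_ring (range \<iota>) (range phi) ?A"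
  proof -
    have "inverse t \<in> ?A" using A.total[OF t_in_phi] tA by blast
    moreover have "inverse t \<notin> range \<iota>" by (rule inverse_t_not_constant[OF A(2,3)])
    ultimately have "range \<iota> \<subset> ?A" "?A \<subset> range phi" using KA t_in_phi tA by blast+
    then show ?thesis unfolding valuation_ring_def
      by (intro conjI ballI) (assumption | rule A.diff A.mult A.total)+
  qed
  have sign: "(place_val (range phi) P t < 0 \<longleftrightarrow> t \<notin> B) \<and> (place_val (range phi) P (inverse t) > 0 \<longleftrightarrow> t \<notin> B)"
    if B: "valuation_ring (range \<iota>) (range phi) B" "P = vring.max_ideal B" for B
  proof -
    interpret vring "range phi" B by (rule valuation_ring_vring[OF is_subfield_phi B(1)])
    obtain p where p: "uniformizer p" using rational_place_uniformizer[OF B(1)] by blast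
    have it: "inverse t \<in> range phi" "inverse t \<noteq> 0" using t_in_phi L_rules(7) t_nonzero by auto
    show ?thesis
      using place_val_sign(1)[OF p t_in_phi t_nonzero] place_val_sign(2)[OF p it]
        not_in_iff[OF t_in_phi] t_nonzero B(2) by auto
  qed
  have unique: "B = ?A" if B: "valuation_ring (range \<iota>) (range phi) B" "t \<notin> B" for B
  proof -
    interpret vring "range phi" B by (rule valuation_ring_vring[OF is_subfield_phi B(1)])
    have KB: "range \<iota> \<subseteq> B" using B by (auto simp: valuation_ring_def)
    have "z \<in> B \<longleftrightarrow> z \<in> ?A" if z: "z \<in> range phi" for z
    proof (cases "z = 0")
      case True
      then show ?thesis using zero A.zero by simp
    next
      case False
      obtain a where a: "z = phi a" using z by auto
      then have "a \<noteq> 0" using False by auto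
      from infinite_place_val[OF this] obtain n where
        n: "\<And>L A. vring L A \<Longrightarrow> range \<iota> \<subseteq> A \<Longrightarrow> t \<in> L \<Longrightarrow> t \<notin> A \<Longrightarrow>
          phi a / inverse t powi n \<in> vring.units A" by blast
      have *: "z \<in> C \<longleftrightarrow> n \<ge> 0" if C: "vring (range phi) C" "range \<iota> \<subseteq> C" "t \<notin> C" for C
      proof -
        interpret C: vring "range phi" C by (rule C(1))
        have u: "z / inverse t powi n \<in> C.units" using n[OF C(1,2) t_in_phi C(3)] a by simp
        have it: "inverse t \<in> C.max_ideal" "inverse t \<noteq> 0"
          using C.not_in_iff[OF t_in_phi] C(3) t_nonzero by auto
        show ?thesis
          using C.mult_unit_in_A_iff(1)[OF u, of "inverse t powi n"] C.powi_in_A_iff(1)[OF it] it(2)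
          by simp
      qed
      show ?thesis using *[OF vring_axioms KB B(2)] *[OF A.vring_axioms KA tA] by simp
    qed
    then show ?thesis using sub by blast
  qed
  have places: "is_place (range \<iota>) (range phi) P \<longleftrightarrow>
      (\<exists>B. valuation_ring (range \<iota>) (range phi) B \<and> P = vring.max_ideal B)"
    by (rule is_place_iff[OF is_subfield_phi])
  show ?th1 ?th2
    unfolding places using sign unique valA tA by blast+
qed

lemma the_infinite_place:
  assumes A: "vring UNIV A" "range \<iota> \<subseteq> A" "t \<notin> A"
  shows "the_pole (range \<iota>) (range phi) t = vring.max_ideal (A \<inter> range phi)"
    and "the_zero (range \<iota>) (range phi) (inverse t) = vring.max_ideal (A \<inter> range phi)"
  unfolding the_pole_def the_zero_def rational_infinite_place[OF A] by simp_all

lemma adjoin_eq: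
  assumes "x \<in> range phi" "\<And>L. is_subfield L \<Longrightarrow> range \<iota> \<subseteq> L \<Longrightarrow> x \<in> L \<Longrightarrow> t \<in> L"
  shows "adjoin (range \<iota>) {x} = range phi"
  unfolding adjoin_def
proof (rule hull_unique)
  show "range \<iota> \<union> {x} \<subseteq> range phi" using assms(1) range_iota_sub_phi by auto
  show "is_subfield (range phi)" by (rule is_subfield_phi)
  fix L assume "range \<iota> \<union> {x} \<subseteq> L" "is_subfield L"
  then show "range phi \<subseteq> L" using phi_in_subfield[of L] assms(2)[of L] by auto
qed

text \<open>The place in question is the pole of \<open>t\<close>. The sum of \<open>lam k\<close>
  times the degrees is minus the order of f there, so its coprimality to m is the condition for
  total ramification.\<close>

theorem totally_ramified_semigroup:
  fixes p :: "'i \<Rightarrow> 'k poly"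
  assumes m: "m \<ge> 2" "(of_nat m :: 'k) \<noteq> 0"
    and I: "finite I" and irred: "\<And>k. k \<in> I \<Longrightarrow> irreducible (p k)"
    and ndvd: "\<And>k j. k \<in> I \<Longrightarrow> j \<in> I \<Longrightarrow> k \<noteq> j \<Longrightarrow> \<not> p k dvd p j"
    and \<alpha>: "\<alpha> \<noteq> 0" and coprime: "coprime (\<Sum>k\<in>I. lam k * int (degree (p k))) (int m)"
    and y: "y ^ m = phi (factored \<alpha> I p lam)"
    and gen: "\<And>L. is_subfield L \<Longrightarrow> range phi \<subseteq> L \<Longrightarrow> y \<in> L \<Longrightarrow> L = UNIV"
  shows "\<exists>A. vring UNIV A \<and> range \<iota> \<subseteq> A \<and> t \<notin> A \<and>
    weierstrass_semigroup (range \<iota>) UNIV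
      (the_place_above (range \<iota>) UNIV (vring.max_ideal (A \<inter> range phi))) =
    {m * e + (\<Sum>k\<in>I. degree (p k) * nat ((int i * lam k) mod int m)) | e i. i < m}"
proof -
  have p0: "p k \<noteq> 0" if "k \<in> I" for k using irred[OF that] by (auto simp: irreducible_def)
  define fn where "fn = smult \<alpha> (\<Prod>k\<in>I. p k ^ nat (lam k))"
  define fd where "fd = (\<Prod>k\<in>I. p k ^ nat (- lam k))"
  have nz: "fn \<noteq> 0" "fd \<noteq> 0" using \<alpha> p0 I by (auto simp: fn_def fd_def)
  have Fract: "factored \<alpha> I p lam = Fract fn fd"
  proof -
    have "to_fract (p k) powi lam k = to_fract (p k ^ nat (lam k)) / to_fract (p k ^ nat (- lam k))" for k
      by (auto simp: power_int_def to_fract_power power_inverse divide_inverse)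
    then have "factored \<alpha> I p lam = to_fract [:\<alpha>:] * (to_fract (\<Prod>k\<in>I. p k ^ nat (lam k)) / to_fract fd)"
      by (simp add: factored_def fd_def to_fract_prod prod_dividef)
    also have "\<dots> = to_fract fn / to_fract fd" by (simp add: fn_def flip: to_fract_mult)
    finally show ?thesis by (simp add: Fract_conv_to_fract)
  qed
  have l: "- (\<Sum>k\<in>I. lam k * int (degree (p k))) = int (degree fd) - int (degree fn)"
  proof -
    have "int (degree fd) = (\<Sum>k\<in>I. int (nat (- lam k)) * int (degree (p k)))"
      "int (degree fn) = (\<Sum>k\<in>I. int (nat (lam k)) * int (degree (p k)))"
      using \<alpha> p0
      by (simp_all add: fd_def fn_def degree_prod_eq_sum_degree degree_power_eq mult.commute)
    then have "int (degree fd) - int (degree fn) =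
        (\<Sum>k\<in>I. (int (nat (- lam k)) - int (nat (lam k))) * int (degree (p k)))"
      by (simp add: sum_subtractf left_diff_distrib)
    also have "\<dots> = (\<Sum>k\<in>I. - (lam k * int (degree (p k))))" by (intro sum.cong) auto
    finally show ?thesis by (simp add: sum_negf)
  qed
  interpret kummer \<iota> t y m fn fd "factored \<alpha> I p lam" "- (\<Sum>k\<in>I. lam k * int (degree (p k)))"
  proof
    show "coprime (- (\<Sum>k\<in>I. lam k * int (degree (p k)))) (int m)" using coprime by simp
    show "m > 0" "(of_nat m :: 'k) \<noteq> 0" using m by auto
  qed (fact nz Fract l y gen)+
  obtain A where A: "vring UNIV A" "range \<iota> \<subseteq> A" "t \<notin> A" using ex_infinite_place by blast
  then have inf: "inf_ring A" by (simp add: inf_ring_def)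
  interpret A: vring UNIV A by (rule A(1))
  interpret A': vring "range phi" "A \<inter> range phi" by (rule vring_restrict[OF A(1)])
  have "the_place_above (range \<iota>) UNIV A'.max_ideal = A.max_ideal"
    unfolding the_place_above_def
  proof (rule the_equality)
    have "valuation_ring (range \<iota>) UNIV A" by (rule inf_ring_valuation_ring[OF inf])
    moreover have "A'.max_ideal \<subseteq> A.max_ideal"
      using is_subfieldD(7)[OF is_subfield_phi] by (auto simp: A'.max_ideal_iff A.max_ideal_iff)
    ultimately show "is_place (range \<iota>) UNIV A.max_ideal \<and> A'.max_ideal \<subseteq> A.max_ideal"
      using is_place_iff[OF is_subfield_UNIV] by blast
  next
    fix Q assume Q: "is_place (range \<iota>) UNIV Q \<and> A'.max_ideal \<subseteq> Q"
    then obtain B where B: "valuation_ring (range \<iota>) UNIV B" "Q = vring.max_ideal B"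
      using is_place_iff[OF is_subfield_UNIV] by metis
    interpret B: vring UNIV B by (rule valuation_ring_vring[OF is_subfield_UNIV B(1)])
    \<comment> \<open>A place above has 1/t in its maximal ideal, so t is missing from its ring, and
      only one ring has this property.\<close>
    have "inverse t \<in> A'.max_ideal" using A'.not_in_iff[OF t_in_phi] A(3) by auto
    then have "inverse t \<in> B.max_ideal" using Q B(2) by auto
    then have "t \<notin> B" using t_nonzero by (simp add: B.max_ideal_iff)
    then have "inf_ring B" using B by (auto simp: inf_ring_def B.vring_axioms valuation_ring_def)
    then show "Q = A.max_ideal" using B(2) inf_ring_unique[OF inf] by simp
  qed
  moreover have "pole_orders =
      {m * e + (\<Sum>k\<in>I. degree (p k) * nat ((int i * lam k) mod int m)) | e i. i < m}"
    by (rule pole_orders_factored[OF I irred ndvd \<alpha> refl])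
  ultimately show ?thesis
    using A infinite_place_semigroup[OF inf] by (intro exI[of _ A] conjI) (simp_all only: not_False_eq_True)
qed

end

section \<open>Changing the generator of K(x)\<close>

lemma ratfun_translate:
  assumes "ratfun \<iota> x"
  shows "ratfun \<iota> (x - \<iota> a)"
proof -
  interpret ratfun \<iota> x by (rule assms)
  show ?thesis
  proof
    fix h assume "poly (map_poly \<iota> h) (x - \<iota> a) = 0"
    then have "ev (pcompose h [:- a, 1:]) = 0"
      by (simp add: ev_def hom_distribs poly_pcompose)
    then have "pcompose h [:- a, 1:] = 0" by simp
    then show "h = 0" by (simp add: pcompose_eq_0_iff)
  qed
qed

section \<open>Transforming irreducible polynomials\<close>

lemma monic_irreducible_dvd_eq:
  fixes p q :: "'k::field poly"
  assumes "irreducible p" "irreducible q" "lead_coeff p = 1" "lead_coeff q = 1" "p dvd q"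
  shows "p = q"
proof -
  from assms(5) obtain c where c: "q = p * c" by (rule dvdE)
  have "\<not> is_unit p" using assms(1) by (rule irreducible_not_unit)
  then have "is_unit c" using irreducibleD[OF assms(2) c] by blast
  then obtain e where e: "c = [:e:]" by (metis is_unit_poly_iff)
  have "lead_coeff q = lead_coeff p * e" unfolding c lead_coeff_mult e by simp
  then have "e = 1" using assms(3,4) by simp
  then show ?thesis using c e by simp
qed

text \<open>The numerator of \<open>p (a + 1 / X)\<close>.\<close>

definition flip_poly :: "'k::field \<Rightarrow> 'k poly \<Rightarrow> 'k poly" where
  "flip_poly a p = reflect_poly (pcompose p [:a, 1:])"

text \<open>\<open>poly p a\<close> is the constant coefficient of p(X + a). As it is nonzero,
  reflection keeps the degree and can be undone.\<close>

lemma flip_poly_inverse: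
  assumes "poly p a \<noteq> 0"
  shows "pcompose (reflect_poly (flip_poly a p)) [:- a, 1:] = p"
proof -
  have "coeff (pcompose p [:a, 1:]) 0 \<noteq> 0" using assms by (simp add: poly_0_coeff_0[symmetric] poly_pcompose)
  then have "reflect_poly (flip_poly a p) = pcompose p [:a, 1:]" by (simp add: flip_poly_def)
  then show ?thesis by (simp add: pcompose_assoc[symmetric] pcompose_pCons)
qed

lemma degree_flip_poly:
  assumes "poly p a \<noteq> 0"
  shows "degree (flip_poly a p) = degree p"
proof -
  have "coeff (pcompose p [:a, 1:]) 0 \<noteq> 0" using assms by (simp add: poly_0_coeff_0[symmetric] poly_pcompose)
  then show ?thesis by (simp add: flip_poly_def degree_pcompose)
qed

lemma flip_poly_dvdD:
  assumes "poly p a \<noteq> 0" "poly q a \<noteq> 0" "flip_poly a p dvd flip_poly a q"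
  shows "p dvd q"
proof -
  from assms(3) obtain c where "flip_poly a q = flip_poly a p * c" by (rule dvdE)
  then have "q = p * pcompose (reflect_poly c) [:- a, 1:]"
    using flip_poly_inverse[OF assms(1)] flip_poly_inverse[OF assms(2)]
    by (metis reflect_poly_mult pcompose_mult)
  then show ?thesis by simp
qed

text \<open>X never divides a flipped polynomial; this distinguishes it from the polynomial X that
  belongs to P_0 in the new coordinate.\<close>

lemma coeff_0_flip_poly: "p \<noteq> 0 \<Longrightarrow> coeff (flip_poly a p) 0 \<noteq> 0"
  unfolding flip_poly_def coeff_0_reflect_poly leading_coeff_0_iff
  by (simp add: pcompose_eq_0_iff)

text \<open>A factorisation of the flipped polynomial flips back to one of p. Its factors have
  nonzero constant coefficients, as their product has, so degrees are kept in both
  directions.\<close>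

lemma irreducible_flip_poly:
  assumes "irreducible p" "poly p a \<noteq> 0"
  shows "irreducible (flip_poly a p)"
proof (rule irreducibleI)
  have p: "p \<noteq> 0" "degree p > 0" using assms(1) by (auto simp: irreducible_def is_unit_iff_degree)
  show nz: "flip_poly a p \<noteq> 0" using coeff_0_flip_poly[OF p(1), of a] by auto
  then show "\<not> is_unit (flip_poly a p)" using p degree_flip_poly[OF assms(2)] by (simp add: is_unit_iff_degree)
  have deg: "degree (pcompose (reflect_poly b) [:- a, 1:]) = degree b" if "coeff b 0 \<noteq> 0" for b :: "'a poly"
    using that by (simp add: degree_pcompose)
  fix b c assume bc: "flip_poly a p = b * c"
  have "coeff b 0 \<noteq> 0" "coeff c 0 \<noteq> 0"
    using coeff_0_flip_poly[OF p(1), of a] by (auto simp: bc coeff_mult_0)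
  moreover have "p = pcompose (reflect_poly b) [:- a, 1:] * pcompose (reflect_poly c) [:- a, 1:]"
    using flip_poly_inverse[OF assms(2)] by (metis bc reflect_poly_mult pcompose_mult)
  from irreducibleD[OF assms(1) this]
  have "degree (pcompose (reflect_poly b) [:- a, 1:]) = 0 \<or> degree (pcompose (reflect_poly c) [:- a, 1:]) = 0"
    by (auto simp: is_unit_iff_degree is_unit_poly_iff)
  ultimately have "degree b = 0 \<or> degree c = 0" using deg by metis
  moreover have "b \<noteq> 0" "c \<noteq> 0" using bc nz by auto
  ultimately show "is_unit b \<or> is_unit c" by (simp add: is_unit_iff_degree)
qed

text \<open>Translation by 1 permutes L, so the sum over L equals itself plus |L| times 1.\<close>

lemma of_nat_card_subfield:
  fixes L :: "'k::field set"
  assumes "is_subfield L" "finite L"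
  shows "(of_nat (card L) :: 'k) = 0"
proof -
  have "(\<Sum>a\<in>L. a) = (\<Sum>a\<in>L. a + 1)"
    by (rule sum.reindex_bij_witness[of _ "\<lambda>a. a + 1" "\<lambda>a. a - 1"])
      (use is_subfieldD[OF assms(1)] in auto)
  then show ?thesis by (simp add: sum.distrib)
qed

theorem proposition3p6:
  fixes q m r s :: nat
    and Fq :: "'k::field set"
    and \<iota> :: "'k \<Rightarrow> 'f::field"
    and K Kx :: "'f set"
    and x y f :: 'f
    and \<alpha> :: 'k
    and p :: "nat \<Rightarrow> 'k poly"
    and lam :: "nat \<Rightarrow> int"
    and d :: "nat \<Rightarrow> nat"
    and P :: "nat \<Rightarrow> 'f set"
    and Q :: "'f set"
  assumes "primepow q"
    and "is_subfield Fq" and "card Fq = q" and "\<forall>a. algebraic_over Fq a"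
    and "m \<ge> 2" and "coprime m q" and "r \<ge> 2"
    and "field_hom \<iota>" and "K = range \<iota>"
    and "\<not> algebraic_over K x"
    and "Kx = adjoin K {x}"
    and "adjoin K {x, y} = UNIV"
    and "\<forall>z. algebraic_over K z \<longrightarrow> z \<in> K"
    and "\<alpha> \<noteq> 0"
    and "\<forall>i\<in>{1..r}. lam i \<noteq> 0"
    and "\<forall>i\<in>{1..r}. lead_coeff (p i) = 1 \<and> irreducible (p i)"
    and "inj_on p {1..r}"
    and "f = \<iota> \<alpha> * (\<Prod>i=1..r. poly (map_poly \<iota> (p i)) x powi lam i)"
    and "y ^ m = f"
    and "\<forall>e. e dvd m \<longrightarrow> e \<ge> 2 \<longrightarrow> \<not> (\<exists>g\<in>Kx. f = g ^ e)"
    and "d 0 = 1" and "\<forall>i\<in>{1..r}. d i = degree (p i)"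
    and "lam 0 = - (\<Sum>i=1..r. lam i * int (d i))"
    and "P 0 = the_pole K Kx x"
    and "\<forall>i\<in>{1..r}. P i = the_zero K Kx (poly (map_poly \<iota> (p i)) x)"
    and "s \<le> r" and "d s = 1" and "gcd (int m) (lam s) = 1"
    and "Q = the_place_above K UNIV (P s)"
  shows
    "(\<forall>mu::int. gcd (int m) mu = 1 \<longrightarrow>
        int ` gaps K UNIV Q =
          {int m * j + i * mu * lam s | i j.
             1 \<le> i \<and> i \<le> int m - 1 \<and>
             \<lceil>real_of_int (- (i * mu * lam s)) / real m\<rceil> \<le> j \<and>
             j \<le> (\<Sum>k=0..r. \<lceil>real_of_int (i * mu * lam k) / real m\<rceil> * int (d k))
                    - \<lceil>real_of_int (i * mu * lam s) / real m\<rceil> - 1}) \<and>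
     (\<forall>mu::int. [mu * lam s = 1] (mod int m) \<longrightarrow>
        int ` gaps K UNIV Q =
          {int m * j + i | i j.
             1 \<le> i \<and> i \<le> int m - 1 \<and> 0 \<le> j \<and>
             j \<le> (\<Sum>k=0..r. \<lceil>real_of_int (i * mu * lam k) / real m\<rceil> * int (d k)) - 2})"
proof -
  interpret iota: field_hom \<iota> by (rule assms(8))
  note K = assms(9) and Kx = assms(11) and gen = assms(12) and \<alpha> = assms(14)
  have prm: "lead_coeff (p i) = 1" "irreducible (p i)" "d i = degree (p i)" if "i \<in> {1..r}" for i
    using assms(16,22) that by auto
  have m: "m \<ge> 2" by (rule assms(5))
  \<comment> \<open>q vanishes in the field because it is the size of a subfield, and m is prime to
    q.\<close>
  have m_unit: "(of_nat m :: 'k) \<noteq> 0"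
  proof
    assume "(of_nat m :: 'k) = 0"
    have "q > 0" using assms(1) by (rule primepow_gt_0_nat)
    then have "finite Fq" using assms(3) by (metis card.infinite less_irrefl)
    then have q: "(of_nat q :: 'k) = 0" using of_nat_card_subfield[OF assms(2)] assms(3) by simp
    obtain a b where "a * int m + b * int q = 1"
      using assms(6) bezout_int[of "int m" "int q"] by auto
    then have "of_int a * (of_nat m :: 'k) + of_int b * of_nat q = 1"
      by (metis of_int_1 of_int_add of_int_mult of_int_of_nat_eq)
    then show False using q \<open>of_nat m = 0\<close> by simp
  qed
  have rat: "ratfun \<iota> x"
  proof (unfold_locales)
    fix h assume h: "poly (map_poly \<iota> h) x = 0"
    show "h = 0"
    proof (rule ccontr)
      assume "h \<noteq> 0"
      then have "map_poly \<iota> h \<noteq> 0" by simp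
      moreover have "set (coeffs (map_poly \<iota> h)) \<subseteq> K" by (auto simp: K)
      ultimately show False using h assms(10) unfolding algebraic_over_def by blast
    qed
  qed
  have deg_sum: "(\<Sum>k=0..r. lam k * int (d k)) = 0"
    using assms(21,23) by (simp add: sum.atLeast_Suc_atMost)
  \<comment> \<open>The index s is dropped because P_s becomes the pole of the generator; if s > 0,
    the index 0 stays and needs a polynomial of its own.\<close>
  define I where "I = {0..r} - {s}"
  have I_sum: "(\<Sum>k\<in>I. lam k * int (d k)) = - lam s"
    using deg_sum assms(26,27) by (simp add: I_def sum.remove[of "{0..r}" s])
  have coprime: "coprime (int m) (lam s)" using assms(28) by (simp add: coprime_iff_gcd_eq_1)
  have "gaps K UNIV Q = UNIV - {m * e + (\<Sum>k\<in>I. d k * nat ((int i * lam k) mod int m)) | e i. i < m}"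
  proof -
    \<comment> \<open>The cases s = 0 and s > 0 differ only in the generator t and in the
      polynomials p' that describe the places other than P_s.\<close>
    have *: "gaps K UNIV Q = UNIV - {m * e + (\<Sum>k\<in>I. d k * nat ((int i * lam k) mod int m)) | e i. i < m}"
      if t: "ratfun \<iota> t" and xt: "\<And>L. is_subfield L \<Longrightarrow> range \<iota> \<subseteq> L \<Longrightarrow> x \<in> L \<longleftrightarrow> t \<in> L"
        and irred: "\<And>k. k \<in> I \<Longrightarrow> irreducible (p' k)"
        and ndvd: "\<And>k j. k \<in> I \<Longrightarrow> j \<in> I \<Longrightarrow> k \<noteq> j \<Longrightarrow> \<not> p' k dvd p' j"
        and deg: "\<And>k. k \<in> I \<Longrightarrow> degree (p' k) = d k"
        and f: "f = \<iota> \<alpha> * (\<Prod>k\<in>I. ratfun.ev \<iota> t (p' k) powi lam k)"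
        and P: "P s = the_pole K Kx t \<or> P s = the_zero K Kx (inverse t)"
      for t p'
    proof -
      interpret t: ratfun \<iota> t by (rule t)
      have Kx': "Kx = range t.phi"
        unfolding Kx K
      proof (rule t.adjoin_eq)
        show "x \<in> range t.phi"
          using xt[OF t.is_subfield_phi t.range_iota_sub_phi] t.t_in_phi by blast
      qed (use xt in blast)
      have "y ^ m = t.phi (factored \<alpha> I p' lam)"
      proof -
        have "t.phi (\<Prod>k\<in>I. to_fract (p' k) powi lam k) = (\<Prod>k\<in>I. t.ev (p' k) powi lam k)"
          unfolding t.phi.hom_prod t.phi_powi by simp
        then show ?thesis unfolding factored_def t.phi.hom_mult assms(19) f by simp
      qed
      moreover have "L = UNIV" if L: "is_subfield L" "range t.phi \<subseteq> L" "y \<in> L" for L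
      proof -
        have "range \<iota> \<subseteq> L" "t \<in> L" using L(2) t.range_iota_sub_phi t.t_in_phi by auto
        then have "K \<union> {x, y} \<subseteq> L" using xt[OF L(1)] L(3) by (simp add: K)
        then have "adjoin K {x, y} \<subseteq> L" unfolding adjoin_def by (rule hull_minimal) (rule L(1))
        then show ?thesis using gen by auto
      qed
      moreover have "coprime (\<Sum>k\<in>I. lam k * int (degree (p' k))) (int m)"
        using coprime I_sum deg by (simp add: coprime_commute)
      moreover have "finite I" by (simp add: I_def)
      ultimately obtain A where A: "vring UNIV A" "range \<iota> \<subseteq> A" "t \<notin> A"
        "weierstrass_semigroup (range \<iota>) UNIV
          (the_place_above (range \<iota>) UNIV (vring.max_ideal (A \<inter> range t.phi))) =
          {m * e + (\<Sum>k\<in>I. degree (p' k) * nat ((int i * lam k) mod int m)) | e i. i < m}"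
        using t.totally_ramified_semigroup[where I = I and p = p' and y = y and lam = lam,
            OF m m_unit _ irred ndvd \<alpha>] by blast
      have "P s = vring.max_ideal (A \<inter> range t.phi)"
        using P t.the_infinite_place[OF A(1-3)] unfolding Kx' K by auto
      then have "weierstrass_semigroup K UNIV Q =
          {m * e + (\<Sum>k\<in>I. degree (p' k) * nat ((int i * lam k) mod int m)) | e i. i < m}"
        using A(4) unfolding assms(29) K by simp
      also have "\<dots> = {m * e + (\<Sum>k\<in>I. d k * nat ((int i * lam k) mod int m)) | e i. i < m}"
        using deg by simp
      finally show ?thesis by (simp add: gaps_def)
    qed
    have p_ndvd: "\<not> p k dvd p j" if "k \<in> {1..r}" "j \<in> {1..r}" "k \<noteq> j" for k j
    proof
      assume "p k dvd p j"
      then have "p k = p j" using monic_irreducible_dvd_eq prm that by blast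
      then show False using inj_onD[OF assms(17)] that by blast
    qed
    show ?thesis
    proof (cases "s = 0")
      case True
      then have I: "I = {1..r}" by (auto simp: I_def)
      show ?thesis
      proof (rule *[OF rat, of p])
        show "f = \<iota> \<alpha> * (\<Prod>k\<in>I. ratfun.ev \<iota> x (p k) powi lam k)"
          unfolding assms(18) I ratfun.ev_def[OF rat] ..
        show "P s = the_pole K Kx x \<or> P s = the_zero K Kx (inverse x)" using assms(24) True by simp
      qed (use prm p_ndvd in \<open>auto simp: I\<close>)
    next
      case False
      then have s: "s \<in> {1..r}" using assms(26) by auto
      obtain a where ps: "p s = [:- a, 1:]"
      proof -
        have deg: "degree (p s) = 1" using prm(3)[OF s] assms(27) by simp
        obtain b g where bg: "p s = pCons b g" by (cases "p s")
        then have "degree g = 0" using deg by (auto split: if_splits)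
        then obtain c where "g = [:c:]" by (rule degree_eq_zeroE)
        then have bc: "p s = [:b, c:]" using bg by simp
        then have "c = 1" using prm(1)[OF s] deg by (auto split: if_splits)
        then show thesis using that[of "- b"] bc by simp
      qed
      define w where "w = x - \<iota> a"
      \<comment> \<open>P_s is the zero of p_s = X - a, hence the pole of 1 / (x - a).\<close>
      define t where "t = inverse w"
      interpret x: ratfun \<iota> x by (rule rat)
      interpret w: ratfun \<iota> w unfolding w_def by (rule ratfun_translate[OF rat])
      have rt: "ratfun \<iota> t" unfolding t_def by (rule w.ratfun_inverse)
      interpret t: ratfun \<iota> t by (rule rt)
      \<comment> \<open>The pole P_0 of x is the zero of t, whence the polynomial X for the index
        0.\<close>
      define p' where "p' k = (if k = 0 then [:0, 1:] else flip_poly a (p k))" for k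
      have pa: "poly (p k) a \<noteq> 0" if "k \<in> {1..r}" "k \<noteq> s" for k
        using p_ndvd[OF s that(1)] that(2) by (auto simp: ps poly_eq_0_iff_dvd)
      \<comment> \<open>p_k(x) = p_k(a + 1/t) has denominator t^(d_k), and its numerator is the
        flipped polynomial at t.\<close>
      have p'_ev: "poly (map_poly \<iota> (p k)) x = t.ev (p' k) * t powi (- int (d k))"
        if k: "k \<in> {1..r}" "k \<noteq> s" for k
      proof -
        define g where "g = pcompose (p k) [:a, 1:]"
        have "poly (map_poly \<iota> (p k)) x = poly (map_poly \<iota> g) w"
          by (simp add: g_def w_def hom_distribs poly_pcompose)
        moreover have "t.ev (p' k) = t ^ degree g * poly (map_poly \<iota> g) (inverse t)"
        proof -
          have "map_poly \<iota> (reflect_poly g) = reflect_poly (map_poly \<iota> g)"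
            by (intro poly_eqI) (simp add: coeff_reflect_poly)
          then have "t.ev (p' k) = poly (reflect_poly (map_poly \<iota> g)) t"
            using k by (simp add: t.ev_def p'_def flip_poly_def g_def)
          then show ?thesis using t.t_nonzero by (simp add: poly_reflect_poly_nz)
        qed
        moreover have "degree g = d k" using prm(3)[OF k(1)] by (simp add: g_def degree_pcompose)
        ultimately show ?thesis
          using t.t_nonzero by (simp add: t_def power_int_minus field_simps)
      qed
      have ps_ev: "poly (map_poly \<iota> (p s)) x = inverse t"
        by (simp add: ps t_def w_def hom_distribs)
      have f: "f = \<iota> \<alpha> * (\<Prod>k\<in>I. t.ev (p' k) powi lam k)"
      proof -
        define J where "J = {1..r} - {s}"
        have IJ: "I = insert 0 J" "0 \<notin> J" "finite J" using False by (auto simp: I_def J_def)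
        have "(\<Prod>i=1..r. poly (map_poly \<iota> (p i)) x powi lam i) =
            inverse t powi lam s * (\<Prod>i\<in>J. poly (map_poly \<iota> (p i)) x powi lam i)"
          using prod.remove[OF _ s, of "\<lambda>i. poly (map_poly \<iota> (p i)) x powi lam i"]
          unfolding J_def ps_ev by simp
        also have "(\<Prod>i\<in>J. poly (map_poly \<iota> (p i)) x powi lam i) =
            (\<Prod>i\<in>J. t.ev (p' i) powi lam i * t powi (- int (d i) * lam i))"
        proof (intro prod.cong refl)
          fix i assume "i \<in> J"
          then have "poly (map_poly \<iota> (p i)) x = t.ev (p' i) * t powi (- int (d i))"
            by (intro p'_ev) (auto simp: J_def)
          then show "poly (map_poly \<iota> (p i)) x powi lam i =
              t.ev (p' i) powi lam i * t powi (- int (d i) * lam i)"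
            by (simp only: power_int_mult_distrib power_int_mult)
        qed
        also have "\<dots> = (\<Prod>i\<in>J. t.ev (p' i) powi lam i) * t powi (\<Sum>i\<in>J. - int (d i) * lam i)"
        proof -
          have "(\<Prod>i\<in>J. t powi g i) = t powi (\<Sum>i\<in>J. g i)" for g
            using IJ(3) by (induction J rule: finite_induct) (auto simp: power_int_add t.t_nonzero)
          then show ?thesis by (simp only: prod.distrib)
        qed
        also have "inverse t powi lam s * ((\<Prod>i\<in>J. t.ev (p' i) powi lam i) * t powi (\<Sum>i\<in>J. - int (d i) * lam i)) =
            t powi (- lam s + (\<Sum>i\<in>J. - int (d i) * lam i)) * (\<Prod>i\<in>J. t.ev (p' i) powi lam i)"
        proof -
          have "t powi (- lam s + (\<Sum>i\<in>J. - int (d i) * lam i)) =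
              inverse t powi lam s * t powi (\<Sum>i\<in>J. - int (d i) * lam i)"
            using t.t_nonzero by (subst power_int_add) (auto simp: power_int_minus power_int_inverse)
          then show ?thesis by (simp only: mult_ac)
        qed
        \<comment> \<open>The powers of t from p_s and from the denominators combine to t^(lam_0),
          because d_0 = d_s = 1 and all lam_k d_k sum to 0.\<close>
        also have "- lam s + (\<Sum>i\<in>J. - int (d i) * lam i) = lam 0"
          using I_sum IJ assms(21) by (simp add: sum_negf mult.commute)
        also have "t powi lam 0 * (\<Prod>i\<in>J. t.ev (p' i) powi lam i) = (\<Prod>k\<in>I. t.ev (p' k) powi lam k)"
          using IJ by (simp add: p'_def)
        finally show ?thesis unfolding assms(18) by simp
      qed
      show ?thesis
      proof (rule *[OF rt _ _ _ _ f])
        fix L assume L: "is_subfield L" "range \<iota> \<subseteq> L"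
        have a: "\<iota> a \<in> L" using L(2) by auto
        show "x \<in> L \<longleftrightarrow> t \<in> L"
        proof
          assume "x \<in> L"
          then show "t \<in> L" unfolding t_def w_def using a by (intro is_subfieldD[OF L(1)])
        next
          assume "t \<in> L"
          then have "inverse t + \<iota> a \<in> L" using a by (intro is_subfieldD[OF L(1)])
          then show "x \<in> L" by (simp add: t_def w_def)
        qed
      next
        have X: "irreducible [:0, 1 :: 'k:]" by (rule irreducible_linear_field_poly) simp
        have coeff0: "\<not> [:0, 1:] dvd p' j" if "j \<in> I" "j \<noteq> 0" for j
        proof
          assume "[:0, 1:] dvd p' j"
          then have "poly (p' j) 0 = 0" using dvd_iff_poly_eq_0[of 0 "p' j"] by simp
          moreover have "p j \<noteq> 0" using prm(1)[of j] that by (auto simp: I_def)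
          ultimately show False
            using coeff_0_flip_poly[of "p j" a] that by (simp add: p'_def poly_0_coeff_0)
        qed
        show irred: "irreducible (p' k)" if "k \<in> I" for k
          using that X irreducible_flip_poly[OF prm(2) pa] by (auto simp: p'_def I_def)
        show "degree (p' k) = d k" if "k \<in> I" for k
          using that prm(3) assms(21) degree_flip_poly[OF pa, of k] by (auto simp: p'_def I_def)
        show "\<not> p' k dvd p' j" if kj: "k \<in> I" "j \<in> I" "k \<noteq> j" for k j
        proof
          assume dvd: "p' k dvd p' j"
          consider "k = 0" | "j = 0" | "k \<noteq> 0" "j \<noteq> 0" by blast
          then show False
          proof cases
            case 1
            then show False using coeff0[OF kj(2)] kj(3) dvd by (simp add: p'_def)
          next
            case 2
            from dvd obtain c where c: "p' j = p' k * c" by (rule dvdE)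
            have "\<not> is_unit (p' k)" using irred[OF kj(1)] by (rule irreducible_not_unit)
            then have "is_unit c" using irreducibleD[OF irred[OF kj(2)] c] by blast
            then have "p' j dvd p' k" unfolding c by (simp add: mult_unit_dvd_iff)
            then show False using coeff0[OF kj(1)] 2 kj(3) by (simp add: p'_def)
          next
            case 3
            then have k: "k \<in> {1..r}" "k \<noteq> s" and j: "j \<in> {1..r}" "j \<noteq> s"
              using kj by (simp_all add: I_def)
            have "flip_poly a (p k) dvd flip_poly a (p j)" using dvd 3 by (simp add: p'_def)
            from flip_poly_dvdD[OF pa[OF k] pa[OF j] this]
            show False using p_ndvd[OF k(1) j(1) kj(3)] by blast
          qed
        qed
        show "P s = the_pole K Kx t \<or> P s = the_zero K Kx (inverse t)"
          using assms(25) s by (simp add: ps_ev)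
      qed
    qed
  qed
  then have gaps: "gaps K UNIV Q = UNIV -
      {m * e + (\<Sum>k\<in>{0..r} - {s}. d k * nat ((int i * lam k) mod int m)) | e i. i < m}"
    unfolding I_def .
  note gap_set = gap_set_eq[OF m assms(26,27) coprime _ deg_sum refl, folded gaps]
  show ?thesis
  proof (intro conjI allI impI)
    fix mu :: int
    assume "gcd (int m) mu = 1"
    then have "coprime (int m) mu" by (simp add: coprime_iff_gcd_eq_1)
    from gap_set[OF this] show "int ` gaps K UNIV Q =
          {int m * j + i * mu * lam s | i j.
             1 \<le> i \<and> i \<le> int m - 1 \<and>
             \<lceil>real_of_int (- (i * mu * lam s)) / real m\<rceil> \<le> j \<and>
             j \<le> (\<Sum>k=0..r. \<lceil>real_of_int (i * mu * lam k) / real m\<rceil> * int (d k))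
                    - \<lceil>real_of_int (i * mu * lam s) / real m\<rceil> - 1}" .
  next
    fix mu :: int
    assume mu: "[mu * lam s = 1] (mod int m)"
    \<comment> \<open>An inverse of lam_s is itself prime to m, so the general formula covers
      it.\<close>
    then have "coprime (mu * lam s) (int m)"
      using cong_imp_coprime[OF cong_sym[OF mu]] by simp
    then have "coprime (int m) mu" by (simp add: coprime_commute)
    from gap_set[OF this] gap_set_inverse[OF m mu, of "\<lambda>i. \<Sum>k=0..r. \<lceil>real_of_int (i * mu * lam k) / real m\<rceil> * int (d k)"]
    show "int ` gaps K UNIV Q =
          {int m * j + i | i j.
             1 \<le> i \<and> i \<le> int m - 1 \<and> 0 \<le> j \<and>
             j \<le> (\<Sum>k=0..r. \<lceil>real_of_int (i * mu * lam k) / real m\<rceil> * int (d k)) - 2}"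
      by (simp only: mult.assoc)
  qed
qed

end
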